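(* Let $\Sigma$ be a planar model with $T$-invariant ergodic selection measure $\mathbb P$. Then for every $\varepsilon,\delta>0$ and $q\in\mathbb N$, $\lim_{n\to\infty}\mathbb P(\mathcal G^{(n)}_{\varepsilon,\delta,q})=1$, where $$\mathcal G^{(n)}_{\varepsilon,\delta,q}=\Big\{\omega:\ \mathbf P_{i=n}\Big(\tfrac1{qn}\big|H(\nu^{(\omega,n')}_{x,i}*\tau^{(\omega,n')},\mathcal D_{(q+1)n})-H(\tau^{(\omega,n')},\mathcal D_{(q+1)n})\big|<\delta\Big)>1-\varepsilon\Big\},\quad n'=n'(\omega).$$
   Context: Planar model $\Sigma$: $I$ finite; $f^{(i)}_j(z)=\lambda_iz+t^{(i)}_j$, $\lambda_i=r_i\varphi_i$, $0<r_i<1$, $|\varphi_i|=1$; positive probability vectors $p_i$; $\mathbb P$ on $\Omega=I^{\mathbb N}$, $T$ the shift. For $u\in\mathbb X^{(\omega)}_n=\prod_{j\le n}\{1,\dots,k_{\omega_j}\}$, $f^{(\omega)}_u=f^{(\omega_1)}_{u_1}\circ\dots\circ f^{(\omega_n)}_{u_n}$, $p^{(\omega)}_u=\prod_jp^{(\omega_j)}_{u_j}$. $\eta^{(\omega)}$ is the law of $\sum_{n\ge1}(\prod_{j<n}\lambda_{\omega_j})t^{(\omega_n)}_{u_n}$, $u_n$ independent with laws $p_{\omega_n}$. $\nu^{(\omega,n)}=\sum_{u\in\mathbb X^{(\omega)}_n}p^{(\omega)}_u\delta_{f^{(\omega)}_u(0)}$ and $\tau^{(\omega,n)}$ is the pushforward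 of $\eta^{(T^n\omega)}$ under $z\mapsto\lambda_{\omega_1}\cdots\lambda_{\omega_n}z$. Fix $R>0$ with $\overline{f^{(i)}_j(B(0,R))}\subset B(0,R)$ and $2R\min r_i>1/2$; $n'(\omega)$ is the natural number with $2R\prod_{i=1}^{n'}r_{\omega_i}\le2^{-n}\le2R\prod_{i=1}^{n'-1}r_{\omega_i}$. $\mathcal D_k$ dyadic squares of side $2^{-k}$, $H$ Shannon entropy (log base 2), $*$ convolution; raw component $\mu_{x,i}=\mu|_{D_i(x)}/\mu(D_i(x))$ and $\mathbf P_{i=n}(\mu_{x,i}\in A)=\mu(\{x:\mu_{x,n}\in A\})$. *)

theory Defs
  imports "HOL-Probability.Probability"
begin

text \<open>Conventions: sequences omega in Omega = I^N are functions nat => 'i, indexed from 0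
  (so omega 0 is the paper's omega_1); the maps of the i-th IFS are indexed by
  j in {0..<k i} (the paper's 1..k_i).\<close>

definition planar_model ::
  "('i::finite \<Rightarrow> complex) \<Rightarrow> ('i \<Rightarrow> nat) \<Rightarrow> ('i \<Rightarrow> nat \<Rightarrow> complex) \<Rightarrow> ('i \<Rightarrow> nat \<Rightarrow> real) \<Rightarrow> bool"
  where "planar_model lam k t p \<longleftrightarrow>
     (\<forall>i. 0 < cmod (lam i) \<and> cmod (lam i) < 1) \<and>
     (\<forall>i. 1 \<le> k i) \<and>
     (\<forall>i. \<forall>j<k i. 0 < p i j) \<and>
     (\<forall>i. (\<Sum>j<k i. p i j) = 1)"

definition ifs_map :: "('i \<Rightarrow> complex) \<Rightarrow> ('i \<Rightarrow> nat \<Rightarrow> complex) \<Rightarrow> 'i \<Rightarrow> nat \<Rightarrow> complex \<Rightarrow> complex"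
  where "ifs_map lam t i j z = lam i * z + t i j"

fun comp_map :: "('i \<Rightarrow> complex) \<Rightarrow> ('i \<Rightarrow> nat \<Rightarrow> complex) \<Rightarrow> (nat \<Rightarrow> 'i) \<Rightarrow> (nat \<Rightarrow> nat) \<Rightarrow> nat \<Rightarrow> complex \<Rightarrow> complex"
  where
    "comp_map lam t \<omega> u 0 = id"
  | "comp_map lam t \<omega> u (Suc n) = comp_map lam t \<omega> u n \<circ> ifs_map lam t (\<omega> n) (u n)"

definition digit_pmf :: "('i \<Rightarrow> nat) \<Rightarrow> ('i \<Rightarrow> nat \<Rightarrow> real) \<Rightarrow> 'i \<Rightarrow> nat pmf"
  where "digit_pmf k p i = embed_pmf (\<lambda>j. if j < k i then p i j else 0)"

definition shift :: "(nat \<Rightarrow> 'i) \<Rightarrow> (nat \<Rightarrow> 'i)"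
  where "shift \<omega> = (\<lambda>m. \<omega> (Suc m))"

text \<open>nu^{(omega,n)} = sum_{u in X_n} p_u delta_{f_u(0)}, as the image of the
  product of the digit distributions.\<close>
definition nu_meas :: "('i \<Rightarrow> complex) \<Rightarrow> ('i \<Rightarrow> nat) \<Rightarrow> ('i \<Rightarrow> nat \<Rightarrow> complex) \<Rightarrow> ('i \<Rightarrow> nat \<Rightarrow> real)
    \<Rightarrow> (nat \<Rightarrow> 'i) \<Rightarrow> nat \<Rightarrow> complex measure"
  where "nu_meas lam k t p \<omega> n =
    distr (PiM {..<n} (\<lambda>j. measure_pmf (digit_pmf k p (\<omega> j)))) borel
          (\<lambda>u. comp_map lam t \<omega> u n 0)"

definition eta_meas :: "('i \<Rightarrow> complex) \<Rightarrow> ('i \<Rightarrow> nat) \<Rightarrow> ('i \<Rightarrow> nat \<Rightarrow> complex) \<Rightarrow> ('i \<Rightarrow> nat \<Rightarrow> real)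
    \<Rightarrow> (nat \<Rightarrow> 'i) \<Rightarrow> complex measure"
  where "eta_meas lam k t p \<omega> =
    distr (PiM UNIV (\<lambda>j. measure_pmf (digit_pmf k p (\<omega> j)))) borel
          (\<lambda>u. \<Sum>m. (\<Prod>j<m. lam (\<omega> j)) * t (\<omega> m) (u m))"

definition tau_meas :: "('i \<Rightarrow> complex) \<Rightarrow> ('i \<Rightarrow> nat) \<Rightarrow> ('i \<Rightarrow> nat \<Rightarrow> complex) \<Rightarrow> ('i \<Rightarrow> nat \<Rightarrow> real)
    \<Rightarrow> (nat \<Rightarrow> 'i) \<Rightarrow> nat \<Rightarrow> complex measure"
  where "tau_meas lam k t p \<omega> n =
    distr (eta_meas lam k t p ((shift ^^ n) \<omega>)) borel (\<lambda>z. (\<Prod>j<n. lam (\<omega> j)) * z)"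

text \<open>n'(omega): the natural number n' with
  2R prod_{i<=n'} r_{omega_i} <= 2^{-n} <= 2R prod_{i<=n'-1} r_{omega_i};
  we take the least such number.\<close>
definition n_prime :: "('i \<Rightarrow> complex) \<Rightarrow> real \<Rightarrow> (nat \<Rightarrow> 'i) \<Rightarrow> nat \<Rightarrow> nat"
  where "n_prime lam R \<omega> n =
    (LEAST m. 2 * R * (\<Prod>j<m. cmod (lam (\<omega> j))) \<le> 2 powr (- real n))"

definition dyadic_square :: "nat \<Rightarrow> int \<Rightarrow> int \<Rightarrow> complex set"
  where "dyadic_square k a b =
    {z. real_of_int a / 2^k \<le> Re z \<and> Re z < real_of_int (a + 1) / 2^k \<and>
        real_of_int b / 2^k \<le> Im z \<and> Im z < real_of_int (b + 1) / 2^k}"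

definition dyadic_cell :: "nat \<Rightarrow> complex \<Rightarrow> complex set"
  where "dyadic_cell k x = dyadic_square k \<lfloor>Re x * 2^k\<rfloor> \<lfloor>Im x * 2^k\<rfloor>"

definition dyadic_entropy :: "complex measure \<Rightarrow> nat \<Rightarrow> real"
  where "dyadic_entropy \<mu> k =
    - (\<Sum>\<^sub>\<infinity>(a, b)\<in>(UNIV :: (int \<times> int) set).
         (let m = measure \<mu> (dyadic_square k a b) in if m = 0 then 0 else m * log 2 m))"

definition conv :: "complex measure \<Rightarrow> complex measure \<Rightarrow> complex measure"
  where "conv M N = distr (M \<Otimes>\<^sub>M N) borel (\<lambda>(x, y). x + y)"

definition component :: "complex measure \<Rightarrow> complex \<Rightarrow> nat \<Rightarrow> complex measure"
  where "component \<mu> x i =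
    density \<mu> (\<lambda>y. ennreal (indicator (dyadic_cell i x) y / measure \<mu> (dyadic_cell i x)))"

definition comp_prob :: "complex measure \<Rightarrow> nat \<Rightarrow> (complex measure \<Rightarrow> bool) \<Rightarrow> real"
  where "comp_prob \<mu> n A = measure \<mu> {x \<in> space \<mu>. A (component \<mu> x n)}"

definition shift_invariant_ergodic :: "(nat \<Rightarrow> 'i) measure \<Rightarrow> bool"
  where "shift_invariant_ergodic P \<longleftrightarrow>
     prob_space P \<and>
     sets P = sets (PiM UNIV (\<lambda>_::nat. count_space (UNIV :: 'i set))) \<and>
     shift \<in> measurable P P \<and> distr P P shift = P \<and>
     (\<forall>A\<in>sets P. shift -` A \<inter> space P = A \<longrightarrow> measure P A = 0 \<or> measure P A = 1)"

definition good_set ::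
  "('i \<Rightarrow> complex) \<Rightarrow> ('i \<Rightarrow> nat) \<Rightarrow> ('i \<Rightarrow> nat \<Rightarrow> complex) \<Rightarrow> ('i \<Rightarrow> nat \<Rightarrow> real) \<Rightarrow> real
     \<Rightarrow> real \<Rightarrow> real \<Rightarrow> nat \<Rightarrow> nat \<Rightarrow> (nat \<Rightarrow> 'i) set"
  where "good_set lam k t p R \<epsilon> \<delta> q n =
    {\<omega>. let n' = n_prime lam R \<omega> n;
           \<nu> = nu_meas lam k t p \<omega> n';
           \<tau> = tau_meas lam k t p \<omega> n'
       in comp_prob \<nu> n (\<lambda>c. 1 / (real q * real n) *
              \<bar>dyadic_entropy (conv c \<tau>) ((q + 1) * n) - dyadic_entropy \<tau> ((q + 1) * n)\<bar> < \<delta>)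
          > 1 - \<epsilon>}"

end

theory Submission
  imports Defs
begin

text \<open>
  Write \<open>h\<^sub>m(\<omega>)\<close> for the entropy of \<open>\<nu>\<^bsup>(\<omega>,m)\<^esup>\<close> at the scale \<open>\<lambda>\<^bsub>\<omega>\<^sub>1\<^esub>\<cdots>\<lambda>\<^bsub>\<omega>\<^sub>m\<^esub>\<close>. A chain rule argument gives
  \<open>h\<^sub>m\<^sub>+\<^sub>d(\<omega>) \<ge> h\<^sub>m(\<omega>) + h\<^sub>d(T\<^sup>m\<omega>) - C\<close>. The excess of the left side over the right side is bounded
  below, and by shift invariance and Fekete's lemma its mean is sublinear; hence it is sublinear
  in probability for each pair of levels.
  The same chain rule bounds the average over the level-\<open>n\<close> components \<open>\<theta>\<close> of
  \<open>H(\<theta> * \<tau>) - H(\<tau>)\<close> by the excess at the levels \<open>n'(\<omega>)\<close> and \<open>((q+1)n)'(\<omega>)\<close>, while each single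
  difference is at least a constant since entropy is concave, so Markov's inequality applies.
  The levels are random, but changing them by \<open>O(\<kappa>n)\<close> changes all entropies by \<open>O(\<kappa>n)\<close>, so they can be
  rounded to one of boundedly many multiples of \<open>\<kappa>n\<close> and a union bound suffices.
\<close>

section \<open>Entropy of finitely valued random variables\<close>

text \<open>Two obstacles shape the proof. The maps contain rotations, so the grid natural for a
  cylinder is a rotated one. This is harmless because entropies matter only up to additive
  constants: two variables whose values determine each other up to C choices have entropies within
  \<open>log 2 C\<close>, and squares of comparable side in any position meet boundedly many of each
  other. Hence every comparison (rotation, translation, truncation of a series, dyadic versus
  natural scale) is a count of cells, and the errors disappear after division by n. The second
  obstacle is that the shift by the random level n'(\<omega>) need not preserve the selection
  measure, so means are computed for deterministic levels; this is why the sublinear bound is first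
  proved on a grid of levels. The grid step is about n/L with L fixed, so the number of grid levels
  needed stays bounded as n grows. Finally, measurability of the good set needs its own argument:
  \<open>measure\<close> returns 0 off the sigma-algebra, so the inclusion of a large set in a
  nonmeasurable good set would prove nothing.\<close>

definition ent_fun :: "real \<Rightarrow> real" where "ent_fun x = - x * log 2 x"

lemma ent_fun_0 [simp]: "ent_fun 0 = 0" by (simp add: ent_fun_def)

lemma ent_fun_nonneg: "0 \<le> x \<Longrightarrow> x \<le> 1 \<Longrightarrow> 0 \<le> ent_fun x"
  by (cases "x = 0") (auto simp: ent_fun_def mult_nonneg_nonpos)

lemma ent_fun_mult:
  assumes "0 \<le> p" "0 \<le> a"
  shows "ent_fun (p * a) = p * ent_fun a + a * ent_fun p"
  using assms by (cases "p = 0 \<or> a = 0") (auto simp: ent_fun_def log_mult algebra_simps)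

text \<open>The concave function lies below its tangent at A; this is
  \<open>ln x \<le> x - 1\<close> in base 2. Summed with one common A, it yields both the bound by
  the uniform distribution and Jensen's inequality, because the right-hand sides then add up to at
  most 0.\<close>

lemma ent_fun_tangent:
  assumes "0 \<le> a" "0 < A"
  shows "ent_fun a + a * log 2 A \<le> (A - a) / ln 2"
proof (cases "a = 0")
  case False
  then have a: "a > 0" using assms by simp
  have "ln (A / a) \<le> A / a - 1" using a assms by (intro ln_le_minus_one) auto
  then have "a * ln (A / a) \<le> a * (A / a - 1)" using a by (intro mult_left_mono) auto
  also have "\<dots> = A - a" using a by (simp add: field_simps)
  finally have "a * ln (A / a) / ln 2 \<le> (A - a) / ln 2" by (intro divide_right_mono) auto
  moreover have "a * ln (A / a) / ln 2 = ent_fun a + a * log 2 A"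
    using a assms by (simp add: ent_fun_def log_def ln_div field_simps)
  ultimately show ?thesis by simp
qed (use assms in auto)

text \<open>Merging atoms loses information: every a j is at most the total, so its negative
  logarithm is at least that of the total.\<close>

lemma ent_fun_sum_le:
  assumes "finite J" "\<And>j. j \<in> J \<Longrightarrow> 0 \<le> a j"
  shows "ent_fun (\<Sum>j\<in>J. a j) \<le> (\<Sum>j\<in>J. ent_fun (a j))"
proof -
  let ?A = "\<Sum>j\<in>J. a j"
  have "a j * - log 2 ?A \<le> ent_fun (a j)" if j: "j \<in> J" for j
  proof (cases "a j = 0")
    case False
    with assms j have "0 < a j" by force
    moreover have "a j \<le> ?A" using assms j by (intro member_le_sum) auto
    ultimately show ?thesis by (simp add: ent_fun_def mult_left_mono)
  qed auto
  then have "(\<Sum>j\<in>J. a j * - log 2 ?A) \<le> (\<Sum>j\<in>J. ent_fun (a j))" by (intro sum_mono)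
  then show ?thesis by (simp only: sum_distrib_right[symmetric]) (simp add: ent_fun_def)
qed

text \<open>A mass spread over at most C atoms gains at most log C bits per unit of mass. It is
  stated for unnormalised masses, the form of a conditional distribution before division by the
  probability of the condition.\<close>

lemma sum_ent_fun_le:
  assumes fin: "finite J" and nn: "\<And>j. j \<in> J \<Longrightarrow> 0 \<le> a j"
    and card: "real (card {j\<in>J. a j \<noteq> 0}) \<le> C" and C: "0 < C"
  shows "(\<Sum>j\<in>J. ent_fun (a j)) \<le> ent_fun (\<Sum>j\<in>J. a j) + (\<Sum>j\<in>J. a j) * log 2 C"
proof (cases "(\<Sum>j\<in>J. a j) = 0")
  case True
  then have "\<forall>j\<in>J. a j = 0" using fin nn by (simp add: sum_nonneg_eq_0_iff)
  then show ?thesis by simp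
next
  case False
  define A where "A = (\<Sum>j\<in>J. a j)"
  define J' where "J' = {j\<in>J. a j \<noteq> 0}"
  have A: "A > 0" using False nn sum_nonneg[of J a] by (force simp: A_def)
  have s: "(\<Sum>j\<in>J. g (a j)) = (\<Sum>j\<in>J'. g (a j))" if "g 0 = 0" for g :: "real \<Rightarrow> real"
    unfolding J'_def using fin that by (intro sum.mono_neutral_right) auto
  have A': "A = (\<Sum>j\<in>J'. a j)" using s[of "\<lambda>x. x"] by (simp add: A_def)
  \<comment> \<open>The tangent is taken at A / C, the common size of C equal atoms of total mass
    A.\<close>
  have "(\<Sum>j\<in>J'. ent_fun (a j) + a j * log 2 (A / C)) \<le> (\<Sum>j\<in>J'. (A / C - a j) / ln 2)"
    using nn A C by (intro sum_mono ent_fun_tangent) (auto simp: J'_def)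
  also have "\<dots> = (card J' * (A / C) - A) / ln 2"
    by (simp add: sum_divide_distrib[symmetric] sum_subtractf A')
  also have "\<dots> \<le> 0"
  proof -
    have "card J' * (A / C) \<le> C * (A / C)" using card A C by (intro mult_right_mono) (auto simp: J'_def)
    then show ?thesis using C by (intro divide_nonpos_nonneg) auto
  qed
  finally have "(\<Sum>j\<in>J'. ent_fun (a j)) + A * log 2 (A / C) \<le> 0"
    by (simp add: sum.distrib sum_distrib_right[symmetric] A'[symmetric])
  then have "(\<Sum>j\<in>J. ent_fun (a j)) + A * log 2 (A / C) \<le> 0" using s[of ent_fun] by simp
  then show ?thesis using A C unfolding A_def[symmetric]
    by (simp add: log_divide ent_fun_def algebra_simps)
qed

text \<open>Jensen's inequality from the tangent at the mean: the weighted deviations from the mean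
  cancel.\<close>

lemma ent_fun_concave_sum:
  assumes fin: "finite J" and nn: "\<And>j. j \<in> J \<Longrightarrow> 0 \<le> a j" "\<And>j. j \<in> J \<Longrightarrow> 0 \<le> c j"
    and c: "(\<Sum>j\<in>J. c j) = 1"
  shows "(\<Sum>j\<in>J. c j * ent_fun (a j)) \<le> ent_fun (\<Sum>j\<in>J. c j * a j)"
proof (cases "(\<Sum>j\<in>J. c j * a j) = 0")
  case True
  then have "\<forall>j\<in>J. c j * a j = 0" using fin nn by (simp add: sum_nonneg_eq_0_iff)
  then have "\<forall>j\<in>J. c j * ent_fun (a j) = 0" by auto
  then have "(\<Sum>j\<in>J. c j * ent_fun (a j)) = 0" by (intro sum.neutral)
  then show ?thesis using True by simp
next
  case False
  define A where "A = (\<Sum>j\<in>J. c j * a j)"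
  have A: "A > 0" using False nn sum_nonneg[of J "\<lambda>j. c j * a j"] by (force simp: A_def)
  have "(\<Sum>j\<in>J. c j * (ent_fun (a j) + a j * log 2 A)) \<le> (\<Sum>j\<in>J. c j * ((A - a j) / ln 2))"
    using nn A by (intro sum_mono mult_left_mono ent_fun_tangent) auto
  also have "\<dots> = ((\<Sum>j\<in>J. c j) * A - A) / ln 2"
    by (simp add: sum_divide_distrib[symmetric] sum_subtractf right_diff_distrib A_def sum_distrib_right)
  also have "\<dots> = 0" using c by simp
  finally have "(\<Sum>j\<in>J. c j * ent_fun (a j)) + A * log 2 A \<le> 0"
    by (simp add: A_def sum.distrib sum_distrib_right distrib_left mult.assoc)
  then show ?thesis by (simp add: A_def[symmetric] ent_fun_def)
qed

text \<open>Shannon entropy in bits of the law of \<phi>. Summing over the atoms of positive mass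
  avoids naming a range. Infinitely many such atoms would give 0 by the convention for sums; the
  variables of interest below take finitely many values almost surely.\<close>

definition rv_entropy :: "'a measure \<Rightarrow> ('a \<Rightarrow> 'b) \<Rightarrow> real" where
  "rv_entropy M \<phi> = (\<Sum>v | measure M {s\<in>space M. \<phi> s = v} \<noteq> 0. ent_fun (measure M {s\<in>space M. \<phi> s = v}))"

text \<open>A need not be measurable. If the fibre itself is not measurable, its measure is 0 by
  convention.\<close>

lemma measure_eq_0_outside:
  assumes "AE s in M. s \<in> A" "v \<notin> \<phi> ` A"
  shows "measure M {s\<in>space M. \<phi> s = v} = 0"
proof -
  have "AE s in M. \<not> \<phi> s = v" using assms(1) by eventually_elim (use assms(2) in auto)
  then have "emeasure M {s\<in>space M. \<phi> s = v} = 0"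
    by (cases "{s\<in>space M. \<phi> s = v} \<in> sets M") (auto simp: AE_iff_measurable[OF _ refl] emeasure_notin_sets)
  then show ?thesis by (simp add: measure_def)
qed

lemma rv_entropy_eq_sum:
  assumes "AE s in M. s \<in> A" "\<phi> ` A \<subseteq> F" "finite F"
  shows "rv_entropy M \<phi> = (\<Sum>v\<in>F. ent_fun (measure M {s\<in>space M. \<phi> s = v}))"
  unfolding rv_entropy_def
  using measure_eq_0_outside[OF assms(1), of _ \<phi>] assms(2,3)
  by (intro sum.mono_neutral_left) auto

lemma rv_entropy_nonneg:
  assumes "prob_space M"
  shows "0 \<le> rv_entropy M \<phi>"
proof -
  interpret prob_space M by fact
  show ?thesis unfolding rv_entropy_def by (intro sum_nonneg ent_fun_nonneg) auto
qed

lemma rv_entropy_distr: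
  assumes "X \<in> measurable M N" "\<phi> \<in> measurable N (count_space UNIV)"
  shows "rv_entropy (distr M N X) \<phi> = rv_entropy M (\<lambda>s. \<phi> (X s))"
proof -
  have "measure (distr M N X) {s\<in>space N. \<phi> s = v} = measure M {s\<in>space M. \<phi> (X s) = v}" for v
  proof -
    have "{s\<in>space N. \<phi> s = v} \<in> sets N" using assms(2) by measurable
    then show ?thesis using assms(1) measurable_space[OF assms(1)]
      by (subst measure_distr) (auto intro!: arg_cong[where f="measure M"])
  qed
  then show ?thesis by (simp add: rv_entropy_def)
qed

lemma (in prob_space) prob_eq_sum_fibers:
  assumes [measurable]: "\<phi> \<in> measurable M (count_space UNIV)" "Measurable.pred M Q"
    and A: "AE s in M. s \<in> A" and F: "finite F" "\<phi> ` A \<subseteq> F"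
  shows "prob {s\<in>space M. Q s} = (\<Sum>v\<in>F. prob {s\<in>space M. \<phi> s = v \<and> Q s})"
proof -
  have "prob {s\<in>space M. Q s} = prob (\<Union>v\<in>F. {s\<in>space M. \<phi> s = v \<and> Q s})"
  proof (rule finite_measure_eq_AE)
    show "AE x in M. (x \<in> {s \<in> space M. Q s}) = (x \<in> (\<Union>v\<in>F. {s \<in> space M. \<phi> s = v \<and> Q s}))"
      using A by eventually_elim (use F in auto)
    show "(\<Union>v\<in>F. {s \<in> space M. \<phi> s = v \<and> Q s}) \<in> events"
      using F(1) by (intro sets.finite_UN) auto
  qed measurable
  also have "\<dots> = (\<Sum>v\<in>F. prob {s\<in>space M. \<phi> s = v \<and> Q s})"
    using F(1) by (intro finite_measure_finite_Union) (auto simp: disjoint_family_on_def)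
  finally show ?thesis .
qed

text \<open>H(\<phi>) \<le> H(\<phi>, \<psi>) = H(\<psi>) + H(\<phi> | \<psi>), and the conditional
  entropy is at most log C. The set A of full measure lets exceptional points be ignored in the
  count of values. Most comparisons of entropies below are instances.\<close>

lemma rv_entropy_le_fibers:
  assumes "prob_space M" and meas: "\<phi> \<in> measurable M (count_space UNIV)" "\<psi> \<in> measurable M (count_space UNIV)"
    and A: "AE s in M. s \<in> A" and fin: "finite (\<phi> ` A)" "finite (\<psi> ` A)"
    and C: "0 < C" "\<And>w. w \<in> \<psi> ` A \<Longrightarrow> real (card (\<phi> ` {s\<in>A. \<psi> s = w})) \<le> C"
  shows "rv_entropy M \<phi> \<le> rv_entropy M \<psi> + log 2 C"
proof -
  interpret prob_space M by fact
  note [measurable] = meas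
  define a where "a v w = prob {s\<in>space M. \<phi> s = v \<and> \<psi> s = w}" for v w
  have a1: "prob {s\<in>space M. \<phi> s = v} = (\<Sum>w\<in>\<psi> ` A. a v w)" for v
    using prob_eq_sum_fibers[of \<psi> "\<lambda>s. \<phi> s = v" A "\<psi> ` A"] A fin by (simp add: a_def conj_commute)
  have a2: "prob {s\<in>space M. \<psi> s = w} = (\<Sum>v\<in>\<phi> ` A. a v w)" for w
    using prob_eq_sum_fibers[of \<phi> "\<lambda>s. \<psi> s = w" A "\<phi> ` A"] A fin by (simp add: a_def)
  have a0: "0 \<le> a v w" for v w by (simp add: a_def)
  have "rv_entropy M \<phi> = (\<Sum>v\<in>\<phi> ` A. ent_fun (\<Sum>w\<in>\<psi> ` A. a v w))"
    using rv_entropy_eq_sum[OF A _ fin(1)] by (simp add: a1)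
  also have "\<dots> \<le> (\<Sum>v\<in>\<phi> ` A. \<Sum>w\<in>\<psi> ` A. ent_fun (a v w))"
    using fin a0 by (intro sum_mono ent_fun_sum_le) auto
  also have "\<dots> = (\<Sum>w\<in>\<psi> ` A. \<Sum>v\<in>\<phi> ` A. ent_fun (a v w))" by (rule sum.swap)
  also have "\<dots> \<le> (\<Sum>w\<in>\<psi> ` A. ent_fun (\<Sum>v\<in>\<phi> ` A. a v w) + (\<Sum>v\<in>\<phi> ` A. a v w) * log 2 C)"
  proof (intro sum_mono sum_ent_fun_le)
    fix w assume w: "w \<in> \<psi> ` A"
    \<comment> \<open>Only pairs (v, w) attained on A can have positive mass.\<close>
    have "{v \<in> \<phi> ` A. a v w \<noteq> 0} \<subseteq> \<phi> ` {s\<in>A. \<psi> s = w}"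
    proof
      fix v assume "v \<in> {v \<in> \<phi> ` A. a v w \<noteq> 0}"
      then have "a v w \<noteq> 0" by simp
      then have "(v, w) \<in> (\<lambda>s. (\<phi> s, \<psi> s)) ` A"
        using measure_eq_0_outside[OF A, of "(v,w)" "\<lambda>s. (\<phi> s, \<psi> s)"] by (auto simp: a_def)
      then show "v \<in> \<phi> ` {s\<in>A. \<psi> s = w}" by auto
    qed
    moreover have "finite (\<phi> ` {s\<in>A. \<psi> s = w})" using fin(1) by (rule finite_subset[rotated]) auto
    ultimately have "card {v \<in> \<phi> ` A. a v w \<noteq> 0} \<le> card (\<phi> ` {s\<in>A. \<psi> s = w})" by (rule card_mono[rotated])
    with C(2)[OF w] show "real (card {v \<in> \<phi> ` A. a v w \<noteq> 0}) \<le> C" by linarith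
  qed (use fin a0 C in auto)
  also have "\<dots> = rv_entropy M \<psi> + (\<Sum>w\<in>\<psi> ` A. prob {s\<in>space M. \<psi> s = w}) * log 2 C"
    using rv_entropy_eq_sum[OF A _ fin(2), OF subset_refl] by (simp add: a2 sum.distrib sum_distrib_right)
  also have "(\<Sum>w\<in>\<psi> ` A. prob {s\<in>space M. \<psi> s = w}) = 1"
    using prob_eq_sum_fibers[of \<psi> "\<lambda>s. True" A "\<psi> ` A"] A fin by (simp add: prob_space)
  finally show ?thesis by simp
qed

section \<open>Cells of the unit grid and their number\<close>

definition cell :: "complex \<Rightarrow> int \<times> int" where "cell z = (\<lfloor>Re z\<rfloor>, \<lfloor>Im z\<rfloor>)"

lemma measurable_cell [measurable]: "cell \<in> measurable borel (count_space UNIV)"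
proof -
  have "(\<lambda>z. (\<lfloor>Re z\<rfloor>, \<lfloor>Im z\<rfloor>)) \<in> measurable borel (count_space UNIV \<Otimes>\<^sub>M count_space UNIV)"
    by measurable
  then show ?thesis unfolding cell_def[abs_def] by (simp add: pair_measure_countable)
qed

lemma card_floor_interval_le:
  assumes "0 \<le> D"
  shows "real (card {\<lfloor>x - D\<rfloor>..\<lfloor>x + D\<rfloor>}) \<le> 2 * D + 2"
proof -
  have "\<lfloor>x - D\<rfloor> \<le> \<lfloor>x + D\<rfloor>" using assms by (intro floor_mono) auto
  then have "real (card {\<lfloor>x - D\<rfloor>..\<lfloor>x + D\<rfloor>}) = \<lfloor>x + D\<rfloor> - \<lfloor>x - D\<rfloor> + 1"
    by (simp add: card_atLeastAtMost_int)
  also have "\<dots> \<le> 2 * D + 2" by linarith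
  finally show ?thesis .
qed

text \<open>Each coordinate lies within D of that of a fixed point of Z, so its floor has at most 2
  D + 2 values.\<close>

lemma card_cell_le:
  assumes "\<And>x y. x \<in> Z \<Longrightarrow> y \<in> Z \<Longrightarrow> cmod (x - y) \<le> D" "0 \<le> D"
  shows "finite (cell ` Z)" "real (card (cell ` Z)) \<le> (2 * D + 2)\<^sup>2"
proof -
  have "finite (cell ` Z) \<and> real (card (cell ` Z)) \<le> (2 * D + 2)\<^sup>2"
  proof (cases "Z = {}")
    case False
    then obtain z where z: "z \<in> Z" by auto
    let ?R = "{\<lfloor>Re z - D\<rfloor>..\<lfloor>Re z + D\<rfloor>}" and ?I = "{\<lfloor>Im z - D\<rfloor>..\<lfloor>Im z + D\<rfloor>}"
    have sub: "cell ` Z \<subseteq> ?R \<times> ?I"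
    proof
      fix v assume "v \<in> cell ` Z"
      then obtain x where x: "x \<in> Z" "v = cell x" by auto
      have "cmod (x - z) \<le> D" using assms x z by auto
      then have "\<bar>Re x - Re z\<bar> \<le> D" "\<bar>Im x - Im z\<bar> \<le> D"
        using abs_Re_le_cmod[of "x - z"] abs_Im_le_cmod[of "x - z"] by auto
      then show "v \<in> ?R \<times> ?I" by (auto simp: x(2) cell_def intro!: floor_mono)
    qed
    then have "card (cell ` Z) \<le> card ?R * card ?I"
      using card_mono[OF _ sub] by (simp add: card_cartesian_product)
    then have "real (card (cell ` Z)) \<le> real (card ?R) * real (card ?I)"
      by (metis of_nat_le_iff of_nat_mult)
    also have "\<dots> \<le> (2 * D + 2) * (2 * D + 2)"
      using assms(2) by (intro mult_mono card_floor_interval_le) auto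
    finally show ?thesis using finite_subset[OF sub] by (auto simp: power2_eq_square)
  qed auto
  then show "finite (cell ` Z)" "real (card (cell ` Z)) \<le> (2 * D + 2)\<^sup>2" by auto
qed

lemma cell_eq_imp_dist: "cell x = cell y \<Longrightarrow> cmod (x - y) \<le> 2"
proof -
  assume a: "cell x = cell y"
  then have "\<bar>Re (x - y)\<bar> \<le> 1" "\<bar>Im (x - y)\<bar> \<le> 1" by (auto simp: cell_def) linarith+
  then show ?thesis using cmod_le[of "x - y"] by linarith
qed

lemma cell_scaled_eq_imp_dist:
  assumes "cell (a * x) = cell (a * y)" "a \<noteq> 0"
  shows "cmod (x - y) \<le> 2 / cmod a"
proof -
  have "cmod (a * (x - y)) \<le> 2" using cell_eq_imp_dist[OF assms(1)] by (simp add: algebra_simps)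
  then show ?thesis using assms(2) by (simp add: norm_mult pos_le_divide_eq mult.commute)
qed

lemma finite_cell_bounded:
  assumes "bounded Z" shows "finite (cell ` Z)"
proof -
  obtain B where B: "\<And>z. z \<in> Z \<Longrightarrow> cmod z \<le> B" using assms by (auto simp: bounded_iff)
  have "cmod (x - y) \<le> 2 * \<bar>B\<bar>" if "x \<in> Z" "y \<in> Z" for x y
    using norm_triangle_ineq4[of x y] B[OF that(1)] B[OF that(2)] by linarith
  then show ?thesis by (rule card_cell_le) auto
qed

lemma finite_cell_scaled_bounded:
  assumes "bounded (X ` A)" shows "finite ((\<lambda>s. cell (b * X s)) ` A)"
proof -
  have "bounded ((\<lambda>z. b * z) ` X ` A)"
    using assms by (intro bounded_linear_image[OF _ bounded_linear_mult_right])
  from finite_cell_bounded[OF this] show ?thesis by (simp add: image_image)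
qed

lemma log2_square: "0 < x \<Longrightarrow> log 2 (x\<^sup>2) = 2 * log 2 x"
  by (simp add: log_nat_power)

text \<open>The a-cell of Y leaves Y free by 2/|a|, hence X by 2/|a| + d, hence b X by |b| (2/|a| +
  d). Only the moduli of the scales enter, so rotating a grid costs a bounded amount.\<close>

lemma rv_entropy_cell_le:
  assumes "prob_space M" and meas [measurable]: "X \<in> borel_measurable M" "Y \<in> borel_measurable M"
    and A: "AE s in M. s \<in> A" and bdd: "bounded (X ` A)" "bounded (Y ` A)"
    and dist: "\<And>s s'. s \<in> A \<Longrightarrow> s' \<in> A \<Longrightarrow> cmod (X s - X s') \<le> cmod (Y s - Y s') + d"
    and a: "a \<noteq> 0" and d: "0 \<le> d"
  shows "rv_entropy M (\<lambda>s. cell (b * X s)) \<le> rv_entropy M (\<lambda>s. cell (a * Y s))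
    + 2 * log 2 (2 * (cmod b * (2 / cmod a + d)) + 2)"
proof -
  let ?D = "cmod b * (2 / cmod a + d)"
  have D: "0 \<le> ?D" using d by simp
  have "rv_entropy M (\<lambda>s. cell (b * X s)) \<le> rv_entropy M (\<lambda>s. cell (a * Y s)) + log 2 ((2 * ?D + 2)\<^sup>2)"
  proof (rule rv_entropy_le_fibers[OF assms(1) _ _ A])
    fix w
    let ?Z = "(\<lambda>s. b * X s) ` {s \<in> A. cell (a * Y s) = w}"
    have "real (card (cell ` ?Z)) \<le> (2 * ?D + 2)\<^sup>2"
    proof (rule card_cell_le(2)[OF _ D])
      fix x y assume "x \<in> ?Z" "y \<in> ?Z"
      then obtain s s' where s: "s \<in> A" "s' \<in> A" "cell (a * Y s) = cell (a * Y s')"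
        and xy: "x = b * X s" "y = b * X s'" by auto
      have "cmod (X s - X s') \<le> 2 / cmod a + d"
        using dist[OF s(1,2)] cell_scaled_eq_imp_dist[OF s(3) a] by linarith
      then show "cmod (x - y) \<le> ?D"
        unfolding xy by (simp add: norm_mult right_diff_distrib[symmetric] mult_left_mono)
    qed
    then show "real (card ((\<lambda>s. cell (b * X s)) ` {s \<in> A. cell (a * Y s) = w})) \<le> (2 * ?D + 2)\<^sup>2"
      by (simp add: image_image)
  qed (use bdd D in \<open>auto intro!: finite_cell_scaled_bounded\<close>)
  then show ?thesis using D by (simp add: log2_square)
qed

section \<open>Convolution with a finitely supported measure\<close>

text \<open>S only has to carry the full mass and may contain null points. A conditional measure can
  therefore keep the set S of the original one.\<close>

definition fin_supp :: "complex measure \<Rightarrow> complex set \<Rightarrow> bool" where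
  "fin_supp \<nu> S \<longleftrightarrow> prob_space \<nu> \<and> sets \<nu> = sets borel \<and> finite S \<and> (AE x in \<nu>. x \<in> S)"

lemma fin_suppD:
  assumes "fin_supp \<nu> S"
  shows "prob_space \<nu>" "sets \<nu> = sets borel" "finite S" "AE x in \<nu>. x \<in> S" "space \<nu> = UNIV"
  using assms sets_eq_imp_space_eq[of \<nu> borel] by (auto simp: fin_supp_def)

lemma nn_integral_fin_supp:
  assumes "fin_supp \<nu> S"
  shows "(\<integral>\<^sup>+x. f x \<partial>\<nu>) = (\<Sum>x\<in>S. f x * emeasure \<nu> {x})"
proof -
  note fs = fin_suppD[OF assms]
  have [measurable]: "{x} \<in> sets \<nu>" for x using fs(2) by simp
  have "(\<integral>\<^sup>+x. f x \<partial>\<nu>) = (\<integral>\<^sup>+x. (\<Sum>y\<in>S. f y * indicator {y} x) \<partial>\<nu>)"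
  proof (rule nn_integral_cong_AE)
    show "AE x in \<nu>. f x = (\<Sum>y\<in>S. f y * indicator {y} x)"
      using fs(4)
    proof eventually_elim
      fix x assume x: "x \<in> S"
      have "(\<Sum>y\<in>S. f y * indicator {y} x) = (\<Sum>y\<in>S. if y = x then f y else 0)"
        by (intro sum.cong) (auto simp: indicator_def)
      then show "f x = (\<Sum>y\<in>S. f y * indicator {y} x)" using x fs(3) by simp
    qed
  qed
  also have "\<dots> = (\<Sum>y\<in>S. \<integral>\<^sup>+x. f y * indicator {y} x \<partial>\<nu>)"
    by (intro nn_integral_sum) measurable
  also have "\<dots> = (\<Sum>x\<in>S. f x * emeasure \<nu> {x})"
    by (intro sum.cong refl nn_integral_cmult_indicator) auto
  finally show ?thesis .
qed

lemma measure_pair_fin_supp: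
  assumes fs: "fin_supp \<nu> S" and M: "prob_space M" and Q: "Measurable.pred (\<nu> \<Otimes>\<^sub>M M) Q"
  shows "measure (\<nu> \<Otimes>\<^sub>M M) {z\<in>space (\<nu> \<Otimes>\<^sub>M M). Q z} =
    (\<Sum>x\<in>S. measure \<nu> {x} * measure M {s\<in>space M. Q (x, s)})"
proof -
  interpret M: prob_space M by fact
  interpret N: prob_space \<nu> using fs by (rule fin_suppD)
  let ?E = "{z\<in>space (\<nu> \<Otimes>\<^sub>M M). Q z}"
  have E: "?E \<in> sets (\<nu> \<Otimes>\<^sub>M M)" using Q by measurable
  have *: "Pair x -` ?E = {s\<in>space M. Q (x, s)}" for x
    by (auto simp: space_pair_measure fin_suppD(5)[OF fs])
  have "emeasure (\<nu> \<Otimes>\<^sub>M M) ?E = (\<integral>\<^sup>+x. emeasure M (Pair x -` ?E) \<partial>\<nu>)"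
    using E by (rule M.emeasure_pair_measure_alt)
  also have "\<dots> = (\<Sum>x\<in>S. emeasure M {s\<in>space M. Q (x, s)} * emeasure \<nu> {x})"
    by (subst nn_integral_fin_supp[OF fs]) (simp only: *)
  also have "\<dots> = (\<Sum>x\<in>S. ennreal (measure \<nu> {x} * measure M {s\<in>space M. Q (x, s)}))"
    by (simp add: M.emeasure_eq_measure N.emeasure_eq_measure ennreal_mult'[symmetric] mult.commute)
  also have "\<dots> = ennreal (\<Sum>x\<in>S. measure \<nu> {x} * measure M {s\<in>space M. Q (x, s)})"
    by (intro sum_ennreal) auto
  finally show ?thesis by (simp add: measure_def sum_nonneg)
qed

lemma AE_pair_Times:
  assumes "prob_space N" "prob_space M" "AE x in N. x \<in> S" "AE s in M. s \<in> A"
  shows "AE z in N \<Otimes>\<^sub>M M. z \<in> S \<times> A"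
proof -
  interpret M: prob_space M by fact
  interpret N: prob_space N by fact
  obtain B where B: "{x\<in>space N. x \<notin> S} \<subseteq> B" "emeasure N B = 0" "B \<in> sets N"
    using AE_E[OF assms(3)] by auto
  obtain C where C: "{x\<in>space M. x \<notin> A} \<subseteq> C" "emeasure M C = 0" "C \<in> sets M"
    using AE_E[OF assms(4)] by auto
  have "B \<times> space M \<union> space N \<times> C \<in> null_sets (N \<Otimes>\<^sub>M M)"
    using B C by (intro null_sets.Un null_setsI) (auto simp: M.emeasure_pair_measure_Times)
  then show ?thesis
    by (rule AE_I') (use B C in \<open>auto simp: space_pair_measure\<close>)
qed

lemma measure_eq_sum_fin_supp:
  assumes "fin_supp \<nu> S" "B \<in> sets borel"
  shows "measure \<nu> B = (\<Sum>x\<in>S. measure \<nu> {x} * indicator B x)"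
proof -
  interpret N: prob_space \<nu> using assms(1) by (rule fin_suppD)
  have "emeasure \<nu> B = (\<integral>\<^sup>+x. indicator B x \<partial>\<nu>)"
    using assms fin_suppD(2)[OF assms(1)] by simp
  also have "\<dots> = (\<Sum>x\<in>S. ennreal (measure \<nu> {x} * indicator B x))"
    unfolding nn_integral_fin_supp[OF assms(1)]
    by (intro sum.cong refl) (auto simp: N.emeasure_eq_measure split: split_indicator)
  also have "\<dots> = ennreal (\<Sum>x\<in>S. measure \<nu> {x} * indicator B x)"
    by (intro sum_ennreal) auto
  finally show ?thesis by (simp add: measure_def sum_nonneg)
qed

lemma sum_measure_fin_supp:
  assumes "fin_supp \<nu> S" shows "(\<Sum>x\<in>S. measure \<nu> {x}) = 1"
  using measure_eq_sum_fin_supp[OF assms, of UNIV] prob_space.prob_space[OF fin_suppD(1)[OF assms]]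
    fin_suppD(5)[OF assms] by simp

text \<open>Entropy at scale 1/|b| of the convolution of \<nu> with the law of Y. The second factor
  is a random variable on an arbitrary space, so that one statement serves digit sequences,
  \<open>nu\<close> and \<open>tau\<close> alike.\<close>

definition conv_entropy :: "complex measure \<Rightarrow> 'a measure \<Rightarrow> ('a \<Rightarrow> complex) \<Rightarrow> complex \<Rightarrow> real" where
  "conv_entropy \<nu> M Y b = rv_entropy (\<nu> \<Otimes>\<^sub>M M) (\<lambda>(x, s). cell (b * (x + Y s)))"

lemma bounded_sum_image:
  assumes "finite S" "bounded (Y ` A)"
  shows "bounded ((\<lambda>(x, s). x + Y s :: complex) ` (S \<times> A))"
proof -
  have "(\<lambda>(x, s). x + Y s) ` (S \<times> A) = (\<lambda>(x, y). x + y) ` (S \<times> Y ` A)" by force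
  moreover have "bounded S" using assms(1) by (rule finite_imp_bounded)
  ultimately show ?thesis using bounded_plus[of S "Y ` A"] assms(2) by (simp add: image_def)
qed

lemma measurable_cell_sum:
  assumes "sets \<nu> = sets borel" and [measurable]: "Y \<in> borel_measurable M"
  shows "(\<lambda>(x, s). cell (b * (x + Y s))) \<in> measurable (\<nu> \<Otimes>\<^sub>M M) (count_space UNIV)"
proof -
  have *: "sets (\<nu> \<Otimes>\<^sub>M M) = sets (borel \<Otimes>\<^sub>M M)" using assms(1) by (intro sets_pair_measure_cong) auto
  show ?thesis unfolding measurable_cong_sets[OF * refl] by measurable
qed

text \<open>The law of the sum is an average over x of the laws of x + Y, and entropy is concave.
  Each translate has nearly the entropy of Y, since translation only moves the grid relative to
  Y.\<close>

lemma conv_entropy_ge: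
  assumes c: "fin_supp c S" and M: "prob_space M" and Y [measurable]: "Y \<in> borel_measurable M"
    and A: "AE s in M. s \<in> A" and bdd: "bounded (Y ` A)" and b: "b \<noteq> 0"
  shows "rv_entropy M (\<lambda>s. cell (b * Y s)) - 2 * log 2 6 \<le> conv_entropy c M Y b"
proof -
  interpret M: prob_space M by fact
  let ?X = "\<lambda>(x, s). cell (b * (x + Y s))"
  have AE: "AE z in c \<Otimes>\<^sub>M M. z \<in> S \<times> A" using fin_suppD[OF c] M A by (intro AE_pair_Times) auto
  define F where "F = ?X ` (S \<times> A)"
  have fin: "finite F"
    unfolding F_def using finite_cell_scaled_bounded[OF bounded_sum_image[OF fin_suppD(3)[OF c] bdd], of b]
    by (simp add: case_prod_beta')
  note cs = measurable_cell_sum[OF fin_suppD(2)[OF c] Y, of b]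
  have shift: "rv_entropy M (\<lambda>s. cell (b * Y s)) - 2 * log 2 6 \<le> (\<Sum>v\<in>F. ent_fun (measure M {s\<in>space M. ?X (x, s) = v}))"
    if x: "x \<in> S" for x
  proof -
    \<comment> \<open>Inside one b-cell of Y the point b (x + Y) varies by at most 2, giving at most
      \<open>(2 * 2 + 2)\<^sup>2\<close> cells, whence the constant
      \<open>2 * log 2 6\<close>.\<close>
    have "rv_entropy M (\<lambda>s. cell (b * Y s)) \<le> rv_entropy M (\<lambda>s. cell (b * (x + Y s)))
      + 2 * log 2 (2 * (cmod b * (2 / cmod b + 0)) + 2)"
      using bdd b bounded_translation[OF bdd, of x]
      by (intro rv_entropy_cell_le[OF M _ _ A]) (auto simp: image_image)
    moreover have "rv_entropy M (\<lambda>s. cell (b * (x + Y s))) = (\<Sum>v\<in>F. ent_fun (measure M {s\<in>space M. ?X (x, s) = v}))"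
      using x fin by (subst rv_entropy_eq_sum[OF A, of _ F]) (auto simp: F_def)
    ultimately show ?thesis using b by simp
  qed
  have "rv_entropy M (\<lambda>s. cell (b * Y s)) - 2 * log 2 6
      = (\<Sum>x\<in>S. measure c {x} * (rv_entropy M (\<lambda>s. cell (b * Y s)) - 2 * log 2 6))"
    using sum_measure_fin_supp[OF c] by (simp add: sum_distrib_right[symmetric])
  also have "\<dots> \<le> (\<Sum>x\<in>S. measure c {x} * (\<Sum>v\<in>F. ent_fun (measure M {s\<in>space M. ?X (x, s) = v})))"
    using shift by (intro sum_mono mult_left_mono) auto
  also have "\<dots> = (\<Sum>v\<in>F. \<Sum>x\<in>S. measure c {x} * ent_fun (measure M {s\<in>space M. ?X (x, s) = v}))"
    by (subst sum.swap) (simp add: sum_distrib_left)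
  also have "\<dots> \<le> (\<Sum>v\<in>F. ent_fun (\<Sum>x\<in>S. measure c {x} * measure M {s\<in>space M. ?X (x, s) = v}))"
    using sum_measure_fin_supp[OF c] fin_suppD(3)[OF c] by (intro sum_mono ent_fun_concave_sum) auto
  also have "\<dots> = (\<Sum>v\<in>F. ent_fun (measure (c \<Otimes>\<^sub>M M) {z\<in>space (c \<Otimes>\<^sub>M M). ?X z = v}))"
    using cs by (subst measure_pair_fin_supp[OF c M]) (auto intro: pred_count_space_const1)
  also have "\<dots> = conv_entropy c M Y b"
    unfolding conv_entropy_def using fin by (subst rv_entropy_eq_sum[OF AE, of _ F]) (auto simp: F_def)
  finally show ?thesis .
qed

text \<open>The density defining \<open>component\<close>, with an arbitrary set so that cells of
  rotated grids are covered too. A null set B gives the zero measure, since division by 0 is 0;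
  hence the condition on its mass below.\<close>

definition cond_measure :: "complex measure \<Rightarrow> complex set \<Rightarrow> complex measure" where
  "cond_measure \<nu> B = density \<nu> (\<lambda>y. ennreal (indicator B y / measure \<nu> B))"

lemma
  assumes fs: "fin_supp \<nu> S" and B: "B \<in> sets borel" and pos: "measure \<nu> B \<noteq> 0"
  shows fin_supp_cond_measure: "fin_supp (cond_measure \<nu> B) S"
    and measure_cond_measure: "C \<in> sets borel \<Longrightarrow> measure (cond_measure \<nu> B) C = measure \<nu> (B \<inter> C) / measure \<nu> B"
proof -
  note f = fin_suppD[OF fs]
  interpret N: prob_space \<nu> by fact
  have [measurable]: "B \<in> sets \<nu>" using B f by simp
  have pos': "0 < measure \<nu> B" using pos by (simp add: zero_less_measure_iff)
  have em: "emeasure (cond_measure \<nu> B) C = ennreal (measure \<nu> (B \<inter> C) / measure \<nu> B)" if "C \<in> sets borel" for C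
  proof -
    have C [measurable]: "C \<in> sets \<nu>" using that f by simp
    have "emeasure (cond_measure \<nu> B) C = (\<integral>\<^sup>+y. ennreal (indicator B y / measure \<nu> B) * indicator C y \<partial>\<nu>)"
      unfolding cond_measure_def by (intro emeasure_density) measurable
    also have "\<dots> = (\<integral>\<^sup>+y. ennreal (1 / measure \<nu> B) * indicator (B \<inter> C) y \<partial>\<nu>)"
      by (intro nn_integral_cong) (auto split: split_indicator)
    also have "\<dots> = ennreal (1 / measure \<nu> B) * emeasure \<nu> (B \<inter> C)"
      by (intro nn_integral_cmult_indicator) auto
    also have "\<dots> = ennreal (measure \<nu> (B \<inter> C) / measure \<nu> B)"
      using pos' by (simp add: N.emeasure_eq_measure ennreal_mult'[symmetric])
    finally show ?thesis .
  qed
  show "measure (cond_measure \<nu> B) C = measure \<nu> (B \<inter> C) / measure \<nu> B" if "C \<in> sets borel"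
    using em[OF that] by (simp add: measure_def)
  have "prob_space (cond_measure \<nu> B)"
    using em[of UNIV] pos by (intro prob_spaceI) (simp add: cond_measure_def f(5))
  moreover have "AE x in cond_measure \<nu> B. x \<in> S"
    unfolding cond_measure_def by (subst AE_density) (use f(4) in auto)
  ultimately show "fin_supp (cond_measure \<nu> B) S"
    using f by (simp add: fin_supp_def) (simp add: cond_measure_def)
qed

lemma measurable_cell_fiber [measurable]: "{y. cell (a * y) = v} \<in> sets borel"
proof -
  have "{y \<in> space borel. cell (a * y) = v} \<in> sets borel" by measurable
  then show ?thesis by simp
qed

text \<open>Chain rule for the pair (cell of \<open>x\<close> at scale \<open>a\<close>, cell of \<open>x + Y\<close> at scale \<open>b\<close>): since \<open>Y\<close> is
  small, the second entry determines the first up to boundedly many values.\<close>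

lemma conv_entropy_ge_components:
  assumes nu: "fin_supp \<nu> S" and M: "prob_space M" and Y [measurable]: "Y \<in> borel_measurable M"
    and A: "AE s in M. s \<in> A" and bdd: "\<And>s. s \<in> A \<Longrightarrow> cmod (Y s) \<le> \<rho>" and b: "b \<noteq> 0" and rho: "0 \<le> \<rho>"
  shows "rv_entropy \<nu> (\<lambda>x. cell (a * x))
      + (\<Sum>v\<in>(\<lambda>x. cell (a * x)) ` S. measure \<nu> {x. cell (a * x) = v} * conv_entropy (cond_measure \<nu> {x. cell (a * x) = v}) M Y b)
    \<le> conv_entropy \<nu> M Y b + 2 * log 2 (2 * (cmod a * (2 / cmod b + 2 * \<rho>)) + 2)"
proof -
  interpret M: prob_space M by fact
  note f = fin_suppD[OF nu]
  interpret N: prob_space \<nu> by fact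
  interpret NM: pair_prob_space \<nu> M ..
  let ?NM = "\<nu> \<Otimes>\<^sub>M M"
  let ?D = "cmod a * (2 / cmod b + 2 * \<rho>)"
  have D: "0 \<le> ?D" using rho by simp
  define \<psi> where "\<psi> = (\<lambda>(x, s). cell (b * (x + Y s)))"
  define \<phi> where "\<phi> = (\<lambda>(x, s::'a). (cell (a * x), \<psi> (x, s)))"
  define p where "p v = measure \<nu> {x. cell (a * x) = v}" for v
  define V where "V = (\<lambda>x. cell (a * x)) ` S"
  define W where "W = \<psi> ` (S \<times> A)"
  have bY: "bounded (Y ` A)" using bdd by (auto simp: bounded_iff)
  have AE: "AE z in ?NM. z \<in> S \<times> A" using f M A by (intro AE_pair_Times) auto
  have finV: "finite V" using f(3) by (simp add: V_def)
  have finW: "finite W"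
    unfolding W_def \<psi>_def using finite_cell_scaled_bounded[OF bounded_sum_image[OF f(3) bY], of b]
    by (simp add: case_prod_beta')
  have m1 [measurable]: "\<psi> \<in> measurable ?NM (count_space UNIV)"
    unfolding \<psi>_def using f(2) Y by (rule measurable_cell_sum)
  have "(\<lambda>x. cell (a * x)) \<in> measurable \<nu> (count_space UNIV)"
    using f(2) by (simp cong: measurable_cong_sets)
  then have m2 [measurable]: "(\<lambda>z. cell (a * fst z)) \<in> measurable ?NM (count_space UNIV)"
    by (rule measurable_compose[OF measurable_fst])
  have m3: "\<phi> \<in> measurable ?NM (count_space UNIV)"
  proof -
    have "(\<lambda>z. (cell (a * fst z), \<psi> z)) \<in> measurable ?NM (count_space UNIV \<Otimes>\<^sub>M count_space UNIV)"
      by measurable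
    then show ?thesis by (simp add: \<phi>_def pair_measure_countable case_prod_beta')
  qed
  have phiVW: "\<phi> ` (S \<times> A) \<subseteq> V \<times> W" by (auto simp: \<phi>_def V_def W_def)
  have joint: "measure ?NM {z\<in>space ?NM. \<phi> z = (v, w)}
      = p v * measure (cond_measure \<nu> {x. cell (a * x) = v} \<Otimes>\<^sub>M M) {z\<in>space (cond_measure \<nu> {x. cell (a * x) = v} \<Otimes>\<^sub>M M). \<psi> z = w}"
    if v: "p v \<noteq> 0" for v w
  proof -
    let ?B = "{x. cell (a * x) = v}"
    have c: "fin_supp (cond_measure \<nu> ?B) S" using v by (intro fin_supp_cond_measure[OF nu]) (auto simp: p_def)
    have "measure ?NM {z\<in>space ?NM. \<phi> z = (v, w)}
        = (\<Sum>x\<in>S. measure \<nu> {x} * measure M {s\<in>space M. \<phi> (x, s) = (v, w)})"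
      using m3 by (intro measure_pair_fin_supp[OF nu M] pred_count_space_const1)
    also have "\<dots> = (\<Sum>x\<in>S. p v * (measure (cond_measure \<nu> ?B) {x} * measure M {s\<in>space M. \<psi> (x, s) = w}))"
    proof (intro sum.cong refl)
      fix x
      have "?B \<inter> {x} = (if cell (a * x) = v then {x} else {})" by auto
      then show "measure \<nu> {x} * measure M {s\<in>space M. \<phi> (x, s) = (v, w)} =
          p v * (measure (cond_measure \<nu> ?B) {x} * measure M {s\<in>space M. \<psi> (x, s) = w})"
        using v by (auto simp: measure_cond_measure[OF nu] p_def \<phi>_def)
    qed
    also have "\<dots> = p v * (\<Sum>x\<in>S. measure (cond_measure \<nu> ?B) {x} * measure M {s\<in>space M. \<psi> (x, s) = w})"
      by (simp add: sum_distrib_left)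
    also have "(\<Sum>x\<in>S. measure (cond_measure \<nu> ?B) {x} * measure M {s\<in>space M. \<psi> (x, s) = w})
        = measure (cond_measure \<nu> ?B \<Otimes>\<^sub>M M) {z\<in>space (cond_measure \<nu> ?B \<Otimes>\<^sub>M M). \<psi> z = w}"
      using measurable_cell_sum[OF fin_suppD(2)[OF c] Y, of b]
      by (intro measure_pair_fin_supp[OF c M, symmetric] pred_count_space_const1) (simp add: \<psi>_def)
    finally show ?thesis .
  qed
  have p_total: "(\<Sum>w\<in>W. measure ?NM {z\<in>space ?NM. \<phi> z = (v, w)}) = p v" for v
  proof -
    have "(\<Sum>w\<in>W. measure ?NM {z\<in>space ?NM. \<psi> z = w \<and> cell (a * fst z) = v})
        = measure ?NM {z\<in>space ?NM. cell (a * fst z) = v}"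
      using AE finW by (intro NM.prob_eq_sum_fibers[symmetric]) (auto simp: W_def)
    also have "\<dots> = (\<Sum>x\<in>S. measure \<nu> {x} * measure M {s\<in>space M. cell (a * x) = v})"
      using m2 by (subst measure_pair_fin_supp[OF nu M]) (auto intro: pred_count_space_const1)
    also have "\<dots> = (\<Sum>x\<in>S. measure \<nu> {x} * indicator {x. cell (a * x) = v} x)"
      by (intro sum.cong refl) (auto simp: M.prob_space split: split_indicator)
    also have "\<dots> = p v" unfolding p_def by (intro measure_eq_sum_fin_supp[OF nu, symmetric]) simp
    finally show ?thesis by (simp add: \<phi>_def case_prod_beta' conj_commute)
  qed
  \<comment> \<open>Chain rule for one cell v. A null cell has no conditional probability measure;
    there both sides are 0.\<close>
  have chain: "(\<Sum>w\<in>W. ent_fun (measure ?NM {z\<in>space ?NM. \<phi> z = (v, w)}))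
      = ent_fun (p v) + p v * conv_entropy (cond_measure \<nu> {x. cell (a * x) = v}) M Y b" for v
  proof (cases "p v = 0")
    case True
    have "measure ?NM {z\<in>space ?NM. \<phi> z = (v, w)} = 0" if "w \<in> W" for w
      using p_total[of v] True finW that by (simp add: sum_nonneg_eq_0_iff)
    then show ?thesis using True by simp
  next
    case False
    let ?B = "{x. cell (a * x) = v}"
    let ?q = "\<lambda>w. measure (cond_measure \<nu> ?B \<Otimes>\<^sub>M M) {z\<in>space (cond_measure \<nu> ?B \<Otimes>\<^sub>M M). \<psi> z = w}"
    have c: "fin_supp (cond_measure \<nu> ?B) S" using False by (intro fin_supp_cond_measure[OF nu]) (auto simp: p_def)
    have AEc: "AE z in cond_measure \<nu> ?B \<Otimes>\<^sub>M M. z \<in> S \<times> A"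
      using fin_suppD[OF c] M A by (intro AE_pair_Times) auto
    have "p v * (\<Sum>w\<in>W. ?q w) = p v * 1"
      using p_total[of v] by (simp add: joint[OF False] sum_distrib_left)
    then have q: "(\<Sum>w\<in>W. ?q w) = 1" using False by simp
    have "(\<Sum>w\<in>W. ent_fun (measure ?NM {z\<in>space ?NM. \<phi> z = (v, w)})) = (\<Sum>w\<in>W. p v * ent_fun (?q w) + ?q w * ent_fun (p v))"
      unfolding joint[OF False] by (intro sum.cong refl ent_fun_mult) (auto simp: p_def)
    \<comment> \<open>The conditional masses sum to 1, so \<open>ent_fun (p v)\<close> occurs
      exactly once.\<close>
    also have "\<dots> = p v * (\<Sum>w\<in>W. ent_fun (?q w)) + ent_fun (p v)"
      using q by (simp add: sum.distrib sum_distrib_left[symmetric] sum_distrib_right[symmetric])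
    also have "(\<Sum>w\<in>W. ent_fun (?q w)) = conv_entropy (cond_measure \<nu> ?B) M Y b"
      unfolding conv_entropy_def \<psi>_def[symmetric] using finW by (subst rv_entropy_eq_sum[OF AEc, of _ W]) (auto simp: W_def)
    finally show ?thesis by simp
  qed
  have "rv_entropy ?NM \<phi> = (\<Sum>v\<in>V. \<Sum>w\<in>W. ent_fun (measure ?NM {z\<in>space ?NM. \<phi> z = (v, w)}))"
    using finV finW by (subst rv_entropy_eq_sum[OF AE phiVW]) (auto simp: sum.cartesian_product case_prod_beta')
  also have "\<dots> = (\<Sum>v\<in>V. ent_fun (p v)) + (\<Sum>v\<in>V. p v * conv_entropy (cond_measure \<nu> {x. cell (a * x) = v}) M Y b)"
    by (simp add: chain sum.distrib)
  also have "(\<Sum>v\<in>V. ent_fun (p v)) = rv_entropy \<nu> (\<lambda>x. cell (a * x))"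
    using finV by (subst rv_entropy_eq_sum[OF f(4), of _ V]) (auto simp: V_def p_def f(5))
  finally have eq: "rv_entropy ?NM \<phi> = rv_entropy \<nu> (\<lambda>x. cell (a * x)) + (\<Sum>v\<in>V. p v * conv_entropy (cond_measure \<nu> {x. cell (a * x) = v}) M Y b)" .
  have "rv_entropy ?NM \<phi> \<le> rv_entropy ?NM \<psi> + log 2 ((2 * ?D + 2)\<^sup>2)"
  proof (rule rv_entropy_le_fibers[OF _ m3 m1 AE])
    show "prob_space ?NM" by unfold_locales
    show "finite (\<phi> ` (S \<times> A))" using finV finW by (intro finite_subset[OF phiVW]) auto
    fix w
    let ?Z = "(\<lambda>z. a * fst z) ` {z \<in> S \<times> A. \<psi> z = w}"
    have "\<phi> ` {z \<in> S \<times> A. \<psi> z = w} = (\<lambda>v. (v, w)) ` cell ` ?Z"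
      unfolding image_image by (intro image_cong) (auto simp: \<phi>_def)
    then have "card (\<phi> ` {z \<in> S \<times> A. \<psi> z = w}) = card (cell ` ?Z)"
      by (simp add: card_image inj_on_def)
    moreover have "real (card (cell ` ?Z)) \<le> (2 * ?D + 2)\<^sup>2"
    proof (rule card_cell_le(2)[OF _ D])
      fix x y assume "x \<in> ?Z" "y \<in> ?Z"
      then obtain z1 z2 where z: "z1 \<in> S \<times> A" "z2 \<in> S \<times> A" "\<psi> z1 = w" "\<psi> z2 = w"
        "x = a * fst z1" "y = a * fst z2" by blast
      define x1 s1 x2 s2 where "x1 = fst z1" "s1 = snd z1" "x2 = fst z2" "s2 = snd z2"
      with z have s: "s1 \<in> A" "s2 \<in> A" and xy: "x = a * x1" "y = a * x2"
        and eq: "cell (b * (x1 + Y s1)) = cell (b * (x2 + Y s2))" by (auto simp: \<psi>_def)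
      have e: "x1 - x2 = ((x1 + Y s1) - (x2 + Y s2)) - (Y s1 - Y s2)" by simp
      have "cmod (x1 - x2) \<le> cmod ((x1 + Y s1) - (x2 + Y s2)) + cmod (Y s1 - Y s2)"
        by (subst e) (rule norm_triangle_ineq4)
      also have "\<dots> \<le> 2 / cmod b + 2 * \<rho>"
      proof (rule add_mono)
        show "cmod (Y s1 - Y s2) \<le> 2 * \<rho>"
          using norm_triangle_ineq4[of "Y s1" "Y s2"] bdd[OF s(1)] bdd[OF s(2)] by linarith
      qed (rule cell_scaled_eq_imp_dist[OF eq b])
      finally have "cmod a * cmod (x1 - x2) \<le> ?D" by (rule mult_left_mono) simp
      then show "cmod (x - y) \<le> ?D"
        unfolding xy by (simp only: norm_mult right_diff_distrib[symmetric])
    qed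
    ultimately show "real (card (\<phi> ` {z \<in> S \<times> A. \<psi> z = w})) \<le> (2 * ?D + 2)\<^sup>2" by simp
  qed (use D finW in \<open>auto simp: W_def\<close>)
  then show ?thesis
    unfolding eq using D by (simp add: log2_square conv_entropy_def \<psi>_def V_def p_def)
qed

text \<open>In the chain rule each component contributes at least the entropy of Y up to a constant,
  by \<open>conv_entropy_ge\<close>, and averaging keeps this. The superadditivity of the level
  entropies comes from here.\<close>

lemma conv_entropy_superadd:
  assumes nu: "fin_supp \<nu> S" and M: "prob_space M" and Y [measurable]: "Y \<in> borel_measurable M"
    and A: "AE s in M. s \<in> A" and bdd: "\<And>s. s \<in> A \<Longrightarrow> cmod (Y s) \<le> \<rho>" and b: "b \<noteq> 0" and rho: "0 \<le> \<rho>"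
  shows "rv_entropy \<nu> (\<lambda>x. cell (a * x)) + rv_entropy M (\<lambda>s. cell (b * Y s))
    \<le> conv_entropy \<nu> M Y b + 2 * log 2 (2 * (cmod a * (2 / cmod b + 2 * \<rho>)) + 2) + 2 * log 2 6"
proof -
  interpret N: prob_space \<nu> using nu by (rule fin_suppD)
  let ?p = "\<lambda>v. measure \<nu> {x. cell (a * x) = v}"
  let ?V = "(\<lambda>x. cell (a * x)) ` S"
  let ?h = "rv_entropy M (\<lambda>s. cell (b * Y s)) - 2 * log 2 6"
  have [measurable]: "(\<lambda>x. cell (a * x)) \<in> measurable \<nu> (count_space UNIV)"
    using fin_suppD(2)[OF nu] by (simp cong: measurable_cong_sets)
  have "(\<Sum>v\<in>?V. ?p v) = 1"
    using N.prob_eq_sum_fibers[of "\<lambda>x. cell (a * x)" "\<lambda>_. True" S ?V] fin_suppD[OF nu] N.prob_space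
    by simp
  then have "?h = (\<Sum>v\<in>?V. ?p v * ?h)" by (simp add: sum_distrib_right[symmetric])
  also have "\<dots> \<le> (\<Sum>v\<in>?V. ?p v * conv_entropy (cond_measure \<nu> {x. cell (a * x) = v}) M Y b)"
  proof (rule sum_mono)
    fix v
    have bY: "bounded (Y ` A)" using bdd by (auto simp: bounded_iff)
    show "?p v * ?h \<le> ?p v * conv_entropy (cond_measure \<nu> {x. cell (a * x) = v}) M Y b"
    proof (cases "?p v = 0")
      case False
      then show ?thesis
        using conv_entropy_ge[OF fin_supp_cond_measure[OF nu _ False] M Y A bY b] by (intro mult_left_mono) auto
    qed simp
  qed
  finally show ?thesis using conv_entropy_ge_components[OF assms, of a] by linarith
qed

lemma card_fin_supp_pos: "fin_supp \<nu> S \<Longrightarrow> 0 < card S"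
  using sum_measure_fin_supp[of \<nu> S] fin_suppD(3)[of \<nu> S] by (auto simp: card_gt_0_iff)

lemma rv_entropy_snd_fin_supp:
  assumes nu: "fin_supp \<nu> S" and M: "prob_space M" and m: "\<phi> \<in> measurable M (count_space UNIV)"
  shows "rv_entropy (\<nu> \<Otimes>\<^sub>M M) (\<lambda>z. \<phi> (snd z)) = rv_entropy M \<phi>"
proof -
  have "measure (\<nu> \<Otimes>\<^sub>M M) {z\<in>space (\<nu> \<Otimes>\<^sub>M M). \<phi> (snd z) = v} = measure M {s\<in>space M. \<phi> s = v}" for v
  proof -
    have "measure (\<nu> \<Otimes>\<^sub>M M) {z\<in>space (\<nu> \<Otimes>\<^sub>M M). \<phi> (snd z) = v}
        = (\<Sum>x\<in>S. measure \<nu> {x} * measure M {s\<in>space M. \<phi> (snd (x, s)) = v})"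
      by (intro measure_pair_fin_supp[OF nu M] pred_count_space_const1 measurable_compose[OF measurable_snd m])
    then show ?thesis using sum_measure_fin_supp[OF nu] by (simp add: sum_distrib_right[symmetric])
  qed
  then show ?thesis by (simp add: rv_entropy_def)
qed

text \<open>Given the cell of Y, the cell of x + Y has at most 36 values for each of the
  \<open>card S\<close> translations x.\<close>

lemma conv_entropy_le:
  assumes nu: "fin_supp \<nu> S" and M: "prob_space M" and Y [measurable]: "Y \<in> borel_measurable M"
    and A: "AE s in M. s \<in> A" and bdd: "bounded (Y ` A)" and b: "b \<noteq> 0"
  shows "conv_entropy \<nu> M Y b \<le> rv_entropy M (\<lambda>s. cell (b * Y s)) + log 2 (card S * 36)"
proof -
  note f = fin_suppD[OF nu]
  interpret M: prob_space M by fact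
  interpret N: prob_space \<nu> by fact
  interpret NM: pair_prob_space \<nu> M ..
  let ?\<phi> = "\<lambda>(x, s). cell (b * (x + Y s))" and ?\<psi> = "\<lambda>z. cell (b * Y (snd z))"
  have AE: "AE z in \<nu> \<Otimes>\<^sub>M M. z \<in> S \<times> A" using f M A by (intro AE_pair_Times) auto
  have "rv_entropy (\<nu> \<Otimes>\<^sub>M M) ?\<phi> \<le> rv_entropy (\<nu> \<Otimes>\<^sub>M M) ?\<psi> + log 2 (card S * 36)"
  proof (rule rv_entropy_le_fibers[OF _ _ _ AE])
    show "prob_space (\<nu> \<Otimes>\<^sub>M M)" by unfold_locales
    show "?\<phi> \<in> measurable (\<nu> \<Otimes>\<^sub>M M) (count_space UNIV)"
      using f(2) Y by (rule measurable_cell_sum)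
    show "?\<psi> \<in> measurable (\<nu> \<Otimes>\<^sub>M M) (count_space UNIV)" by measurable
    show "finite (?\<phi> ` (S \<times> A))"
      using finite_cell_scaled_bounded[OF bounded_sum_image[OF f(3) bdd], of b] by (simp add: case_prod_beta')
    have "?\<psi> ` (S \<times> A) \<subseteq> (\<lambda>s. cell (b * Y s)) ` A" by auto
    then show "finite (?\<psi> ` (S \<times> A))"
      using finite_cell_scaled_bounded[OF bdd, of b] by (rule finite_subset)
    show "0 < real (card S * 36)" using card_fin_supp_pos[OF nu] by simp
    fix w
    let ?A = "{s \<in> A. cell (b * Y s) = w}"
    let ?Z = "\<lambda>x. (\<lambda>s. b * (x + Y s)) ` ?A"
    have Z: "finite (cell ` ?Z x)" "real (card (cell ` ?Z x)) \<le> (2 * 2 + 2)\<^sup>2" for x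
    proof -
      have "cmod (y - z) \<le> 2" if yz: "y \<in> ?Z x" "z \<in> ?Z x" for y z
      proof -
        have "\<exists>s s'. cell (b * Y s) = cell (b * Y s') \<and> y = b * (x + Y s) \<and> z = b * (x + Y s')"
          using yz by (elim imageE) (metis (mono_tags, lifting) mem_Collect_eq)
        then obtain s s' where s: "cell (b * Y s) = cell (b * Y s')" "y = b * (x + Y s)" "z = b * (x + Y s')"
          using that by blast
        have "y - z = b * Y s - b * Y s'" by (simp add: s algebra_simps)
        then show ?thesis using cell_eq_imp_dist[OF s(1)] by simp
      qed
      then show "finite (cell ` ?Z x)" "real (card (cell ` ?Z x)) \<le> (2 * 2 + 2)\<^sup>2"
        by (rule card_cell_le; simp)+
    qed
    have "?\<phi> ` {z \<in> S \<times> A. ?\<psi> z = w} = (\<Union>x\<in>S. cell ` ?Z x)" by force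
    then have "card (?\<phi> ` {z \<in> S \<times> A. ?\<psi> z = w}) \<le> (\<Sum>x\<in>S. card (cell ` ?Z x))"
      using f(3) by (simp only: card_UN_le)
    then have "real (card (?\<phi> ` {z \<in> S \<times> A. ?\<psi> z = w})) \<le> (\<Sum>x\<in>S. real (card (cell ` ?Z x)))"
      by (simp only: of_nat_sum[symmetric] of_nat_le_iff)
    also have "\<dots> \<le> (\<Sum>x\<in>S. 36)" using Z(2) by (intro sum_mono) simp
    finally show "real (card (?\<phi> ` {z \<in> S \<times> A. ?\<psi> z = w})) \<le> real (card S * 36)" by simp
  qed
  then show ?thesis
    using rv_entropy_snd_fin_supp[OF nu M, of "\<lambda>s. cell (b * Y s)"] by (simp add: conv_entropy_def)
qed

lemma conv_entropy_distr:
  assumes nu: "fin_supp \<nu> S" and M: "prob_space M" and Y [measurable]: "Y \<in> borel_measurable M"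
    and g [measurable]: "g \<in> borel_measurable borel"
  shows "conv_entropy \<nu> (distr M borel Y) g b = conv_entropy \<nu> M (\<lambda>s. g (Y s)) b"
proof -
  interpret M: prob_space M by fact
  have D: "prob_space (distr M borel Y)" using Y by (rule M.prob_space_distr)
  have "measure (\<nu> \<Otimes>\<^sub>M distr M borel Y) {z\<in>space (\<nu> \<Otimes>\<^sub>M distr M borel Y). (case z of (x, y) \<Rightarrow> cell (b * (x + g y))) = v}
      = measure (\<nu> \<Otimes>\<^sub>M M) {z\<in>space (\<nu> \<Otimes>\<^sub>M M). (case z of (x, s) \<Rightarrow> cell (b * (x + g (Y s)))) = v}" for v
  proof -
    have e: "measure (distr M borel Y) {y. cell (b * (x + g y)) = v} = measure M {s\<in>space M. cell (b * (x + g (Y s))) = v}" for x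
    proof -
      have "{y\<in>space borel. cell (b * (x + g y)) = v} \<in> sets borel" by measurable
      then show ?thesis by (subst measure_distr) (auto intro!: arg_cong[where f="measure M"])
    qed
    show ?thesis
      using measurable_cell_sum[OF fin_suppD(2)[OF nu], of g "distr M borel Y" b]
        measurable_cell_sum[OF fin_suppD(2)[OF nu], of "\<lambda>s. g (Y s)" M b]
      by (subst (1 2) measure_pair_fin_supp[OF nu]) (auto simp: e D M intro!: pred_count_space_const1)
  qed
  then show ?thesis by (simp add: conv_entropy_def rv_entropy_def)
qed

section \<open>Words, partial sums and the measures of the model\<close>

lemma shift_funpow: "(shift ^^ m) \<omega> = (\<lambda>j. \<omega> (m + j))"
  by (induction m arbitrary: \<omega>) (auto simp: shift_def)

locale planar =
  fixes lam :: "'i::finite \<Rightarrow> complex" and k :: "'i \<Rightarrow> nat"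
    and t :: "'i \<Rightarrow> nat \<Rightarrow> complex" and p :: "'i \<Rightarrow> nat \<Rightarrow> real"
  assumes model: "planar_model lam k t p"
begin

definition rmax :: real where "rmax = Max (range (\<lambda>i. cmod (lam i)))"
definition rmin :: real where "rmin = Min (range (\<lambda>i. cmod (lam i)))"
definition tmax :: real where "tmax = Max (range (\<lambda>i. Max ((\<lambda>j. cmod (t i j)) ` {..<k i})))"
definition kmax :: nat where "kmax = Max (range k)"
text \<open>Sum of the geometric series with terms \<open>tmax * rmax ^ i\<close>: a radius that
  contains all partial and full sums over valid digits.\<close>

definition B :: real where "B = tmax / (1 - rmax)"

definition lam_prod :: "(nat \<Rightarrow> 'i) \<Rightarrow> nat \<Rightarrow> complex" where "lam_prod \<omega> m = (\<Prod>j<m. lam (\<omega> j))"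
definition partial_sum :: "(nat \<Rightarrow> 'i) \<Rightarrow> nat \<Rightarrow> (nat \<Rightarrow> nat) \<Rightarrow> complex" where
  "partial_sum \<omega> m u = (\<Sum>i<m. lam_prod \<omega> i * t (\<omega> i) (u i))"
definition full_sum :: "(nat \<Rightarrow> 'i) \<Rightarrow> (nat \<Rightarrow> nat) \<Rightarrow> complex" where
  "full_sum \<omega> u = (\<Sum>i. lam_prod \<omega> i * t (\<omega> i) (u i))"
definition dig :: "(nat \<Rightarrow> 'i) \<Rightarrow> nat \<Rightarrow> nat measure" where
  "dig \<omega> j = measure_pmf (digit_pmf k p (\<omega> j))"
text \<open>Digits outside the alphabet have probability 0 but are still points of the product
  space. The bounds on the sums, and the convergence of \<open>full_sum\<close>, are obtained on
  this set.\<close>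

definition valid :: "(nat \<Rightarrow> 'i) \<Rightarrow> (nat \<Rightarrow> nat) set" where "valid \<omega> = {u. \<forall>j. u j < k (\<omega> j)}"

abbreviation "nu \<equiv> nu_meas lam k t p"
abbreviation "eta \<equiv> eta_meas lam k t p"
abbreviation "tau \<equiv> tau_meas lam k t p"

lemma lam_bounds: "rmin \<le> cmod (lam i)" "cmod (lam i) \<le> rmax" "0 < rmin" "rmax < 1"
proof -
  have m: "\<And>i. 0 < cmod (lam i) \<and> cmod (lam i) < 1" using model by (auto simp: planar_model_def)
  show "rmin \<le> cmod (lam i)" "cmod (lam i) \<le> rmax" by (auto simp: rmin_def rmax_def)
  show "0 < rmin" "rmax < 1" using m by (auto simp: rmin_def rmax_def)
qed

lemma rmax_pos: "0 < rmax" using lam_bounds(1,2)[of undefined] lam_bounds(3) by linarith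

lemma k_pos: "0 < k i" using model by (auto simp: planar_model_def Suc_le_eq)

lemma t_bound: "j < k i \<Longrightarrow> cmod (t i j) \<le> tmax"
proof -
  assume "j < k i"
  then have "cmod (t i j) \<le> Max ((\<lambda>j. cmod (t i j)) ` {..<k i})" by (intro Max_ge) auto
  also have "\<dots> \<le> tmax" unfolding tmax_def by (intro Max_ge) auto
  finally show ?thesis .
qed

lemma tmax_nonneg: "0 \<le> tmax"
  using t_bound[OF k_pos, of undefined] norm_ge_zero order_trans by blast

lemma B_nonneg: "0 \<le> B" using tmax_nonneg lam_bounds by (simp add: B_def)

lemma k_le: "k i \<le> kmax" by (simp add: kmax_def)

lemma kmax_pos: "0 < kmax" using k_pos[of undefined] k_le[of undefined] by linarith

lemma lam_prod_0 [simp]: "lam_prod \<omega> 0 = 1" by (simp add: lam_prod_def)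

lemma lam_prod_nonzero: "lam_prod \<omega> m \<noteq> 0" using model by (auto simp: lam_prod_def planar_model_def)

lemma lam_prod_add: "lam_prod \<omega> (m + d) = lam_prod \<omega> m * lam_prod ((shift ^^ m) \<omega>) d"
  unfolding lam_prod_def shift_funpow
  by (induction d) (auto simp: mult.assoc)

lemma lam_prod_le: "cmod (lam_prod \<omega> m) \<le> rmax ^ m"
proof -
  have "cmod (lam_prod \<omega> m) \<le> (\<Prod>j<m. rmax)"
    unfolding lam_prod_def prod_norm[symmetric] using lam_bounds by (intro prod_mono) auto
  then show ?thesis by simp
qed

lemma lam_prod_ge: "rmin ^ m \<le> cmod (lam_prod \<omega> m)"
proof -
  have "(\<Prod>j<m. rmin) \<le> cmod (lam_prod \<omega> m)"
    unfolding lam_prod_def prod_norm[symmetric] using lam_bounds less_imp_le[OF lam_bounds(3)] by (intro prod_mono) auto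
  then show ?thesis by simp
qed

lemma lam_prod_le_1: "cmod (lam_prod \<omega> m) \<le> 1"
  using lam_prod_le[of \<omega> m] power_le_one[of rmax m] rmax_pos lam_bounds by (meson less_imp_le order_trans)

lemma term_bound:
  assumes "u (m + i) < k (\<omega> (m + i))"
  shows "cmod (lam_prod \<omega> (m + i) * t (\<omega> (m + i)) (u (m + i))) \<le> cmod (lam_prod \<omega> m) * tmax * rmax ^ i"
proof -
  have "cmod (lam_prod ((shift ^^ m) \<omega>) i) * cmod (t (\<omega> (m + i)) (u (m + i))) \<le> rmax ^ i * tmax"
    using lam_prod_le[of "(shift ^^ m) \<omega>" i] t_bound[OF assms] rmax_pos by (intro mult_mono) auto
  then have "cmod (lam_prod \<omega> m) * (cmod (lam_prod ((shift ^^ m) \<omega>) i) * cmod (t (\<omega> (m + i)) (u (m + i)))) \<le> cmod (lam_prod \<omega> m) * (rmax ^ i * tmax)"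
    by (intro mult_left_mono) auto
  then show ?thesis unfolding lam_prod_add norm_mult by (simp add: ac_simps)
qed

lemma sums_geom: "(\<lambda>i. c * tmax * rmax ^ i) sums (c * B)"
  using sums_mult[OF geometric_sums[of rmax], of "c * tmax"] rmax_pos lam_bounds
  by (simp add: B_def)

text \<open>After the factor \<open>lam_prod \<omega> m\<close> is pulled out, the tail is dominated
  by the geometric series with sum B. So the digits after position m act only at the scale of level
  m.\<close>

lemma partial_sum_diff_bound:
  assumes "\<And>j. j < m + d \<Longrightarrow> u j < k (\<omega> j)"
  shows "cmod (partial_sum \<omega> (m + d) u - partial_sum \<omega> m u) \<le> cmod (lam_prod \<omega> m) * B"
proof -
  have "partial_sum \<omega> (m + d) u - partial_sum \<omega> m u = (\<Sum>i<d. lam_prod \<omega> (m + i) * t (\<omega> (m + i)) (u (m + i)))"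
    unfolding partial_sum_def by (induction d) (auto simp: algebra_simps)
  also have "cmod \<dots> \<le> (\<Sum>i<d. cmod (lam_prod \<omega> m) * tmax * rmax ^ i)"
    using assms by (intro sum_norm_le term_bound) auto
  also have "\<dots> \<le> cmod (lam_prod \<omega> m) * B"
    using sums_geom[of "cmod (lam_prod \<omega> m)"] tmax_nonneg rmax_pos
    by (subst sums_unique[OF sums_geom]) (intro sum_le_suminf sums_summable[OF sums_geom], auto)
  finally show ?thesis .
qed

lemma partial_sum_bound:
  assumes "\<And>j. j < m \<Longrightarrow> u j < k (\<omega> j)"
  shows "cmod (partial_sum \<omega> m u) \<le> B"
  using partial_sum_diff_bound[of 0 m u \<omega>] assms by (simp add: partial_sum_def)

lemma full_sum_diff_bound:
  assumes "u \<in> valid \<omega>"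
  shows "cmod (full_sum \<omega> u - partial_sum \<omega> m u) \<le> cmod (lam_prod \<omega> m) * B"
proof -
  let ?f = "\<lambda>i. lam_prod \<omega> i * t (\<omega> i) (u i)"
  have b: "norm (?f (i + m)) \<le> cmod (lam_prod \<omega> m) * tmax * rmax ^ i" for i
    using term_bound[of u m i \<omega>] assms by (simp add: valid_def add.commute)
  have s: "summable (\<lambda>i. cmod (lam_prod \<omega> m) * tmax * rmax ^ i)" using sums_geom by (rule sums_summable)
  have "summable (\<lambda>i. ?f (i + m))" using b by (intro summable_comparison_test'[OF s, of 0]) auto
  then have "summable ?f" using summable_iff_shift[of ?f m] by simp
  then have "full_sum \<omega> u - partial_sum \<omega> m u = (\<Sum>i. ?f (i + m))"
    using suminf_split_initial_segment[of ?f m] by (simp add: full_sum_def partial_sum_def)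
  also have "cmod \<dots> \<le> (\<Sum>i. cmod (lam_prod \<omega> m) * tmax * rmax ^ i)"
    using b s by (intro norm_suminf_le) auto
  also have "\<dots> = cmod (lam_prod \<omega> m) * B" using sums_geom by (rule sums_unique[symmetric])
  finally show ?thesis .
qed

lemma full_sum_bound: "u \<in> valid \<omega> \<Longrightarrow> cmod (full_sum \<omega> u) \<le> B"
  using full_sum_diff_bound[of u \<omega> 0] by (simp add: partial_sum_def)

lemma comp_map_eq: "comp_map lam t \<omega> u m z = partial_sum \<omega> m u + lam_prod \<omega> m * z"
  by (induction m arbitrary: z) (auto simp: partial_sum_def lam_prod_def ifs_map_def algebra_simps)

lemma nu_eq: "nu \<omega> m = distr (PiM {..<m} (dig \<omega>)) borel (partial_sum \<omega> m)"
  by (simp add: nu_meas_def comp_map_eq dig_def[abs_def])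

lemma eta_eq: "eta \<omega> = distr (PiM UNIV (dig \<omega>)) borel (full_sum \<omega>)"
  by (simp add: eta_meas_def full_sum_def[abs_def] dig_def[abs_def] lam_prod_def)

lemma prob_space_dig: "prob_space (dig \<omega> j)" by (simp add: dig_def prob_space_measure_pmf)

lemma prob_space_PiM_dig: "prob_space (PiM I (dig \<omega>))" by (intro prob_space_PiM prob_space_dig)

text \<open>\<open>embed_pmf\<close> is known to have the prescribed weights once these are
  nonnegative with sum 1; the model supplies both.\<close>

lemma set_digit_pmf: "set_pmf (digit_pmf k p i) \<subseteq> {..<k i}"
proof -
  let ?f = "\<lambda>j. if j < k i then p i j else 0"
  have nn: "0 \<le> (if j < k i then p i j else 0)" for j using model by (auto simp: planar_model_def less_imp_le)
  have "(\<integral>\<^sup>+j. ennreal (?f j) \<partial>count_space UNIV) = (\<Sum>j<k i. ennreal (?f j))"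
    by (intro nn_integral_count_space') auto
  also have "\<dots> = ennreal (\<Sum>j<k i. ?f j)" by (intro sum_ennreal nn)
  also have "(\<Sum>j<k i. ?f j) = 1" using model by (auto simp: planar_model_def)
  finally have "pmf (digit_pmf k p i) j = ?f j" for j
    unfolding digit_pmf_def by (intro pmf_embed_pmf nn) simp
  then show ?thesis by (auto simp: set_pmf_iff split: if_splits)
qed

lemma AE_dig: "AE u in PiM I (dig \<omega>). \<forall>j\<in>I. u j < k (\<omega> j)"
proof -
  have "AE u in PiM I (dig \<omega>). \<forall>j. j \<in> I \<longrightarrow> u j < k (\<omega> j)"
  proof (subst AE_all_countable, intro allI)
    fix j
    show "AE u in PiM I (dig \<omega>). j \<in> I \<longrightarrow> u j < k (\<omega> j)"
    proof (cases "j \<in> I")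
      case True
      have "AE x in dig \<omega> j. x < k (\<omega> j)"
        unfolding dig_def using set_digit_pmf by (auto simp: AE_measure_pmf_iff)
      then have "AE u in PiM I (dig \<omega>). u j < k (\<omega> j)"
        using True prob_space_dig by (intro AE_PiM_component) auto
      then show ?thesis by simp
    qed simp
  qed
  then show ?thesis by (simp add: Ball_def)
qed

lemma AE_valid: "AE u in PiM UNIV (dig \<omega>). u \<in> valid \<omega>"
  using AE_dig[of UNIV \<omega>] by (simp add: valid_def)

lemma measurable_t_digit: "i \<in> I \<Longrightarrow> (\<lambda>u. t a (u i)) \<in> borel_measurable (PiM I (dig \<omega>))"
  by (rule measurable_compose[OF measurable_component_singleton]) (auto simp: dig_def)

lemma measurable_partial_sum: "{..<m} \<subseteq> I \<Longrightarrow> partial_sum \<omega> m \<in> borel_measurable (PiM I (dig \<omega>'))"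
  unfolding partial_sum_def[abs_def]
  by (intro borel_measurable_sum borel_measurable_times borel_measurable_const measurable_t_digit) auto

lemma measurable_full_sum: "full_sum \<omega> \<in> borel_measurable (PiM UNIV (dig \<omega>'))"
  unfolding full_sum_def[abs_def]
  by (intro borel_measurable_suminf borel_measurable_times borel_measurable_const measurable_t_digit) auto

definition nu_supp :: "(nat \<Rightarrow> 'i) \<Rightarrow> nat \<Rightarrow> complex set" where
  "nu_supp \<omega> m = partial_sum \<omega> m ` PiE {..<m} (\<lambda>j. {..<k (\<omega> j)})"

lemma fin_supp_nu: "fin_supp (nu \<omega> m) (nu_supp \<omega> m)"
proof -
  interpret prob_space "PiM {..<m} (dig \<omega>)" by (rule prob_space_PiM_dig)
  have m: "partial_sum \<omega> m \<in> borel_measurable (PiM {..<m} (dig \<omega>))" by (rule measurable_partial_sum) simp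
  have fin: "finite (nu_supp \<omega> m)" by (auto simp: nu_supp_def intro!: finite_PiE)
  have "AE u in PiM {..<m} (dig \<omega>). partial_sum \<omega> m u \<in> nu_supp \<omega> m"
    using AE_dig[of "{..<m}" \<omega>] AE_space
  proof eventually_elim
    fix u assume "\<forall>j\<in>{..<m}. u j < k (\<omega> j)" "u \<in> space (PiM {..<m} (dig \<omega>))"
    then show "partial_sum \<omega> m u \<in> nu_supp \<omega> m" unfolding nu_supp_def by (auto simp: space_PiM PiE_iff intro!: imageI)
  qed
  then have "AE x in nu \<omega> m. x \<in> nu_supp \<omega> m"
    unfolding nu_eq using AE_distr_iff[OF m, of "\<lambda>x. x \<in> nu_supp \<omega> m"] borel_closed[OF finite_imp_closed[OF fin]]
    by simp
  then show ?thesis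
    using prob_space_distr[OF m] fin by (simp add: fin_supp_def) (simp add: nu_eq)
qed

lemma card_nu_supp: "card (nu_supp \<omega> m) \<le> kmax ^ m"
proof -
  have "card (nu_supp \<omega> m) \<le> card (PiE {..<m} (\<lambda>j. {..<k (\<omega> j)}))"
    unfolding nu_supp_def by (intro card_image_le finite_PiE) auto
  also have "\<dots> = (\<Prod>j<m. k (\<omega> j))" by (simp add: card_PiE)
  also have "\<dots> \<le> (\<Prod>j<m. kmax)" by (intro prod_mono) (auto simp: k_le)
  finally show ?thesis by simp
qed

lemma nu_supp_bound: "x \<in> nu_supp \<omega> m \<Longrightarrow> cmod x \<le> B"
  by (auto simp: nu_supp_def intro!: partial_sum_bound)

text \<open>The first m digits and the next d are independent, and the second block enters as a copy
  of the construction for the shifted sequence, scaled by \<open>lam_prod \<omega> m\<close>. Thus a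
  level measure is a convolution, to which the preceding section applies.\<close>

lemma nu_add: "nu \<omega> (m + d) = distr (nu \<omega> m \<Otimes>\<^sub>M nu ((shift ^^ m) \<omega>) d) borel (\<lambda>(x, y). x + lam_prod \<omega> m * y)"
proof -
  let ?\<omega>' = "(shift ^^ m) \<omega>"
  let ?I = "{..<m}" and ?J = "{m..<m+d}" and ?M = "dig \<omega>"
  let ?g = "\<lambda>v. \<lambda>j\<in>{..<d}. v (m + j) :: nat"
  interpret product_prob_space ?M UNIV by (intro product_prob_spaceI prob_space_dig)
  interpret J: prob_space "PiM ?J ?M" by (rule prob_space_PiM_dig)
  have IJ: "{..<m+d} = ?I \<union> ?J" by auto
  have shift_M: "(\<lambda>i. ?M (m + i)) = dig ?\<omega>'" by (auto simp: dig_def shift_funpow)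
  \<comment> \<open>Reindexing the digits m, ..., m + d - 1 as 0, ..., d - 1 turns their law into
    that of the shifted sequence.\<close>
  have R: "distr (PiM ?J ?M) (PiM {..<d} (dig ?\<omega>')) ?g = PiM {..<d} (dig ?\<omega>')"
    using distr_PiM_reindex[of ?J ?M "\<lambda>j. m + j" "{..<d}"] prob_space_dig
    unfolding shift_M by auto
  have g: "?g \<in> measurable (PiM ?J ?M) (PiM {..<d} (dig ?\<omega>'))"
    unfolding shift_M[symmetric] by (intro measurable_restrict measurable_component_singleton) auto
  have [measurable]: "partial_sum \<omega> m \<in> borel_measurable (PiM ?I ?M)"
    "partial_sum ?\<omega>' d \<in> borel_measurable (PiM {..<d} (dig ?\<omega>'))" "partial_sum \<omega> (m + d) \<in> borel_measurable (PiM (?I \<union> ?J) ?M)"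
    by (auto intro!: measurable_partial_sum)
  have psg [measurable]: "(\<lambda>v. partial_sum ?\<omega>' d (?g v)) \<in> borel_measurable (PiM ?J ?M)"
    by (rule measurable_compose[OF g]) measurable
  have nu2: "nu ?\<omega>' d = distr (PiM ?J ?M) borel (\<lambda>v. partial_sum ?\<omega>' d (?g v))"
    unfolding nu_eq by (subst R[symmetric], subst distr_distr) (auto simp: g comp_def intro!: measurable_partial_sum)
  have pair: "nu \<omega> m \<Otimes>\<^sub>M nu ?\<omega>' d = distr (PiM ?I ?M \<Otimes>\<^sub>M PiM ?J ?M) (borel \<Otimes>\<^sub>M borel) (\<lambda>(u, v). (partial_sum \<omega> m u, partial_sum ?\<omega>' d (?g v)))"
    unfolding nu2 nu_eq[of \<omega> m]
    by (intro pair_measure_distr prob_space_imp_sigma_finite J.prob_space_distr) measurable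
  have split: "partial_sum \<omega> (m + d) (merge ?I ?J (u, v)) = partial_sum \<omega> m u + lam_prod \<omega> m * partial_sum ?\<omega>' d (?g v)" for u v
  proof -
    have "partial_sum \<omega> (m + d) w = partial_sum \<omega> m w + (\<Sum>i<d. lam_prod \<omega> (m + i) * t (\<omega> (m + i)) (w (m + i)))" for w
      unfolding partial_sum_def by (induction d) (auto simp: algebra_simps)
    then show ?thesis
      by (simp add: partial_sum_def merge_def lam_prod_add shift_funpow sum_distrib_left mult.assoc)
  qed
  have "nu \<omega> (m + d) = distr (distr (PiM ?I ?M \<Otimes>\<^sub>M PiM ?J ?M) (PiM (?I \<union> ?J) ?M) (merge ?I ?J)) borel (partial_sum \<omega> (m + d))"
    unfolding nu_eq IJ by (subst distr_merge) auto
  also have "\<dots> = distr (PiM ?I ?M \<Otimes>\<^sub>M PiM ?J ?M) borel (\<lambda>(u, v). partial_sum \<omega> m u + lam_prod \<omega> m * partial_sum ?\<omega>' d (?g v))"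
    by (subst distr_distr) (auto simp: comp_def split case_prod_beta' intro!: distr_cong)
  also have "\<dots> = distr (nu \<omega> m \<Otimes>\<^sub>M nu ?\<omega>' d) borel (\<lambda>(x, y). x + lam_prod \<omega> m * y)"
    unfolding pair by (subst distr_distr) (auto simp: comp_def case_prod_beta' intro!: distr_cong)
  finally show ?thesis .
qed

text \<open>Puts all levels on one probability space, so that sums with different numbers of digits
  can be compared point by point.\<close>

lemma nu_eq_UNIV: "nu \<omega> m = distr (PiM UNIV (dig \<omega>)) borel (partial_sum \<omega> m)"
proof -
  interpret product_prob_space "dig \<omega>" UNIV by (intro product_prob_spaceI prob_space_dig)
  have "partial_sum \<omega> m (restrict x {..<m}) = partial_sum \<omega> m x" for x by (simp add: partial_sum_def)
  then show ?thesis
    unfolding nu_eq by (subst distr_PiM_restrict_finite[symmetric, of "{..<m}"])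
      (auto simp: distr_distr comp_def measurable_partial_sum intro!: distr_cong measurable_restrict_subset)
qed

section \<open>Entropy of the level measures at their own scale\<close>

text \<open>Rescaling by the complex number \<^term>\<open>lam_prod \<omega> m\<close>, rotation included, makes these entropies
  superadditive along the shift up to a constant.\<close>

definition G :: "(nat \<Rightarrow> 'i) \<Rightarrow> nat \<Rightarrow> real" where
  "G \<omega> m = rv_entropy (nu \<omega> m) (\<lambda>z. cell (inverse (lam_prod \<omega> m) * z))"

lemma sets_nu: "sets (nu \<omega> m) = sets borel" by (simp add: nu_meas_def)

lemma prob_space_nu: "prob_space (nu \<omega> m)" using fin_suppD(1)[OF fin_supp_nu] .

lemma measurable_nu: "measurable (nu \<omega> m) N = measurable borel N"
  using sets_nu by (rule measurable_cong_sets) simp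

lemma G_nonneg: "0 \<le> G \<omega> m" unfolding G_def by (intro rv_entropy_nonneg prob_space_nu)

lemma rv_entropy_nu_UNIV: "rv_entropy (nu \<omega> m) (\<lambda>z. cell (a * z)) = rv_entropy (PiM UNIV (dig \<omega>)) (\<lambda>u. cell (a * partial_sum \<omega> m u))"
  unfolding nu_eq_UNIV by (subst rv_entropy_distr) (auto intro!: measurable_partial_sum)

lemma rv_entropy_nu_add:
  "rv_entropy (nu \<omega> (m + d)) (\<lambda>z. cell (b * z)) = conv_entropy (nu \<omega> m) (nu ((shift ^^ m) \<omega>) d) (\<lambda>y. lam_prod \<omega> m * y) b"
proof -
  have "(\<lambda>(x, y). x + lam_prod \<omega> m * y) \<in> borel_measurable (borel \<Otimes>\<^sub>M borel)" by measurable
  moreover have "sets (nu \<omega> m \<Otimes>\<^sub>M nu ((shift ^^ m) \<omega>) d) = sets (borel \<Otimes>\<^sub>M borel)"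
    by (intro sets_pair_measure_cong sets_nu)
  ultimately have "(\<lambda>(x, y). x + lam_prod \<omega> m * y) \<in> borel_measurable (nu \<omega> m \<Otimes>\<^sub>M nu ((shift ^^ m) \<omega>) d)"
    using measurable_cong_sets by blast
  then show ?thesis unfolding nu_add conv_entropy_def by (subst rv_entropy_distr) (auto simp: case_prod_beta')
qed

lemma inverse_lam_prod_add: "inverse (lam_prod \<omega> (m + d)) * (lam_prod \<omega> m * y) = inverse (lam_prod ((shift ^^ m) \<omega>) d) * y"
  unfolding lam_prod_add[of _ m d] using lam_prod_nonzero[of \<omega> m] by simp

lemma AE_nu_supp: "AE y in nu \<omega> m. y \<in> nu_supp \<omega> m" using fin_suppD(4)[OF fin_supp_nu] .

text \<open>Origin: with scales inverse to those of levels m and m + d, the chain rule counts 2 D +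
  2 values per coordinate, where D \<le> 2 + 2 B. The second term is the cost of a translated
  grid.\<close>

definition c1 :: real where "c1 = 2 * log 2 (6 + 4 * B) + 2 * log 2 6"

lemma c1_nonneg: "0 \<le> c1" using B_nonneg by (simp add: c1_def)

text \<open>By \<open>nu_add\<close> the measure of level m + d is a convolution whose second
  summand, seen at the finer scale, is exactly the shifted problem of level d: the factors
  \<open>lam_prod \<omega> m\<close> cancel.\<close>

lemma G_superadd: "G \<omega> m + G ((shift ^^ m) \<omega>) d \<le> G \<omega> (m + d) + c1"
proof -
  let ?\<omega>' = "(shift ^^ m) \<omega>"
  have "rv_entropy (nu \<omega> m) (\<lambda>x. cell (inverse (lam_prod \<omega> m) * x))
      + rv_entropy (nu ?\<omega>' d) (\<lambda>s. cell (inverse (lam_prod \<omega> (m + d)) * (lam_prod \<omega> m * s)))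
    \<le> conv_entropy (nu \<omega> m) (nu ?\<omega>' d) (\<lambda>y. lam_prod \<omega> m * y) (inverse (lam_prod \<omega> (m + d)))
      + 2 * log 2 (2 * (cmod (inverse (lam_prod \<omega> m)) * (2 / cmod (inverse (lam_prod \<omega> (m + d))) + 2 * (cmod (lam_prod \<omega> m) * B))) + 2)
      + 2 * log 2 6"
    using lam_prod_nonzero B_nonneg nu_supp_bound[of _ ?\<omega>' d]
    by (intro conv_entropy_superadd[OF fin_supp_nu prob_space_nu _ AE_nu_supp])
       (auto simp: measurable_nu norm_mult intro!: mult_left_mono)
  moreover have "cmod (inverse (lam_prod \<omega> m)) * (2 / cmod (inverse (lam_prod \<omega> (m + d))) + 2 * (cmod (lam_prod \<omega> m) * B))
      = 2 * cmod (lam_prod ?\<omega>' d) + 2 * B"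
    unfolding lam_prod_add[of _ m d] norm_mult norm_inverse using lam_prod_nonzero[of \<omega> m] by (simp add: field_simps)
  moreover have "log 2 (2 * (2 * cmod (lam_prod ?\<omega>' d) + 2 * B) + 2) \<le> log 2 (6 + 4 * B)"
    using lam_prod_le_1[of ?\<omega>' d] B_nonneg by (subst log_le_cancel_iff) (auto intro: add_nonneg_pos)
  ultimately show ?thesis
    unfolding G_def by (simp add: rv_entropy_nu_add inverse_lam_prod_add c1_def)
qed

lemma bounded_partial_sum: "bounded (partial_sum \<omega> m ` valid \<omega>)"
  unfolding bounded_iff using partial_sum_bound[of m _ \<omega>] by (auto simp: valid_def intro!: exI[of _ B])

lemma bounded_full_sum: "bounded (full_sum \<omega> ` valid \<omega>)"
  using full_sum_bound[of _ \<omega>] by (auto simp: bounded_iff)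

lemma cmod_diff_perturb:
  fixes x x' y y' :: complex
  assumes "cmod (x - y) \<le> e" "cmod (x' - y') \<le> e"
  shows "cmod (x - x') \<le> cmod (y - y') + 2 * e"
proof -
  have e: "x - x' = (y - y') + ((x - y) - (x' - y'))" by simp
  have "cmod (x - x') \<le> cmod (y - y') + cmod ((x - y) - (x' - y'))"
    by (subst e) (rule norm_triangle_ineq)
  also have "cmod ((x - y) - (x' - y')) \<le> 2 * e"
    using norm_triangle_ineq4[of "x - y" "x' - y'"] assms by linarith
  finally show ?thesis by simp
qed

text \<open>A further letter refines the scale by no more than the factor \<open>1 / rmin\<close>;
  the logarithm is doubled because cells are counted in two dimensions. The second part pays for the
  grid and the tail of the series.\<close>

definition c2 :: real where "c2 = 2 * log 2 (1 / rmin) + 2 * log 2 (6 + 4 * B)"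

lemma log_rmin: "0 \<le> log 2 (1 / rmin)"
  using lam_bounds(1,2)[of undefined] lam_bounds(3,4) by simp

lemma c2_nonneg: "0 \<le> c2" using B_nonneg log_rmin by (simp add: c2_def)

text \<open>Appending d letters moves a point by at most B times the old scale and refines the grid
  by at most \<open>(1 / rmin) ^ d\<close>. An old cell therefore leaves at most
  \<open>((6 + 4 * B) * (1 / rmin) ^ d)\<^sup>2\<close> new ones.\<close>

lemma G_add_right_le: "G \<omega> (l + d) \<le> G \<omega> l + c2 * (real d + 1)"
proof -
  let ?P = "PiM UNIV (dig \<omega>)"
  let ?e = "cmod (lam_prod \<omega> l) * B"
  have "rv_entropy ?P (\<lambda>u. cell (inverse (lam_prod \<omega> (l + d)) * partial_sum \<omega> (l + d) u))
      \<le> rv_entropy ?P (\<lambda>u. cell (inverse (lam_prod \<omega> l) * partial_sum \<omega> l u))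
      + 2 * log 2 (2 * (cmod (inverse (lam_prod \<omega> (l + d))) * (2 / cmod (inverse (lam_prod \<omega> l)) + 2 * ?e)) + 2)"
    using B_nonneg lam_prod_nonzero
    by (intro rv_entropy_cell_le[OF prob_space_PiM_dig _ _ AE_valid] measurable_partial_sum bounded_partial_sum
      cmod_diff_perturb partial_sum_diff_bound) (auto simp: valid_def)
  moreover have "2 * (cmod (inverse (lam_prod \<omega> (l + d))) * (2 / cmod (inverse (lam_prod \<omega> l)) + 2 * ?e)) + 2
      = (4 + 4 * B) / cmod (lam_prod ((shift ^^ l) \<omega>) d) + 2"
    unfolding lam_prod_add[of _ l d] norm_mult norm_inverse
    using lam_prod_nonzero[of \<omega> l] lam_prod_nonzero[of "(shift ^^ l) \<omega>" d] by (simp add: field_simps)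
  moreover have "(4 + 4 * B) / cmod (lam_prod ((shift ^^ l) \<omega>) d) + 2 \<le> (6 + 4 * B) * (1 / rmin) ^ d"
  proof -
    have "(4 + 4 * B) / cmod (lam_prod ((shift ^^ l) \<omega>) d) \<le> (4 + 4 * B) / rmin ^ d"
      using lam_prod_ge[of d "(shift ^^ l) \<omega>"] B_nonneg lam_bounds(3) by (intro divide_left_mono) (auto simp: lam_prod_nonzero)
    moreover have "2 \<le> 2 / rmin ^ d"
    proof -
      have "rmin ^ d \<le> 1" using lam_prod_ge[of d \<omega>] lam_prod_le_1[of \<omega> d] by linarith
      then show ?thesis using lam_bounds(3) by (simp add: field_simps)
    qed
    ultimately show ?thesis by (simp add: power_divide add_divide_distrib)
  qed
  then have "log 2 ((4 + 4 * B) / cmod (lam_prod ((shift ^^ l) \<omega>) d) + 2) \<le> log 2 ((6 + 4 * B) * (1 / rmin) ^ d)"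
    using B_nonneg lam_bounds(3) by (subst log_le_cancel_iff) (auto intro!: add_nonneg_pos mult_pos_pos)
  moreover have "log 2 ((6 + 4 * B) * (1 / rmin) ^ d) = log 2 (6 + 4 * B) + d * log 2 (1 / rmin)"
    using B_nonneg lam_bounds(3) by (subst log_mult) (auto simp: log_nat_power simp del: power_one_over)
  ultimately have "G \<omega> (l + d) \<le> G \<omega> l + 2 * (log 2 (6 + 4 * B) + d * log 2 (1 / rmin))"
    unfolding G_def rv_entropy_nu_UNIV by simp
  also have "\<dots> \<le> G \<omega> l + c2 * (real d + 1)"
  proof -
    have "0 \<le> real d * log 2 (6 + 4 * B)" using B_nonneg by simp
    then show ?thesis using log_rmin unfolding c2_def by (simp add: algebra_simps)
  qed
  finally show ?thesis .
qed

definition c3 :: real where "c3 = log 2 kmax + log 2 36"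

lemma c3_nonneg: "0 \<le> c3" using kmax_pos by (simp add: c3_def)

text \<open>Prepending d letters convolves with a measure on at most \<open>kmax ^ d\<close> points,
  and the rescaled second factor is the level l problem of the shifted sequence.\<close>

lemma G_add_left_le: "G \<omega> (d + l) \<le> G ((shift ^^ d) \<omega>) l + c3 * (real d + 1)"
proof -
  let ?\<omega>' = "(shift ^^ d) \<omega>"
  have "bounded (nu_supp ?\<omega>' l)" using nu_supp_bound by (auto simp: bounded_iff)
  then have "bounded ((\<lambda>y. lam_prod \<omega> d * y) ` nu_supp ?\<omega>' l)"
    by (intro bounded_linear_image[OF _ bounded_linear_mult_right])
  then have "conv_entropy (nu \<omega> d) (nu ?\<omega>' l) (\<lambda>y. lam_prod \<omega> d * y) (inverse (lam_prod \<omega> (d + l)))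
      \<le> rv_entropy (nu ?\<omega>' l) (\<lambda>s. cell (inverse (lam_prod \<omega> (d + l)) * (lam_prod \<omega> d * s))) + log 2 (card (nu_supp \<omega> d) * 36)"
    using lam_prod_nonzero
    by (intro conv_entropy_le[OF fin_supp_nu prob_space_nu _ AE_nu_supp]) (auto simp: measurable_nu)
  then have "G \<omega> (d + l) \<le> G ?\<omega>' l + log 2 (card (nu_supp \<omega> d) * 36)"
    unfolding G_def by (simp add: rv_entropy_nu_add inverse_lam_prod_add)
  also have "log 2 (card (nu_supp \<omega> d) * 36) \<le> log 2 (real kmax ^ d * 36)"
  proof -
    have "real (card (nu_supp \<omega> d)) \<le> real kmax ^ d" using card_nu_supp[of \<omega> d] by (metis of_nat_le_iff of_nat_power)
    then show ?thesis using card_fin_supp_pos[OF fin_supp_nu, of \<omega> d] kmax_pos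
      by (subst log_le_cancel_iff) auto
  qed
  also have "\<dots> = d * log 2 kmax + log 2 36"
    using kmax_pos by (subst log_mult) (auto simp: log_nat_power)
  also have "\<dots> \<le> c3 * (real d + 1)"
  proof -
    have "0 \<le> real d * log 2 36" "0 \<le> log 2 kmax" using kmax_pos by auto
    then show ?thesis unfolding c3_def by (simp add: algebra_simps)
  qed
  finally show ?thesis by simp
qed

section \<open>The stopping level n' and comparison with dyadic scales\<close>

context
  fixes R :: real
  assumes R: "0 < R"
begin

abbreviation np :: "(nat \<Rightarrow> 'i) \<Rightarrow> nat \<Rightarrow> nat" where "np \<omega> n \<equiv> n_prime lam R \<omega> n"

lemma np_def: "np \<omega> n = (LEAST m. 2 * R * cmod (lam_prod \<omega> m) \<le> 1 / 2 ^ n)"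
  by (simp add: n_prime_def lam_prod_def prod_norm powr_minus powr_realpow inverse_eq_divide)

lemma np_exists: "\<exists>m. 2 * R * cmod (lam_prod \<omega> m) \<le> 1 / 2 ^ n"
proof -
  have "(\<lambda>m. 2 * R * rmax ^ m) \<longlonglongrightarrow> 2 * R * 0"
    using rmax_pos lam_bounds(4) by (intro tendsto_intros LIMSEQ_realpow_zero) auto
  then have "eventually (\<lambda>m. 2 * R * rmax ^ m < 1 / 2 ^ n) sequentially"
    by (rule order_tendstoD) simp
  then obtain m where "2 * R * rmax ^ m < 1 / 2 ^ n" by (auto simp: eventually_sequentially)
  moreover have "2 * R * cmod (lam_prod \<omega> m) \<le> 2 * R * rmax ^ m" using R lam_prod_le by (intro mult_left_mono) auto
  ultimately show ?thesis by (intro exI[of _ m]) simp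
qed

lemma np_upper: "2 * R * cmod (lam_prod \<omega> (np \<omega> n)) \<le> 1 / 2 ^ n"
  unfolding np_def using np_exists by (rule LeastI_ex)

lemma np_minimal: "m < np \<omega> n \<Longrightarrow> 1 / 2 ^ n < 2 * R * cmod (lam_prod \<omega> m)"
  unfolding np_def by (drule not_less_Least) simp

lemma np_mono: "n \<le> N \<Longrightarrow> np \<omega> n \<le> np \<omega> N"
proof -
  assume "n \<le> N"
  then have "1 / 2 ^ N \<le> (1 / 2 ^ n :: real)" by (simp add: divide_left_mono)
  then have "2 * R * cmod (lam_prod \<omega> (np \<omega> N)) \<le> 1 / 2 ^ n" using np_upper[of \<omega> N] by linarith
  then show ?thesis unfolding np_def[of \<omega> n] by (rule Least_le)
qed

text \<open>By minimality of n', \<open>1 / 2 ^ n\<close> is below 2 R times the scale one letter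
  earlier, and that letter multiplies the scale by at least \<open>rmin\<close>. The value 1 covers
  n' = 0, where there is no earlier letter and the product is 1.\<close>

definition cR :: real where "cR = max 1 (2 * R / rmin)"

lemma np_lower: "1 / 2 ^ n \<le> cR * cmod (lam_prod \<omega> (np \<omega> n))"
proof (cases "np \<omega> n")
  case 0
  have "1 / 2 ^ n \<le> (1::real)" by simp
  also have "1 \<le> cR" by (simp add: cR_def)
  finally show ?thesis using 0 by simp
next
  case (Suc m)
  have "1 / 2 ^ n \<le> 2 * R * cmod (lam_prod \<omega> m)" using np_minimal[of m \<omega> n] Suc by simp
  also have "cmod (lam_prod \<omega> m) * rmin \<le> cmod (lam_prod \<omega> (Suc m))"
    using lam_bounds(1) by (simp add: lam_prod_def norm_mult mult_left_mono)
  then have "2 * R * cmod (lam_prod \<omega> m) \<le> 2 * R / rmin * cmod (lam_prod \<omega> (Suc m))"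
    using lam_bounds(3) R by (simp add: field_simps)
  also have "\<dots> \<le> cR * cmod (lam_prod \<omega> (Suc m))" by (intro mult_right_mono) (auto simp: cR_def)
  finally show ?thesis using Suc by simp
qed

text \<open>The scale decays at least like \<open>rmax ^ m\<close>, so O(n) letters suffice,
  uniformly in \<omega>. This uniformity bounds the number of grid levels in the final union
  bound.\<close>

lemma np_linear: "\<exists>c. 0 < c \<and> (\<forall>\<omega> n. real (np \<omega> n) \<le> c * (real n + 1))"
proof -
  define a where "a = log 2 (1 / rmax)"
  have a: "0 < a" using rmax_pos lam_bounds(4) by (simp add: a_def)
  \<comment> \<open>The last summand 1 pays for the step from m = n' - 1 to n'.\<close>
  define c where "c = (1 + max 0 (log 2 (2 * R))) / a + 1"
  have c: "0 < c" using a by (auto simp: c_def intro!: add_nonneg_pos divide_nonneg_pos)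
  have "real (np \<omega> n) \<le> c * (real n + 1)" for \<omega> n
  proof (cases "np \<omega> n")
    case (Suc m)
    have "1 / 2 ^ n \<le> 2 * R * cmod (lam_prod \<omega> m)" using np_minimal[of m \<omega> n] Suc by simp
    also have "\<dots> \<le> 2 * R * rmax ^ m" using R lam_prod_le by (intro mult_left_mono) auto
    finally have "log 2 (1 / 2 ^ n) \<le> log 2 (2 * R * rmax ^ m)"
      using R rmax_pos by (subst log_le_cancel_iff) auto
    then have "- real n \<le> log 2 (2 * R) - m * a"
      using R rmax_pos by (simp add: log_mult log_divide log_nat_power a_def)
    then have "m * a \<le> real n + log 2 (2 * R)" by simp
    then have "m \<le> (real n + log 2 (2 * R)) / a" using a by (simp add: field_simps)
    also have "\<dots> \<le> ((1 + max 0 (log 2 (2 * R))) * (real n + 1)) / a"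
    proof (intro divide_right_mono)
      have "0 \<le> real n * max 0 (log 2 (2 * R))" by simp
      then show "real n + log 2 (2 * R) \<le> (1 + max 0 (log 2 (2 * R))) * (real n + 1)"
        using max.cobounded2[of "log 2 (2 * R)" 0] by (simp add: algebra_simps max_def split: if_splits)
    qed (use a in auto)
    finally show ?thesis using Suc by (simp add: c_def algebra_simps)
  qed (use c in simp)
  then show ?thesis using c by blast
qed

lemma cR_pos: "0 < cR" by (simp add: cR_def)

text \<open>One term for each of the comparisons of dyadic entropies with \<open>G\<close>: the
  convolution with \<open>tau\<close>, then \<open>nu\<close> alone, then \<open>tau\<close> alone.
  All terms are nonnegative, so their sum serves everywhere.\<close>

definition c4 :: real where
  "c4 = 2 * log 2 ((4 + 4 * B) / (2 * R) + 2) + 2 * log 2 (4 * cR + 2) + 2 * log 2 (4 * cR + 4 * B + 2)"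

lemma c4_parts:
  "0 \<le> 2 * log 2 ((4 + 4 * B) / (2 * R) + 2)" "0 \<le> 2 * log 2 (4 * cR + 2)" "0 \<le> 2 * log 2 (4 * cR + 4 * B + 2)"
proof -
  have "0 \<le> (4 + 4 * B) / (2 * R)" using B_nonneg R by simp
  then have *: "1 \<le> (4 + 4 * B) / (2 * R) + 2" by linarith
  then show "0 \<le> 2 * log 2 ((4 + 4 * B) / (2 * R) + 2)"
    by (metis mult_nonneg_nonneg zero_le_log_cancel_iff zero_le_numeral less_le_trans one_less_numeral_iff semiring_norm(76) zero_less_one)
  show "0 \<le> 2 * log 2 (4 * cR + 2)" "0 \<le> 2 * log 2 (4 * cR + 4 * B + 2)" using cR_pos B_nonneg by auto
qed

lemma rv_entropy_nu_ge_G: "G \<omega> (np \<omega> n) \<le> rv_entropy (nu \<omega> (np \<omega> n)) (\<lambda>x. cell (2 ^ n * x)) + c4"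
proof -
  let ?m = "np \<omega> n"
  have "bounded ((\<lambda>x. x) ` nu_supp \<omega> ?m)" using nu_supp_bound by (auto simp: bounded_iff)
  then have "rv_entropy (nu \<omega> ?m) (\<lambda>z. cell (inverse (lam_prod \<omega> ?m) * z)) \<le> rv_entropy (nu \<omega> ?m) (\<lambda>z. cell (2 ^ n * z))
      + 2 * log 2 (2 * (cmod (inverse (lam_prod \<omega> ?m)) * (2 / cmod (2 ^ n) + 0)) + 2)"
    by (intro rv_entropy_cell_le[OF prob_space_nu _ _ AE_nu_supp]) (auto simp: measurable_nu)
  also have "2 * (cmod (inverse (lam_prod \<omega> ?m)) * (2 / cmod (2 ^ n) + 0)) + 2 \<le> 4 * cR + 2"
    using np_lower[of n \<omega>] lam_prod_nonzero[of \<omega> ?m] by (simp add: norm_inverse norm_power norm_divide field_simps)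
  then have "log 2 (2 * (cmod (inverse (lam_prod \<omega> ?m)) * (2 / cmod (2 ^ n) + 0)) + 2) \<le> log 2 (4 * cR + 2)"
    using cR_pos by (subst log_le_cancel_iff) (auto intro!: add_nonneg_pos)
  finally show ?thesis unfolding G_def[symmetric] c4_def using c4_parts by linarith
qed

lemma tau_eq: "tau \<omega> m = distr (PiM UNIV (dig ((shift ^^ m) \<omega>))) borel (\<lambda>u. lam_prod \<omega> m * full_sum ((shift ^^ m) \<omega>) u)"
  unfolding tau_meas_def eta_eq using measurable_full_sum
  by (subst distr_distr) (auto simp: lam_prod_def comp_def)

text \<open>The series behind \<open>tau\<close> is cut at the stopping level of N. The tail is at
  most B times the scale there, and \<open>np_lower\<close> bounds the dyadic side by
  \<open>cR\<close> times the same scale.\<close>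

lemma rv_entropy_tau_ge_G:
  assumes "n \<le> N"
  shows "G ((shift ^^ np \<omega> n) \<omega>) (np \<omega> N - np \<omega> n) \<le> rv_entropy (tau \<omega> (np \<omega> n)) (\<lambda>x. cell (2 ^ N * x)) + c4"
proof -
  let ?m = "np \<omega> n" and ?M = "np \<omega> N"
  let ?\<omega>' = "(shift ^^ ?m) \<omega>" and ?l = "?M - ?m"
  let ?P = "PiM UNIV (dig ?\<omega>')"
  have M: "?m + ?l = ?M" using np_mono[OF assms] by simp
  have LM: "cmod (lam_prod \<omega> ?m) * cmod (lam_prod ?\<omega>' ?l) = cmod (lam_prod \<omega> ?M)"
    by (subst M[symmetric]) (simp add: lam_prod_add norm_mult)
  have [measurable]: "full_sum ?\<omega>' \<in> borel_measurable ?P" "partial_sum ?\<omega>' ?l \<in> borel_measurable ?P"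
    by (auto intro: measurable_full_sum measurable_partial_sum)
  have bl: "bounded (f ` valid ?\<omega>') \<Longrightarrow> bounded ((\<lambda>u. lam_prod \<omega> ?m * f u) ` valid ?\<omega>')" for f
    using bounded_linear_image[OF _ bounded_linear_mult_right, of "f ` valid ?\<omega>'" "lam_prod \<omega> ?m"] by (simp add: image_image)
  have "rv_entropy ?P (\<lambda>u. cell (inverse (lam_prod \<omega> ?M) * (lam_prod \<omega> ?m * partial_sum ?\<omega>' ?l u)))
      \<le> rv_entropy ?P (\<lambda>u. cell (2 ^ N * (lam_prod \<omega> ?m * full_sum ?\<omega>' u)))
      + 2 * log 2 (2 * (cmod (inverse (lam_prod \<omega> ?M)) * (2 / cmod (2 ^ N) + 2 * (cmod (lam_prod \<omega> ?M) * B))) + 2)"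
  proof (intro rv_entropy_cell_le[OF prob_space_PiM_dig _ _ AE_valid] bl bounded_partial_sum bounded_full_sum cmod_diff_perturb)
    have *: "cmod (lam_prod \<omega> ?m * partial_sum ?\<omega>' ?l s - lam_prod \<omega> ?m * full_sum ?\<omega>' s) \<le> cmod (lam_prod \<omega> ?M) * B" if "s \<in> valid ?\<omega>'" for s
    proof -
      have "cmod (lam_prod \<omega> ?m) * cmod (full_sum ?\<omega>' s - partial_sum ?\<omega>' ?l s) \<le> cmod (lam_prod \<omega> ?m) * (cmod (lam_prod ?\<omega>' ?l) * B)"
        by (intro mult_left_mono full_sum_diff_bound that) simp
      then show ?thesis
        unfolding LM[symmetric] mult.assoc[symmetric] by (simp add: norm_mult[symmetric] right_diff_distrib norm_minus_commute)
    qed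
    show "cmod (lam_prod \<omega> ?m * partial_sum ?\<omega>' ?l s - lam_prod \<omega> ?m * full_sum ?\<omega>' s) \<le> cmod (lam_prod \<omega> ?M) * B" if "s \<in> valid ?\<omega>'" for s
      using * that .
    show "cmod (lam_prod \<omega> ?m * partial_sum ?\<omega>' ?l s - lam_prod \<omega> ?m * full_sum ?\<omega>' s) \<le> cmod (lam_prod \<omega> ?M) * B" if "s \<in> valid ?\<omega>'" for s
      using * that .
  qed (use B_nonneg in auto)
  also have "rv_entropy ?P (\<lambda>u. cell (inverse (lam_prod \<omega> ?M) * (lam_prod \<omega> ?m * partial_sum ?\<omega>' ?l u))) = G ?\<omega>' ?l"
    unfolding G_def rv_entropy_nu_UNIV using inverse_lam_prod_add[of \<omega> ?m ?l] by (simp only: M)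
  also have "rv_entropy ?P (\<lambda>u. cell (2 ^ N * (lam_prod \<omega> ?m * full_sum ?\<omega>' u))) = rv_entropy (tau \<omega> ?m) (\<lambda>x. cell (2 ^ N * x))"
    unfolding tau_eq by (subst rv_entropy_distr) auto
  also have "2 * (cmod (inverse (lam_prod \<omega> ?M)) * (2 / cmod (2 ^ N) + 2 * (cmod (lam_prod \<omega> ?M) * B))) + 2 \<le> 4 * cR + 4 * B + 2"
    using np_lower[of N \<omega>] lam_prod_nonzero[of \<omega> ?M] by (simp add: norm_inverse norm_power norm_divide field_simps)
  then have "log 2 (2 * (cmod (inverse (lam_prod \<omega> ?M)) * (2 / cmod (2 ^ N) + 2 * (cmod (lam_prod \<omega> ?M) * B))) + 2) \<le> log 2 (4 * cR + 4 * B + 2)"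
    using cR_pos B_nonneg by (subst log_le_cancel_iff) (auto intro!: add_nonneg_pos)
  finally show ?thesis unfolding c4_def using c4_parts by linarith
qed

text \<open>Convolving \<open>nu\<close> with \<open>tau\<close> restores the whole series for
  \<omega>. Cut at the stopping level of N, it becomes the level measure whose entropy is
  \<open>G\<close>; here \<open>np_upper\<close> keeps the tail below the dyadic side up to a
  constant factor.\<close>

lemma conv_entropy_tau_le_G:
  assumes "n \<le> N"
  shows "conv_entropy (nu \<omega> (np \<omega> n)) (tau \<omega> (np \<omega> n)) (\<lambda>y. y) (2 ^ N) \<le> G \<omega> (np \<omega> N) + c4"
proof -
  let ?m = "np \<omega> n" and ?M = "np \<omega> N"
  let ?\<omega>' = "(shift ^^ ?m) \<omega>" and ?l = "?M - ?m"
  let ?P = "PiM UNIV (dig ?\<omega>')"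
  let ?NP = "nu \<omega> ?m \<Otimes>\<^sub>M ?P"
  interpret N: prob_space "nu \<omega> ?m" by (rule prob_space_nu)
  interpret P: prob_space ?P by (rule prob_space_PiM_dig)
  interpret NP: pair_prob_space "nu \<omega> ?m" ?P ..
  have M: "?m + ?l = ?M" using np_mono[OF assms] by simp
  have LM: "cmod (lam_prod \<omega> ?m) * cmod (lam_prod ?\<omega>' ?l) = cmod (lam_prod \<omega> ?M)"
    by (subst M[symmetric]) (simp add: lam_prod_add norm_mult)
  have f [measurable]: "full_sum ?\<omega>' \<in> borel_measurable ?P" "partial_sum ?\<omega>' ?l \<in> borel_measurable ?P"
    by (auto intro: measurable_full_sum measurable_partial_sum)
  have ms: "(\<lambda>z. fst z + lam_prod \<omega> ?m * g (snd z)) \<in> borel_measurable ?NP" if [measurable]: "g \<in> borel_measurable ?P" for g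
  proof -
    have *: "sets ?NP = sets (borel \<Otimes>\<^sub>M ?P)" by (intro sets_pair_measure_cong sets_nu refl)
    show ?thesis unfolding measurable_cong_sets[OF * refl] by measurable
  qed
  have bl: "bounded ((\<lambda>z. fst z + lam_prod \<omega> ?m * f (snd z)) ` (nu_supp \<omega> ?m \<times> valid ?\<omega>'))" if "bounded (f ` valid ?\<omega>')" for f
    using bounded_sum_image[OF fin_suppD(3)[OF fin_supp_nu], of "\<lambda>u. lam_prod \<omega> ?m * f u" "valid ?\<omega>'" \<omega> ?m]
      bounded_linear_image[OF that bounded_linear_mult_right, of "lam_prod \<omega> ?m"] by (simp add: image_image case_prod_beta')
  have AE: "AE z in ?NP. z \<in> nu_supp \<omega> ?m \<times> valid ?\<omega>'"
    by (intro AE_pair_Times AE_valid prob_space_nu prob_space_PiM_dig AE_nu_supp)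
  have "rv_entropy ?NP (\<lambda>z. cell (2 ^ N * (fst z + lam_prod \<omega> ?m * full_sum ?\<omega>' (snd z))))
      \<le> rv_entropy ?NP (\<lambda>z. cell (inverse (lam_prod \<omega> ?M) * (fst z + lam_prod \<omega> ?m * partial_sum ?\<omega>' ?l (snd z))))
      + 2 * log 2 (2 * (cmod (2 ^ N) * (2 / cmod (inverse (lam_prod \<omega> ?M)) + 2 * (cmod (lam_prod \<omega> ?M) * B))) + 2)"
  proof (intro rv_entropy_cell_le[OF _ _ _ AE] bl bounded_partial_sum bounded_full_sum cmod_diff_perturb)
    have *: "cmod ((fst z + lam_prod \<omega> ?m * full_sum ?\<omega>' (snd z)) - (fst z + lam_prod \<omega> ?m * partial_sum ?\<omega>' ?l (snd z))) \<le> cmod (lam_prod \<omega> ?M) * B"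
      if "z \<in> nu_supp \<omega> ?m \<times> valid ?\<omega>'" for z
    proof -
      have "cmod (lam_prod \<omega> ?m) * cmod (full_sum ?\<omega>' (snd z) - partial_sum ?\<omega>' ?l (snd z)) \<le> cmod (lam_prod \<omega> ?m) * (cmod (lam_prod ?\<omega>' ?l) * B)"
        using that by (intro mult_left_mono full_sum_diff_bound) auto
      then show ?thesis
        unfolding LM[symmetric] mult.assoc[symmetric] by (simp add: norm_mult[symmetric] right_diff_distrib)
    qed
    show "cmod ((fst z + lam_prod \<omega> ?m * full_sum ?\<omega>' (snd z)) - (fst z + lam_prod \<omega> ?m * partial_sum ?\<omega>' ?l (snd z))) \<le> cmod (lam_prod \<omega> ?M) * B"
      if "z \<in> nu_supp \<omega> ?m \<times> valid ?\<omega>'" for z using * that .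
    show "cmod ((fst z + lam_prod \<omega> ?m * full_sum ?\<omega>' (snd z)) - (fst z + lam_prod \<omega> ?m * partial_sum ?\<omega>' ?l (snd z))) \<le> cmod (lam_prod \<omega> ?M) * B"
      if "z \<in> nu_supp \<omega> ?m \<times> valid ?\<omega>'" for z using * that .
    show "prob_space ?NP" by unfold_locales
  qed (use B_nonneg lam_prod_nonzero ms[OF f(1)] ms[OF f(2)] in auto)
  also have "rv_entropy ?NP (\<lambda>z. cell (2 ^ N * (fst z + lam_prod \<omega> ?m * full_sum ?\<omega>' (snd z)))) = conv_entropy (nu \<omega> ?m) (tau \<omega> ?m) (\<lambda>y. y) (2 ^ N)"
    unfolding tau_eq by (subst conv_entropy_distr[OF fin_supp_nu prob_space_PiM_dig]) (auto simp: conv_entropy_def case_prod_beta')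
  also have "rv_entropy ?NP (\<lambda>z. cell (inverse (lam_prod \<omega> ?M) * (fst z + lam_prod \<omega> ?m * partial_sum ?\<omega>' ?l (snd z)))) = G \<omega> ?M"
  proof -
    \<comment> \<open>The two blocks of digits reassemble to the measure of level
      \<open>?M\<close>.\<close>
    have "G \<omega> ?M = conv_entropy (nu \<omega> ?m) (nu ?\<omega>' ?l) (\<lambda>y. lam_prod \<omega> ?m * y) (inverse (lam_prod \<omega> ?M))"
      unfolding G_def using rv_entropy_nu_add[of \<omega> ?m ?l] by (simp only: M)
    also have "\<dots> = conv_entropy (nu \<omega> ?m) ?P (\<lambda>u. lam_prod \<omega> ?m * partial_sum ?\<omega>' ?l u) (inverse (lam_prod \<omega> ?M))"
      unfolding nu_eq_UNIV[of ?\<omega>' ?l] by (subst conv_entropy_distr[OF fin_supp_nu prob_space_PiM_dig]) auto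
    finally show ?thesis by (simp add: conv_entropy_def case_prod_beta')
  qed
  also have "2 * (cmod (2 ^ N) * (2 / cmod (inverse (lam_prod \<omega> ?M)) + 2 * (cmod (lam_prod \<omega> ?M) * B))) + 2 \<le> (4 + 4 * B) / (2 * R) + 2"
  proof -
    have "2 ^ N * cmod (lam_prod \<omega> ?M) \<le> 1 / (2 * R)" using np_upper[of \<omega> N] R by (simp add: field_simps)
    then have "(4 + 4 * B) * (2 ^ N * cmod (lam_prod \<omega> ?M)) \<le> (4 + 4 * B) * (1 / (2 * R))"
      using B_nonneg by (intro mult_left_mono) auto
    moreover have "2 * (cmod (2 ^ N) * (2 / cmod (inverse (lam_prod \<omega> ?M)) + 2 * (cmod (lam_prod \<omega> ?M) * B)))
        = (4 + 4 * B) * (2 ^ N * cmod (lam_prod \<omega> ?M))"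
      unfolding norm_inverse norm_power by (simp add: divide_inverse) (simp add: algebra_simps)
    ultimately show ?thesis by simp
  qed
  then have "log 2 (2 * (cmod (2 ^ N) * (2 / cmod (inverse (lam_prod \<omega> ?M)) + 2 * (cmod (lam_prod \<omega> ?M) * B))) + 2) \<le> log 2 ((4 + 4 * B) / (2 * R) + 2)"
    using R B_nonneg by (subst log_le_cancel_iff) (auto intro!: add_nonneg_pos)
  finally show ?thesis unfolding c4_def using c4_parts by linarith
qed

end

end

section \<open>Dyadic entropy and components\<close>

lemma Re_Im_power2_mult: "Re (2 ^ n * z) = 2 ^ n * Re z" "Im (2 ^ n * z) = 2 ^ n * Im z"
proof -
  have "2 ^ n * z = complex_of_real (2 ^ n) * z" by simp
  then show "Re (2 ^ n * z) = 2 ^ n * Re z" "Im (2 ^ n * z) = 2 ^ n * Im z"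
    by (simp_all only: times_complex.simps Re_complex_of_real Im_complex_of_real)
qed

lemma dyadic_square_eq: "dyadic_square n a b = {z. cell (2 ^ n * z) = (a, b)}"
  unfolding dyadic_square_def cell_def Re_Im_power2_mult by (auto simp: floor_eq_iff field_simps)

lemma dyadic_cell_eq: "dyadic_cell n x = {z. cell (2 ^ n * z) = cell (2 ^ n * x)}"
  unfolding dyadic_cell_def dyadic_square_eq by (simp add: cell_def Re_Im_power2_mult mult.commute)

lemma component_eq: "component \<nu> x n = cond_measure \<nu> {z. cell (2 ^ n * z) = cell (2 ^ n * x)}"
  by (simp add: component_def cond_measure_def dyadic_cell_eq)

text \<open>All but finitely many dyadic squares are null, so the infinite sum is a finite
  one.\<close>

lemma dyadic_entropy_eq_rv_entropy:
  assumes sp: "space \<mu> = UNIV" and A: "AE x in \<mu>. x \<in> A" and fin: "finite ((\<lambda>x. cell (2 ^ n * x)) ` A)"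
  shows "dyadic_entropy \<mu> n = rv_entropy \<mu> (\<lambda>x. cell (2 ^ n * x))"
proof -
  let ?m = "\<lambda>v. measure \<mu> {x. cell (2 ^ n * x) = v}"
  let ?F = "(\<lambda>x. cell (2 ^ n * x)) ` A"
  have z: "?m v = 0" if "v \<notin> ?F" for v
    using measure_eq_0_outside[OF A that] by (simp add: sp)
  have "(\<Sum>\<^sub>\<infinity>(a, b)\<in>UNIV. (let m = measure \<mu> (dyadic_square n a b) in if m = 0 then 0 else m * log 2 m))
      = (\<Sum>\<^sub>\<infinity>v\<in>?F. - ent_fun (?m v))"
    by (rule infsum_cong_neutral) (auto simp: dyadic_square_eq ent_fun_def Let_def z)
  also have "\<dots> = (\<Sum>v\<in>?F. - ent_fun (?m v))" using fin by (rule infsum_finite)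
  finally show ?thesis
    unfolding dyadic_entropy_def using rv_entropy_eq_sum[OF A subset_refl fin] by (simp add: sum_negf sp)
qed

lemma dyadic_entropy_conv:
  assumes c: "fin_supp c S" and t: "prob_space \<tau>" "sets \<tau> = sets borel" "AE y in \<tau>. y \<in> A" "bounded A"
  shows "dyadic_entropy (conv c \<tau>) n = conv_entropy c \<tau> (\<lambda>y. y) (2 ^ n)"
proof -
  have *: "sets (c \<Otimes>\<^sub>M \<tau>) = sets (borel \<Otimes>\<^sub>M borel)"
    using fin_suppD(2)[OF c] t(2) by (intro sets_pair_measure_cong)
  have m: "(\<lambda>(x, y). x + y) \<in> borel_measurable (c \<Otimes>\<^sub>M \<tau>)"
    unfolding measurable_cong_sets[OF * refl] by measurable
  have AE: "AE z in c \<Otimes>\<^sub>M \<tau>. z \<in> S \<times> A" using fin_suppD[OF c] t by (intro AE_pair_Times) auto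
  have b: "bounded ((\<lambda>(x, y). x + y) ` (S \<times> A))"
    using bounded_sum_image[OF fin_suppD(3)[OF c], of "\<lambda>y. y" A] t(4) by simp
  let ?Z = "(\<lambda>(x, y). x + y) ` (S \<times> A)"
  \<comment> \<open>The closure is taken because the set of sums is not known to be Borel, while the
    transfer to the image measure asks for a measurable set.\<close>
  have "AE z in c \<Otimes>\<^sub>M \<tau>. (case z of (x, y) \<Rightarrow> x + y) \<in> closure ?Z"
    using AE by eventually_elim (rule closure_subset[THEN subsetD], rule imageI)
  then have "AE x in conv c \<tau>. x \<in> closure ?Z"
    unfolding conv_def using m borel_closed[of "closure ?Z"] by (subst AE_distr_iff) auto
  moreover have "finite ((\<lambda>x. cell (2 ^ n * x)) ` closure ((\<lambda>(x, y). x + y) ` (S \<times> A)))"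
    using finite_cell_scaled_bounded[of "\<lambda>x. x" _ "2 ^ n"] b by (simp add: bounded_closure)
  ultimately have "dyadic_entropy (conv c \<tau>) n = rv_entropy (conv c \<tau>) (\<lambda>x. cell (2 ^ n * x))"
    by (intro dyadic_entropy_eq_rv_entropy) (auto simp: conv_def)
  also have "\<dots> = conv_entropy c \<tau> (\<lambda>y. y) (2 ^ n)"
    unfolding conv_def conv_entropy_def using m by (subst rv_entropy_distr) (auto simp: case_prod_beta')
  finally show ?thesis .
qed

lemma measurable_cell_scaled: "sets \<nu> = sets borel \<Longrightarrow> (\<lambda>x. cell (a * x)) \<in> measurable \<nu> (count_space UNIV)"
  by (simp cong: measurable_cong_sets)

text \<open>Markov's inequality for g - h + 2 log 6, which is nonnegative on cells of positive mass.
  The absolute value is harmless: entropy can drop by at most 2 log 6 < d, so a deviation of size d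
  can only be an increase.\<close>

lemma comp_prob_gt:
  assumes nu: "fin_supp \<nu> S" and t: "prob_space \<tau>" "sets \<tau> = sets borel" "AE y in \<tau>. y \<in> A" "bounded A"
    and sum: "(\<Sum>v\<in>(\<lambda>x. cell (2 ^ n * x)) ` S. measure \<nu> {x. cell (2 ^ n * x) = v} *
        conv_entropy (cond_measure \<nu> {x. cell (2 ^ n * x) = v}) \<tau> (\<lambda>y. y) (2 ^ N)) \<le> rv_entropy \<tau> (\<lambda>y. cell (2 ^ N * y)) + E"
    and D: "2 * log 2 6 < d" and E: "E + 2 * log 2 6 < \<epsilon> * d"
  shows "comp_prob \<nu> n (\<lambda>c. \<bar>dyadic_entropy (conv c \<tau>) N - dyadic_entropy \<tau> N\<bar> < d) > 1 - \<epsilon>"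
proof -
  note f = fin_suppD[OF nu]
  interpret N: prob_space \<nu> by fact
  interpret T: prob_space \<tau> by fact
  define \<phi> where "\<phi> x = cell (2 ^ n * x)" for x
  define h where "h = rv_entropy \<tau> (\<lambda>y. cell (2 ^ N * y))"
  define p where "p v = measure \<nu> {x. \<phi> x = v}" for v
  define g where "g v = conv_entropy (cond_measure \<nu> {x. \<phi> x = v}) \<tau> (\<lambda>y. y) (2 ^ N)" for v
  have [measurable]: "\<phi> \<in> measurable \<nu> (count_space UNIV)" unfolding \<phi>_def using f(2) by (rule measurable_cell_scaled)
  have Bm: "{x. \<phi> x = v} \<in> sets borel" for v unfolding \<phi>_def by (rule measurable_cell_fiber)
  have d0: "0 < d" using D by (smt (verit) log_less_one_cancel_iff zero_less_log_cancel_iff)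
  have ht: "dyadic_entropy \<tau> N = h"
    unfolding h_def using t sets_eq_imp_space_eq[OF t(2)] finite_cell_scaled_bounded[of "\<lambda>x. x" A "2 ^ N"]
    by (intro dyadic_entropy_eq_rv_entropy) auto
  have gv: "h - 2 * log 2 6 \<le> g v" "dyadic_entropy (conv (cond_measure \<nu> {x. \<phi> x = v}) \<tau>) N = g v" if "p v \<noteq> 0" for v
  proof -
    have c: "fin_supp (cond_measure \<nu> {x. \<phi> x = v}) S"
      using that by (intro fin_supp_cond_measure[OF nu Bm]) (simp add: p_def)
    show "dyadic_entropy (conv (cond_measure \<nu> {x. \<phi> x = v}) \<tau>) N = g v"
      unfolding g_def by (rule dyadic_entropy_conv[OF c t])
    show "h - 2 * log 2 6 \<le> g v"
      unfolding g_def h_def using t(2,4) by (intro conv_entropy_ge[OF c t(1) _ t(3)]) (auto cong: measurable_cong_sets)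
  qed
  define bad where "bad = {v\<in>\<phi> ` S. \<not> \<bar>dyadic_entropy (conv (cond_measure \<nu> {x. \<phi> x = v}) \<tau>) N - dyadic_entropy \<tau> N\<bar> < d}"
  let ?Q = "\<lambda>x. \<bar>dyadic_entropy (conv (cond_measure \<nu> {z. \<phi> z = \<phi> x}) \<tau>) N - dyadic_entropy \<tau> N\<bar> < d"
  have finb: "finite bad" using f(3) by (simp add: bad_def)
  \<comment> \<open>\<open>?Q\<close> depends on x only through the discrete label \<phi> x.\<close>
  have Qm: "Measurable.pred \<nu> ?Q"
    by (rule measurable_compose[of \<phi> _ "count_space UNIV"]) auto
  have p_total: "(\<Sum>v\<in>\<phi> ` S. p v) = 1"
    using N.prob_eq_sum_fibers[of \<phi> "\<lambda>_. True" S "\<phi> ` S"] f N.prob_space by (simp add: p_def)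
  have "measure \<nu> {x\<in>space \<nu>. \<not> ?Q x} = (\<Sum>v\<in>\<phi> ` S. measure \<nu> {x\<in>space \<nu>. \<phi> x = v \<and> \<not> ?Q x})"
    using f(3,4) Qm by (intro N.prob_eq_sum_fibers[where A=S]) auto
  also have "\<dots> = (\<Sum>v\<in>\<phi> ` S. if v \<in> bad then p v else 0)"
  proof (intro sum.cong refl)
    fix v assume v: "v \<in> \<phi> ` S"
    have "{x\<in>space \<nu>. \<phi> x = v \<and> \<not> ?Q x} = (if v \<in> bad then {x. \<phi> x = v} else {})"
      using v by (auto simp: bad_def f(5))
    then show "measure \<nu> {x\<in>space \<nu>. \<phi> x = v \<and> \<not> ?Q x} = (if v \<in> bad then p v else 0)"
      by (simp add: p_def)
  qed
  also have "\<dots> = (\<Sum>v\<in>bad. p v)"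
    using f(3) by (subst sum.inter_restrict[symmetric]) (auto intro!: sum.cong simp: bad_def)
  finally have bad: "measure \<nu> {x\<in>space \<nu>. \<not> ?Q x} = (\<Sum>v\<in>bad. p v)" .
  have "(\<Sum>v\<in>bad. p v) * d = (\<Sum>v\<in>bad. p v * d)" by (rule sum_distrib_right)
  also have "\<dots> \<le> (\<Sum>v\<in>bad. p v * (g v - h + 2 * log 2 6))"
  proof (rule sum_mono)
    fix v assume v: "v \<in> bad"
    show "p v * d \<le> p v * (g v - h + 2 * log 2 6)"
    \<comment> \<open>Nothing is known of g on null cells, but their weight is 0.\<close>
    proof (cases "p v = 0")
      case False
      then have "d \<le> \<bar>g v - h\<bar>" using v gv(2)[OF False] by (simp add: bad_def ht)
      then have "d \<le> g v - h" using gv(1)[OF False] D by linarith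
      then have "d \<le> g v - h + 2 * log 2 6" using zero_le_log_cancel_iff[of 2 6] by linarith
      then show ?thesis by (intro mult_left_mono) (auto simp: p_def)
    qed simp
  qed
  also have "\<dots> \<le> (\<Sum>v\<in>\<phi> ` S. p v * (g v - h + 2 * log 2 6))"
  proof (rule sum_mono2)
    fix v assume "v \<in> \<phi> ` S - bad"
    show "0 \<le> p v * (g v - h + 2 * log 2 6)"
      using gv(1)[of v] by (cases "p v = 0") (auto simp: p_def intro!: mult_nonneg_nonneg)
  qed (use f(3) in \<open>auto simp: bad_def\<close>)
  also have "\<dots> = (\<Sum>v\<in>\<phi> ` S. p v * g v) - h + 2 * log 2 6"
  proof -
    have "(\<Sum>v\<in>\<phi> ` S. p v * (g v - h + 2 * log 2 6)) = (\<Sum>v\<in>\<phi> ` S. p v * g v + p v * (2 * log 2 6 - h))"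
      by (intro sum.cong) (auto simp: algebra_simps)
    then show ?thesis using p_total by (simp add: sum.distrib sum_distrib_right[symmetric])
  qed
  also have "\<dots> \<le> E + 2 * log 2 6" using sum by (simp add: p_def g_def h_def \<phi>_def)
  also have "\<dots> < \<epsilon> * d" by fact
  finally have "(\<Sum>v\<in>bad. p v) < \<epsilon>" using d0 by simp
  moreover have "measure \<nu> {x\<in>space \<nu>. ?Q x} = 1 - measure \<nu> {x\<in>space \<nu>. \<not> ?Q x}"
    using Qm by (subst N.prob_neg) (auto)
  ultimately show ?thesis
    unfolding comp_prob_def component_eq using bad by (simp add: \<phi>_def)
qed

section \<open>Fekete's lemma for almost superadditive sequences\<close>

lemma superadditive_limit:
  fixes a :: "nat \<Rightarrow> real"
  assumes sup: "\<And>m n. a m + a n \<le> a (m + n) + C" and nn: "\<And>n. 0 \<le> a n" and ub: "\<And>n. a n \<le> c * (real n + 1)"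
    and C: "0 \<le> C" and c: "0 \<le> c"
  obtains \<alpha> where "(\<lambda>n. a n / real n) \<longlonglongrightarrow> \<alpha>"
proof -
  \<comment> \<open>Subtracting C makes the sequence exactly superadditive, and the limit is the
    supremum of these quotients.\<close>
  define b where "b n = (a n - C) / real n" for n
  define \<alpha> where "\<alpha> = (SUP n\<in>{1..}. b n)"
  have bub: "b n \<le> 2 * c" if "1 \<le> n" for n
  proof -
    have "c * (real n + 1) \<le> c * (2 * real n)" using that c by (intro mult_left_mono) auto
    then have "a n - C \<le> 2 * c * real n" using ub[of n] C by linarith
    then show ?thesis using that by (simp add: b_def divide_le_eq)
  qed
  then have bdd: "bdd_above (b ` {1..})" by (intro bdd_aboveI2[where M="2 * c"]) auto
  have le: "b n \<le> \<alpha>" if "1 \<le> n" for n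
    unfolding \<alpha>_def using that bdd by (intro cSUP_upper) auto
  \<comment> \<open>Superadditivity applied k times, starting from the remainder r with a r \<ge>
    0.\<close>
  have mult: "real k * (a m - C) - C \<le> a (k * m + r) - C" for k m r
  proof (induction k)
    case 0 then show ?case using nn[of r] by simp
  next
    case (Suc k)
    then show ?case using sup[of m "k * m + r"] by (simp add: algebra_simps)
  qed
  have "b \<longlonglongrightarrow> \<alpha>"
  proof (rule LIMSEQ_I)
    fix e :: real assume e: "0 < e"
    have "\<exists>m\<in>{1..}. \<alpha> - e / 2 < b m"
      using less_cSUP_iff[of "{1..}" b "\<alpha> - e / 2"] bdd e by (auto simp: \<alpha>_def)
    then obtain m where m: "1 \<le> m" "\<alpha> - e / 2 < b m" by auto
    \<comment> \<open>The first term pays for replacing (n div m) m by n, and C for the remainder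
      block.\<close>
    define K where "K = m * \<bar>b m\<bar> + C"
    have K: "0 \<le> K" using C by (simp add: K_def)
    obtain n0 :: nat where n0: "2 * K / e < n0" using reals_Archimedean2 by blast
    have "norm (b n - \<alpha>) < e" if n: "n \<ge> max 1 n0" for n
    proof -
      have n1: "0 < real n" using n by simp
      let ?k = "n div m"
      have "real (?k * m) \<le> real n" by (simp only: of_nat_le_iff div_times_less_eq_dividend)
      moreover have "real n - real m \<le> real (?k * m)"
      proof -
        have "n < ?k * m + m" using m(1) by (metis add.commute div_mult_mod_eq mod_less_divisor nat_add_left_cancel_less less_le_trans zero_less_one)
        then show ?thesis by linarith
      qed
      ultimately have "\<bar>real (?k * m) - real n\<bar> \<le> real m" by linarith
      then have "\<bar>real (?k * m) - real n\<bar> * \<bar>b m\<bar> \<le> real m * \<bar>b m\<bar>" by (intro mult_right_mono) auto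
      then have "- ((real (?k * m) - real n) * b m) \<le> real m * \<bar>b m\<bar>"
        unfolding abs_mult[symmetric] by linarith
      then have "real n * b m - real m * \<bar>b m\<bar> \<le> real (?k * m) * b m"
        unfolding left_diff_distrib by linarith
      also have "real (?k * m) * b m = real ?k * (a m - C)" using m(1) by (simp add: b_def)
      also have "\<dots> - C \<le> a n - C" using mult[of ?k m "n mod m"] by simp
      finally have "real n * b m - K \<le> a n - C" using K_def by linarith
      then have "(real n * b m - K) / real n \<le> (a n - C) / real n" by (rule divide_right_mono) simp
      then have "b m - K / n \<le> b n" using n1 by (simp add: b_def[of n] diff_divide_distrib)
      moreover have "K / n < e / 2"
      proof -
        have "2 * K / e < real n" using n0 n by simp
        then show ?thesis using e n1 by (simp add: field_simps)
      qed
      ultimately show ?thesis using m(2) le[of n] n by auto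
    qed
    then show "\<exists>n0. \<forall>n\<ge>n0. norm (b n - \<alpha>) < e" by blast
  qed
  moreover have "(\<lambda>n. C / real n) \<longlonglongrightarrow> 0" by (rule lim_const_over_n)
  ultimately have "(\<lambda>n. b n + C / real n) \<longlonglongrightarrow> \<alpha> + 0" by (intro tendsto_add)
  moreover have "(\<lambda>n. b n + C / real n) = (\<lambda>n. a n / real n)" by (auto simp: b_def diff_divide_distrib)
  ultimately show ?thesis using that by simp
qed

section \<open>Measurability of the good set\<close>

definition seq_space :: "(nat \<Rightarrow> 'i) measure" where
  "seq_space = PiM UNIV (\<lambda>_. count_space UNIV)"

lemma space_seq_space [simp]: "space seq_space = UNIV" by (auto simp: seq_space_def space_PiM)

lemma measurable_coord [measurable]: "(\<lambda>\<omega>. \<omega> j) \<in> measurable seq_space (count_space UNIV)"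
  unfolding seq_space_def by (rule measurable_component_singleton) simp

lemma map_upt_eq_iff: "map \<omega> [0..<m] = l \<longleftrightarrow> length l = m \<and> (\<forall>j<m. \<omega> j = l ! j)"
proof
  assume "length l = m \<and> (\<forall>j<m. \<omega> j = l ! j)"
  then show "map \<omega> [0..<m] = l" by (intro nth_equalityI) simp_all
qed auto

lemma measurable_prefix:
  "(\<lambda>\<omega>::nat \<Rightarrow> 'i::finite. map \<omega> [0..<m]) \<in> measurable seq_space (count_space UNIV)"
proof (subst measurable_count_space_eq2_countable, intro conjI ballI)
  fix l :: "'i list"
  have "(\<lambda>\<omega>. map \<omega> [0..<m]) -` {l} \<inter> space seq_space = {\<omega>\<in>space seq_space. length l = m \<and> (\<forall>j<m. \<omega> j = l ! j)}"
    by (simp add: vimage_def map_upt_eq_iff)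
  also have "\<dots> \<in> sets seq_space" by measurable
  finally show "(\<lambda>\<omega>. map \<omega> [0..<m]) -` {l} \<inter> space seq_space \<in> sets seq_space" .
qed auto

text \<open>Such f factors through the word of length m, a point of a countable discrete space
  because the alphabet is finite.\<close>

lemma measurable_finite_coords:
  fixes f :: "(nat \<Rightarrow> 'i::finite) \<Rightarrow> 'b"
  assumes "\<And>\<omega> \<omega>'. (\<And>j. j < m \<Longrightarrow> \<omega> j = \<omega>' j) \<Longrightarrow> f \<omega> = f \<omega>'" and N: "space N = UNIV"
  shows "f \<in> measurable seq_space N"
proof -
  have "f = (\<lambda>\<omega>. f (\<lambda>j. map \<omega> [0..<m] ! j))" by (intro ext assms(1)) simp
  moreover have "(\<lambda>\<omega>. f (\<lambda>j. map \<omega> [0..<m] ! j)) \<in> measurable seq_space N"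
    by (rule measurable_compose[OF measurable_prefix, of "\<lambda>l. f (\<lambda>j. l ! j)"]) (simp add: N)
  ultimately show ?thesis by simp
qed

lemma measurable_shift: "shift \<in> measurable seq_space (seq_space :: (nat \<Rightarrow> 'i) measure)"
proof -
  have "(\<lambda>\<omega>. \<lambda>m\<in>UNIV. \<omega> (Suc m) :: 'i) \<in> measurable (PiM UNIV (\<lambda>_. count_space UNIV)) (PiM UNIV (\<lambda>_. count_space UNIV))"
    by (intro measurable_restrict measurable_component_singleton) auto
  then show ?thesis by (simp add: seq_space_def shift_def[abs_def] restrict_def)
qed

lemma measurable_shift_pow [measurable]: "(shift ^^ m) \<in> measurable seq_space (seq_space :: (nat \<Rightarrow> 'i) measure)"
proof (induction m)
  case (Suc m)
  have "(\<lambda>\<omega>. shift ((shift ^^ m) \<omega>)) \<in> measurable seq_space (seq_space :: (nat \<Rightarrow> 'i) measure)"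
    using measurable_compose[OF Suc measurable_shift] .
  then show ?case by (simp add: comp_def)
qed (simp add: id_def)

lemma measurable_ent_fun [measurable]: "ent_fun \<in> borel_measurable borel"
  unfolding ent_fun_def[abs_def] by measurable

context planar begin

lemma lam_prod_cong: "(\<And>j. j < m \<Longrightarrow> \<omega> j = \<omega>' j) \<Longrightarrow> lam_prod \<omega> m = lam_prod \<omega>' m"
  by (simp add: lam_prod_def)

lemma nu_cong:
  assumes "\<And>j. j < m \<Longrightarrow> \<omega> j = \<omega>' j"
  shows "nu \<omega> m = nu \<omega>' m"
proof -
  have "partial_sum \<omega> m u = partial_sum \<omega>' m u" for u
    unfolding partial_sum_def using assms lam_prod_cong[of _ \<omega> \<omega>'] by (intro sum.cong) auto
  moreover have "PiM {..<m} (dig \<omega>) = PiM {..<m} (dig \<omega>')"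
    using assms by (intro PiM_cong) (auto simp: dig_def)
  ultimately show ?thesis unfolding nu_eq by (intro distr_cong) auto
qed

lemma G_cong: "(\<And>j. j < m \<Longrightarrow> \<omega> j = \<omega>' j) \<Longrightarrow> G \<omega> m = G \<omega>' m"
  unfolding G_def using nu_cong[of m \<omega> \<omega>'] lam_prod_cong[of m \<omega> \<omega>'] by simp

lemma measurable_G [measurable]: "(\<lambda>\<omega>. G \<omega> m) \<in> borel_measurable seq_space"
  by (rule measurable_finite_coords[of m]) (auto intro: G_cong)

text \<open>Independent digits for every position and every symbol realise all the measures
  \<^term>\<open>eta \<omega>\<close> on one probability space, which gives measurability in \<^term>\<open>\<omega>\<close>.\<close>

definition digs :: "(nat \<times> 'i \<Rightarrow> nat) measure" where
  "digs = PiM UNIV (\<lambda>(n, i). measure_pmf (digit_pmf k p i))"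

lemma prob_space_digs: "prob_space digs"
  unfolding digs_def by (intro prob_space_PiM) (auto intro: prob_space_measure_pmf)

text \<open>The coordinates (n, \<omega> n) are distinct for different n, so the digits read along
  \<omega> are independent with the right laws.\<close>

lemma eta_eq_digs: "eta \<omega> = distr digs borel (\<lambda>x. full_sum \<omega> (\<lambda>n. x (n, \<omega> n)))"
proof -
  let ?f = "\<lambda>n. (n, \<omega> n)"
  let ?M = "\<lambda>(n::nat, i). measure_pmf (digit_pmf k p i)"
  have d: "(\<lambda>n. ?M (?f n)) = dig \<omega>" by (auto simp: dig_def)
  have R: "distr digs (PiM UNIV (dig \<omega>)) (\<lambda>x. \<lambda>n\<in>UNIV. x (?f n)) = PiM UNIV (dig \<omega>)"
    using distr_PiM_reindex[of UNIV ?M ?f UNIV] unfolding d digs_def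
    by (auto simp: inj_on_def prob_space_measure_pmf)
  have m: "(\<lambda>x. \<lambda>n\<in>UNIV. x (?f n)) \<in> measurable digs (PiM UNIV (dig \<omega>))"
    unfolding d[symmetric] digs_def by (intro measurable_restrict measurable_component_singleton) auto
  show ?thesis
    unfolding eta_eq by (subst R[symmetric], subst distr_distr[OF measurable_full_sum m]) (simp add: comp_def restrict_def)
qed

lemma measurable_digs_coord [measurable]: "(\<lambda>x. x ni) \<in> measurable digs (count_space UNIV)"
proof -
  have "(\<lambda>x. x ni) \<in> measurable digs ((\<lambda>(n, i). measure_pmf (digit_pmf k p i)) ni)"
    unfolding digs_def by (rule measurable_component_singleton) simp
  then show ?thesis by (simp add: case_prod_beta')
qed

text \<open>Joint measurability holds term by term: each term reads finitely many letters of
  \<omega> and one digit, selected by a letter from a finite alphabet.\<close>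

lemma measurable_full_sum_joint:
  "(\<lambda>z. full_sum (fst z) (\<lambda>n. snd z (n, fst z n))) \<in> borel_measurable (seq_space \<Otimes>\<^sub>M digs)"
  unfolding full_sum_def
proof (intro borel_measurable_suminf borel_measurable_times)
  fix i
  have "(\<lambda>\<omega>. lam_prod \<omega> i) \<in> borel_measurable seq_space"
    by (rule measurable_finite_coords[of i]) (auto intro: lam_prod_cong)
  then show "(\<lambda>z. lam_prod (fst z) i) \<in> borel_measurable (seq_space \<Otimes>\<^sub>M digs)"
    by (rule measurable_compose[OF measurable_fst])
  have "(\<lambda>z. t a (snd z (i, a))) \<in> borel_measurable (seq_space \<Otimes>\<^sub>M digs)" for a
  proof -
    have "(\<lambda>x. t a (x (i, a))) \<in> borel_measurable digs"
      by (rule measurable_compose[OF measurable_digs_coord]) simp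
    then show ?thesis by (rule measurable_compose[OF measurable_snd])
  qed
  moreover have "(\<lambda>z. fst z i) \<in> measurable (seq_space \<Otimes>\<^sub>M digs) (count_space UNIV)" by measurable
  ultimately show "(\<lambda>z. t (fst z i) (snd z (i, fst z i))) \<in> borel_measurable (seq_space \<Otimes>\<^sub>M digs)"
    by (rule measurable_compose_countable[of "\<lambda>a z. t a (snd z (i, a))"])
qed

text \<open>On the common digit space this is the measure of a section of a product measurable set,
  which depends measurably on the section point.\<close>

lemma measurable_eta_measure:
  assumes B: "Bs \<in> sets borel"
  shows "(\<lambda>\<omega>. measure (eta \<omega>) Bs) \<in> borel_measurable seq_space"
proof -
  interpret D: prob_space digs by (rule prob_space_digs)
  let ?F = "\<lambda>z. full_sum (fst z) (\<lambda>n. snd z (n, fst z n))"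
  let ?E = "?F -` Bs \<inter> space (seq_space \<Otimes>\<^sub>M digs)"
  have E: "?E \<in> sets (seq_space \<Otimes>\<^sub>M digs)"
    using measurable_full_sum_joint B by (rule measurable_sets)
  have eq: "measure (eta \<omega>) Bs = enn2real (emeasure digs (Pair \<omega> -` ?E))" for \<omega>
  proof -
    have "(\<lambda>x. ?F (\<omega>, x)) \<in> borel_measurable digs"
      by (rule measurable_compose[OF measurable_Pair1' measurable_full_sum_joint]) simp
    then have "measure (eta \<omega>) Bs = measure digs ((\<lambda>x. full_sum \<omega> (\<lambda>n. x (n, \<omega> n))) -` Bs \<inter> space digs)"
      unfolding eta_eq_digs using B by (intro measure_distr) auto
    also have "(\<lambda>x. full_sum \<omega> (\<lambda>n. x (n, \<omega> n))) -` Bs \<inter> space digs = Pair \<omega> -` ?E"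
      by (auto simp: space_pair_measure)
    finally show ?thesis by (simp add: measure_def)
  qed
  show ?thesis unfolding eq
    by (rule measurable_compose[OF D.measurable_emeasure_Pair[OF E]]) measurable
qed

text \<open>The factor is kept apart from the sequence: on a cylinder the factor of
  \<open>tau\<close> is constant while the shifted sequence varies.\<close>

definition scaled_eta :: "complex \<Rightarrow> (nat \<Rightarrow> 'i) \<Rightarrow> complex measure" where
  "scaled_eta a \<omega> = distr (eta \<omega>) borel (\<lambda>z. a * z)"

lemma tau_eq_scaled_eta: "tau \<omega> m = scaled_eta (lam_prod \<omega> m) ((shift ^^ m) \<omega>)"
  by (simp add: tau_meas_def scaled_eta_def lam_prod_def)

lemma scaled_eta_props:
  shows "prob_space (scaled_eta a \<omega>)" "sets (scaled_eta a \<omega>) = sets borel" "AE y in scaled_eta a \<omega>. y \<in> cball 0 (cmod a * B)"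
proof -
  interpret P: prob_space "PiM UNIV (dig \<omega>)" by (rule prob_space_PiM_dig)
  have [measurable]: "full_sum \<omega> \<in> borel_measurable (PiM UNIV (dig \<omega>))" by (rule measurable_full_sum)
  have e: "scaled_eta a \<omega> = distr (PiM UNIV (dig \<omega>)) borel (\<lambda>u. a * full_sum \<omega> u)"
    unfolding scaled_eta_def eta_eq by (subst distr_distr) (auto simp: comp_def)
  show "prob_space (scaled_eta a \<omega>)" unfolding e by (intro P.prob_space_distr) measurable
  show "sets (scaled_eta a \<omega>) = sets borel" by (simp add: scaled_eta_def)
  have "AE u in PiM UNIV (dig \<omega>). a * full_sum \<omega> u \<in> cball 0 (cmod a * B)"
    using AE_valid by eventually_elim (auto simp: norm_mult intro!: mult_left_mono full_sum_bound)
  then show "AE y in scaled_eta a \<omega>. y \<in> cball 0 (cmod a * B)"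
    unfolding e using borel_closed[OF closed_cball, of "0::complex" "cmod a * B"] by (subst AE_distr_iff) auto
qed

lemma measurable_scaled_eta_measure:
  assumes "Bs \<in> sets borel"
  shows "(\<lambda>\<omega>. measure (scaled_eta a \<omega>) Bs) \<in> borel_measurable seq_space"
proof -
  have m: "(\<lambda>z. a * z) \<in> borel_measurable borel" by measurable
  have "measure (scaled_eta a \<omega>) Bs = measure (eta \<omega>) ((\<lambda>z. a * z) -` Bs)" for \<omega>
    unfolding scaled_eta_def using assms by (subst measure_distr) (auto simp: eta_meas_def)
  then show ?thesis using measurable_eta_measure[OF measurable_sets_borel[OF m assms]] by simp
qed

lemma space_scaled_eta: "space (scaled_eta a \<omega>) = UNIV" by (simp add: scaled_eta_def)

text \<open>All these measures are carried by one ball independent of \<omega>, so the entropy is a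
  sum over a fixed finite set of cells.\<close>

lemma measurable_scaled_eta_entropy: "(\<lambda>\<omega>. dyadic_entropy (scaled_eta a \<omega>) N) \<in> borel_measurable seq_space"
proof -
  define F where "F = (\<lambda>x. cell (2 ^ N * x)) ` cball 0 (cmod a * B)"
  have fin: "finite F" unfolding F_def using finite_cell_scaled_bounded[of "\<lambda>x. x"] by simp
  have "dyadic_entropy (scaled_eta a \<omega>) N = (\<Sum>v\<in>F. ent_fun (measure (scaled_eta a \<omega>) {y. cell (2 ^ N * y) = v}))" for \<omega>
    using fin unfolding F_def
    by (subst dyadic_entropy_eq_rv_entropy[OF space_scaled_eta scaled_eta_props(3)], simp)
       (subst rv_entropy_eq_sum[OF scaled_eta_props(3) subset_refl], auto simp: space_scaled_eta)
  moreover have "(\<lambda>\<omega>. \<Sum>v\<in>F. ent_fun (measure (scaled_eta a \<omega>) {y. cell (2 ^ N * y) = v})) \<in> borel_measurable seq_space"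
    by (intro borel_measurable_sum measurable_compose[OF measurable_scaled_eta_measure measurable_ent_fun]) measurable
  ultimately show ?thesis by simp
qed

lemma measurable_conv_scaled_eta_entropy:
  assumes c: "fin_supp c S"
  shows "(\<lambda>\<omega>. dyadic_entropy (conv c (scaled_eta a \<omega>)) N) \<in> borel_measurable seq_space"
proof -
  let ?A = "cball 0 (cmod a * B)"
  let ?X = "\<lambda>(x, y). cell (2 ^ N * (x + y))"
  define F where "F = ?X ` (S \<times> ?A)"
  have fin: "finite F"
    unfolding F_def using finite_cell_scaled_bounded[OF bounded_sum_image[OF fin_suppD(3)[OF c], of "\<lambda>y. y" ?A], of "2 ^ N"]
    by (simp add: case_prod_beta')
  have "dyadic_entropy (conv c (scaled_eta a \<omega>)) N
      = (\<Sum>v\<in>F. ent_fun (\<Sum>x\<in>S. measure c {x} * measure (scaled_eta a \<omega>) {y. cell (2 ^ N * (x + y)) = v}))" for \<omega>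
  proof -
    note t = scaled_eta_props[of a \<omega>]
    have AE: "AE z in c \<Otimes>\<^sub>M scaled_eta a \<omega>. z \<in> S \<times> ?A"
      by (intro AE_pair_Times fin_suppD[OF c] t)
    have m: "?X \<in> measurable (c \<Otimes>\<^sub>M scaled_eta a \<omega>) (count_space UNIV)"
      using t(2) by (intro measurable_cell_sum fin_suppD(2)[OF c]) (auto cong: measurable_cong_sets)
    have "dyadic_entropy (conv c (scaled_eta a \<omega>)) N = rv_entropy (c \<Otimes>\<^sub>M scaled_eta a \<omega>) ?X"
      using dyadic_entropy_conv[OF c t] by (simp add: conv_entropy_def)
    also have "\<dots> = (\<Sum>v\<in>F. ent_fun (measure (c \<Otimes>\<^sub>M scaled_eta a \<omega>) {z\<in>space (c \<Otimes>\<^sub>M scaled_eta a \<omega>). ?X z = v}))"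
      using fin by (subst rv_entropy_eq_sum[OF AE, of _ F]) (auto simp: F_def)
    also have "\<dots> = (\<Sum>v\<in>F. ent_fun (\<Sum>x\<in>S. measure c {x} * measure (scaled_eta a \<omega>) {y. cell (2 ^ N * (x + y)) = v}))"
      using pred_count_space_const1[OF m]
      by (intro sum.cong refl, subst measure_pair_fin_supp[OF c t(1)]) (auto simp: space_scaled_eta)
    finally show ?thesis .
  qed
  moreover have "(\<lambda>\<omega>. \<Sum>v\<in>F. ent_fun (\<Sum>x\<in>S. measure c {x} * measure (scaled_eta a \<omega>) {y. cell (2 ^ N * (x + y)) = v})) \<in> borel_measurable seq_space"
  proof (intro borel_measurable_sum measurable_compose[OF _ measurable_ent_fun] borel_measurable_times
      borel_measurable_const measurable_scaled_eta_measure)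
    fix x v
    have "{y\<in>space borel. cell (2 ^ N * (x + y)) = v} \<in> sets borel" by measurable
    then show "{y. cell (2 ^ N * (x + y)) = v} \<in> sets borel" by simp
  qed
  ultimately show ?thesis by simp
qed

section \<open>Component probabilities and the word up to the stopping level\<close>

lemma comp_prob_eq_sum:
  assumes nu: "fin_supp \<nu> S"
  shows "comp_prob \<nu> n Q = (\<Sum>x\<in>S. measure \<nu> {x} * (if Q (component \<nu> x n) then 1 else 0))"
proof -
  have "{x. Q (component \<nu> x n)} = (\<lambda>x. cell (2 ^ n * x)) -` {v. Q (cond_measure \<nu> {z. cell (2 ^ n * z) = v})} \<inter> space borel"
    by (simp add: component_eq vimage_def)
  also have "\<dots> \<in> sets borel"
    by (rule measurable_sets[OF measurable_cell_scaled]) auto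
  finally have "{x. Q (component \<nu> x n)} \<in> sets borel" .
  then show ?thesis
    unfolding comp_prob_def fin_suppD(5)[OF nu]
    by (subst measure_eq_sum_fin_supp[OF nu]) (auto intro!: sum.cong)
qed

lemma measurable_comp_prob_scaled_eta:
  assumes nu: "fin_supp \<nu> S"
  shows "(\<lambda>\<omega>. comp_prob \<nu> n (\<lambda>c. r * \<bar>dyadic_entropy (conv c (scaled_eta a \<omega>)) N - dyadic_entropy (scaled_eta a \<omega>) N\<bar> < d))
    \<in> borel_measurable seq_space"
  unfolding comp_prob_eq_sum[OF nu]
proof (rule borel_measurable_sum)
  fix x
  let ?c = "component \<nu> x n"
  interpret N: prob_space \<nu> using nu by (rule fin_suppD)
  show "(\<lambda>\<omega>. measure \<nu> {x} * (if r * \<bar>dyadic_entropy (conv ?c (scaled_eta a \<omega>)) N - dyadic_entropy (scaled_eta a \<omega>) N\<bar> < d then 1 else 0))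
      \<in> borel_measurable seq_space"
  \<comment> \<open>At a null point x the component may be the zero measure; the weight removes that
    term.\<close>
  proof (cases "measure \<nu> {x} = 0")
    case False
    have "measure \<nu> {x} \<le> measure \<nu> {z. cell (2 ^ n * z) = cell (2 ^ n * x)}"
      using fin_suppD(2)[OF nu] by (intro N.finite_measure_mono) auto
    with False have "measure \<nu> {z. cell (2 ^ n * z) = cell (2 ^ n * x)} \<noteq> 0"
      by (metis measure_le_0_iff)
    then have c: "fin_supp ?c S" unfolding component_eq by (intro fin_supp_cond_measure[OF nu]) auto
    note [measurable] = measurable_conv_scaled_eta_entropy[OF c] measurable_scaled_eta_entropy
    show ?thesis by measurable
  qed simp
qed

text \<open>n' is a stopping time: whether the product has fallen below the threshold at level m is
  decided by the first m letters.\<close>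

lemma np_cong:
  assumes R: "0 < R" and eq: "\<And>j. j < n_prime lam R \<omega> n \<Longrightarrow> \<omega> j = \<omega>' j"
  shows "n_prime lam R \<omega>' n = n_prime lam R \<omega> n"
proof -
  have L: "lam_prod \<omega> m = lam_prod \<omega>' m" if "m \<le> n_prime lam R \<omega> n" for m
    using that eq by (intro lam_prod_cong) auto
  show ?thesis
    unfolding np_def[OF R, of \<omega>']
  proof (rule Least_equality)
    show "2 * R * cmod (lam_prod \<omega>' (n_prime lam R \<omega> n)) \<le> 1 / 2 ^ n"
      using np_upper[OF R, of \<omega> n] L by simp
    fix m assume m: "2 * R * cmod (lam_prod \<omega>' m) \<le> 1 / 2 ^ n"
    show "n_prime lam R \<omega> n \<le> m"
    proof (rule ccontr)
      assume "\<not> n_prime lam R \<omega> n \<le> m"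
      then show False using np_minimal[OF R, of m \<omega> n] L[of m] m by simp
    qed
  qed
qed

lemma measurable_np_prefix:
  assumes R: "0 < R"
  shows "(\<lambda>\<omega>. map \<omega> [0..<n_prime lam R \<omega> n]) \<in> measurable seq_space (count_space UNIV)"
proof (subst measurable_count_space_eq2_countable, intro conjI ballI)
  fix l :: "'i list"
  let ?m = "length l"
  \<comment> \<open>Beyond its length the word is continued by unspecified values of
    \<open>l ! j\<close>. In both inclusions the stopping level is the length of l, so they are not
    read.\<close>
  let ?e = "\<lambda>j. l ! j"
  have "(\<lambda>\<omega>. map \<omega> [0..<n_prime lam R \<omega> n]) -` {l} \<inter> space seq_space
      = {\<omega>\<in>space seq_space. (\<forall>j<?m. \<omega> j = l ! j) \<and> n_prime lam R ?e n = ?m}"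
  proof (intro set_eqI iffI)
    fix \<omega> assume "\<omega> \<in> (\<lambda>\<omega>. map \<omega> [0..<n_prime lam R \<omega> n]) -` {l} \<inter> space seq_space"
    then have l: "l = map \<omega> [0..<n_prime lam R \<omega> n]" by auto
    then have "n_prime lam R ?e n = n_prime lam R \<omega> n" by (intro np_cong[OF R]) simp
    then show "\<omega> \<in> {\<omega>\<in>space seq_space. (\<forall>j<?m. \<omega> j = l ! j) \<and> n_prime lam R ?e n = ?m}"
      using l by auto
  next
    fix \<omega> assume w: "\<omega> \<in> {\<omega>\<in>space seq_space. (\<forall>j<?m. \<omega> j = l ! j) \<and> n_prime lam R ?e n = ?m}"
    then have "n_prime lam R \<omega> n = n_prime lam R ?e n" by (intro np_cong[OF R]) auto
    then show "\<omega> \<in> (\<lambda>\<omega>. map \<omega> [0..<n_prime lam R \<omega> n]) -` {l} \<inter> space seq_space"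
      using w by (simp add: map_upt_eq_iff)
  qed
  also have "\<dots> \<in> sets seq_space" by measurable
  finally show "(\<lambda>\<omega>. map \<omega> [0..<n_prime lam R \<omega> n]) -` {l} \<inter> space seq_space \<in> sets seq_space" .
qed auto

text \<open>On the cylinder given by the word of length \<open>n'(\<omega>)\<close>, the only remaining dependence on \<^term>\<open>\<omega>\<close>
  is through \<^term>\<open>eta\<close> of the shifted sequence.\<close>

lemma good_set_measurable:
  assumes R: "0 < R"
  shows "good_set lam k t p R \<epsilon> \<delta> q n \<in> sets seq_space"
proof -
  let ?e = "\<lambda>l j. l ! j :: 'i"
  let ?\<Psi> = "\<lambda>l \<omega>. comp_prob (nu (?e l) (length l)) n (\<lambda>c. 1 / (real q * real n) *
    \<bar>dyadic_entropy (conv c (scaled_eta (lam_prod (?e l) (length l)) ((shift ^^ length l) \<omega>))) ((q + 1) * n)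
      - dyadic_entropy (scaled_eta (lam_prod (?e l) (length l)) ((shift ^^ length l) \<omega>)) ((q + 1) * n)\<bar> < \<delta>)"
  let ?g = "\<lambda>\<omega>. map \<omega> [0..<n_prime lam R \<omega> n]"
  have m: "?\<Psi> l \<in> borel_measurable seq_space" for l
    by (rule measurable_compose[OF measurable_shift_pow measurable_comp_prob_scaled_eta[OF fin_supp_nu]])
  have m': "(\<lambda>\<omega>. ?\<Psi> (?g \<omega>) \<omega>) \<in> borel_measurable seq_space"
    by (rule measurable_compose_countable[OF m measurable_np_prefix[OF R]])
  have "good_set lam k t p R \<epsilon> \<delta> q n = {\<omega>\<in>space seq_space. ?\<Psi> (?g \<omega>) \<omega> > 1 - \<epsilon>}"
  proof -
    have "?\<Psi> (?g \<omega>) \<omega> = comp_prob (nu \<omega> (n_prime lam R \<omega> n)) n (\<lambda>c. 1 / (real q * real n) *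
        \<bar>dyadic_entropy (conv c (tau \<omega> (n_prime lam R \<omega> n))) ((q + 1) * n)
          - dyadic_entropy (tau \<omega> (n_prime lam R \<omega> n)) ((q + 1) * n)\<bar> < \<delta>)" for \<omega>
    proof -
      have "nu (?e (?g \<omega>)) (n_prime lam R \<omega> n) = nu \<omega> (n_prime lam R \<omega> n)"
        "lam_prod (?e (?g \<omega>)) (n_prime lam R \<omega> n) = lam_prod \<omega> (n_prime lam R \<omega> n)"
        by (auto intro!: nu_cong lam_prod_cong)
      then show ?thesis by (simp add: tau_eq_scaled_eta)
    qed
    then show ?thesis unfolding good_set_def Let_def by auto
  qed
  also have "\<dots> \<in> sets seq_space" using m' by measurable
  finally show ?thesis .
qed

end

section \<open>Convergence in measure\<close>

lemma shift_invariant_ergodicD: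
  fixes P :: "(nat \<Rightarrow> 'i) measure"
  assumes "shift_invariant_ergodic P"
  shows "prob_space P" "sets P = sets seq_space" "space P = UNIV" "distr P P (shift ^^ m) = P"
proof -
  show P: "prob_space P" "sets P = sets seq_space"
    using assms by (auto simp: shift_invariant_ergodic_def seq_space_def)
  show "space P = UNIV" using sets_eq_imp_space_eq[OF P(2)] by simp
  have s: "shift \<in> measurable P P" "distr P P shift = P"
    using assms by (auto simp: shift_invariant_ergodic_def)
  have sm: "(shift ^^ m) \<in> measurable P P" for m
    using measurable_shift_pow[of m] by (simp add: measurable_cong_sets[OF P(2) P(2)])
  show "distr P P (shift ^^ m) = P"
  proof (induction m)
    case 0 then show ?case by (simp add: id_def distr_id)
  next
    case (Suc m)
    have "distr P P (shift ^^ Suc m) = distr (distr P P (shift ^^ m)) P shift"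
      by (simp add: distr_distr[OF s(1) sm])
    also have "\<dots> = P" using Suc s(2) by simp
    finally show ?case .
  qed
qed

context planar begin

lemma G_bounded: "\<exists>c\<ge>0. \<forall>\<omega> m. G \<omega> m \<le> c * (real m + 1)"
proof -
  define g where "g = G (\<lambda>_. undefined) 0"
  have g: "0 \<le> g" by (simp add: g_def G_nonneg)
  have "G \<omega> m \<le> (g + c2) * (real m + 1)" for \<omega> m
  proof -
    \<comment> \<open>At level 0 no letter is read, so the value is the same for all
      \<omega>.\<close>
    have "G \<omega> 0 = g" unfolding g_def by (rule G_cong) simp
    then have "G \<omega> m \<le> g + c2 * (real m + 1)" using G_add_right_le[of \<omega> 0 m] by simp
    also have "\<dots> \<le> (g + c2) * (real m + 1)" using g by (simp add: algebra_simps)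
    finally show ?thesis .
  qed
  then show ?thesis using g c2_nonneg by (intro exI[of _ "g + c2"]) auto
qed

text \<open>Defect of additivity, shifted by \<open>c1\<close> to make it nonnegative, as Markov's
  inequality requires.\<close>

definition excess :: "nat \<Rightarrow> nat \<Rightarrow> (nat \<Rightarrow> 'i) \<Rightarrow> real" where
  "excess m d \<omega> = G \<omega> (m + d) - G \<omega> m - G ((shift ^^ m) \<omega>) d + c1"

lemma excess_nonneg: "0 \<le> excess m d \<omega>"
  using G_superadd[of \<omega> m d] by (simp add: excess_def)

lemma measurable_excess: "excess m d \<in> borel_measurable seq_space"
  unfolding excess_def[abs_def] by measurable

text \<open>By invariance the shifted term has the mean of the unshifted one, so the mean excess is
  a(m + d) - a(m) - a(d) + c1. Both levels are multiples of the same s, and a(l s)/s tends to l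
  \<alpha>, so the linear parts cancel.\<close>

lemma mean_excess_tendsto:
  assumes inv: "shift_invariant_ergodic P"
  shows "(\<lambda>s. (\<integral>\<omega>. excess (i * s) (j * s) \<omega> \<partial>P) / real s) \<longlonglongrightarrow> 0"
    and "integrable P (excess m d)"
proof -
  note I = shift_invariant_ergodicD[OF inv]
  interpret prob_space P by (rule I(1))
  obtain c where c: "0 \<le> c" "\<And>\<omega> m. G \<omega> m \<le> c * (real m + 1)" using G_bounded by blast
  have mP: "measurable P N = measurable seq_space N" for N :: "'z measure"
    by (rule measurable_cong_sets[OF I(2) refl])
  have G_int: "integrable P (\<lambda>\<omega>. G \<omega> m)" for m
  proof (rule integrable_const_bound)
    show "AE \<omega> in P. norm (G \<omega> m) \<le> c * (real m + 1)" using c(2) G_nonneg by (intro always_eventually) simp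
  qed (simp add: mP)
  have sm: "(shift ^^ m) \<in> measurable P P" for m
    using measurable_shift_pow[of m] by (simp add: measurable_cong_sets[OF I(2) I(2)])
  have Gs_int: "integrable P (\<lambda>\<omega>. G ((shift ^^ l) \<omega>) m)" for m l
    using integrable_distr[OF sm, of l "\<lambda>\<omega>. G \<omega> m"] G_int[of m] by (simp add: I(4))
  have inv_G: "(\<integral>\<omega>. G ((shift ^^ l) \<omega>) m \<partial>P) = (\<integral>\<omega>. G \<omega> m \<partial>P)" for m l
    using integral_distr[OF sm, of "\<lambda>\<omega>. G \<omega> m" l] by (simp add: I(4) mP)
  define a where "a m = (\<integral>\<omega>. G \<omega> m \<partial>P)" for m
  show int: "integrable P (excess m d)" for m d
    unfolding excess_def[abs_def] using G_int Gs_int by simp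
  have E: "(\<integral>\<omega>. excess m d \<omega> \<partial>P) = a (m + d) - a m - a d + c1" for m d
    unfolding excess_def using G_int Gs_int by (simp add: a_def inv_G prob_space)
  have "0 \<le> (\<integral>\<omega>. excess m d \<omega> \<partial>P)" for m d by (intro integral_nonneg_AE) (simp add: excess_nonneg)
  then have sup: "a m + a d \<le> a (m + d) + c1" for m d using E[of m d] by (smt (verit))
  have a0: "0 \<le> a m" for m unfolding a_def by (intro integral_nonneg_AE) (simp add: G_nonneg)
  have "a m \<le> c * (real m + 1)" for m
    unfolding a_def using integral_mono[OF G_int, of "\<lambda>_. c * (real m + 1)" m] c(2) by (simp add: prob_space)
  from superadditive_limit[OF sup a0 this c1_nonneg c(1)]
  obtain \<alpha> where \<alpha>: "(\<lambda>n. a n / real n) \<longlonglongrightarrow> \<alpha>" by metis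
  have lim: "(\<lambda>s. a (l * s) / real s) \<longlonglongrightarrow> real l * \<alpha>" for l
  \<comment> \<open>For l = 0 the index l s does not tend to infinity.\<close>
  proof (cases "l = 0")
    case True
    then show ?thesis using lim_const_over_n[of "a 0"] by simp
  next
    case False
    have "filterlim (\<lambda>s. l * s) sequentially sequentially"
      using False by (intro filterlim_subseq) (simp add: strict_mono_def)
    then have "(\<lambda>s. real l * (a (l * s) / real (l * s))) \<longlonglongrightarrow> real l * \<alpha>"
      by (intro tendsto_mult_left filterlim_compose[OF \<alpha>])
    then show ?thesis using False by simp
  qed
  have "(\<lambda>s. a ((i + j) * s) / real s - a (i * s) / real s - a (j * s) / real s + c1 / real s)
      \<longlonglongrightarrow> real (i + j) * \<alpha> - real i * \<alpha> - real j * \<alpha> + 0"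
    by (intro tendsto_add tendsto_diff lim lim_const_over_n)
  moreover have "a ((i + j) * s) / real s - a (i * s) / real s - a (j * s) / real s + c1 / real s
      = (\<integral>\<omega>. excess (i * s) (j * s) \<omega> \<partial>P) / real s" for s
    unfolding E by (simp add: add_divide_distrib diff_divide_distrib algebra_simps)
  ultimately show "(\<lambda>s. (\<integral>\<omega>. excess (i * s) (j * s) \<omega> \<partial>P) / real s) \<longlonglongrightarrow> 0"
    by (simp add: algebra_simps)
qed

lemma excess_grid_tendsto:
  assumes inv: "shift_invariant_ergodic P" and \<kappa>: "0 < \<kappa>" and L: "0 < L"
  shows "(\<lambda>n. measure P (\<Union>i\<le>J. \<Union>j\<le>J. {\<omega>. \<kappa> * real n \<le> excess (i * (n div L + 1)) (j * (n div L + 1)) \<omega>})) \<longlonglongrightarrow> 0"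
proof -
  note I = shift_invariant_ergodicD[OF inv]
  interpret prob_space P by (rule I(1))
  \<comment> \<open>A step of about n / L; adding 1 keeps it positive.\<close>
  define s where "s n = n div L + 1" for n
  define X where "X i j n = {\<omega>. \<kappa> * real n \<le> excess (i * s n) (j * s n) \<omega>}" for i j n
  have X: "X i j n \<in> sets P" for i j n
  proof -
    have "{\<omega>\<in>space seq_space. \<kappa> * real n \<le> excess (i * s n) (j * s n) \<omega>} \<in> sets seq_space"
      using measurable_excess by measurable
    then show ?thesis by (simp add: X_def I(2))
  qed
  have s_lim: "filterlim s sequentially sequentially"
    unfolding filterlim_at_top
  proof
    fix Z
    have "Z \<le> s n" if "n \<ge> Z * L" for n
      using div_le_mono[OF that, of L] L by (simp add: s_def)
    then show "eventually (\<lambda>n. Z \<le> s n) sequentially" unfolding eventually_sequentially by blast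
  qed
  have X_lim: "(\<lambda>n. prob (X i j n)) \<longlonglongrightarrow> 0" for i j
  proof (rule tendsto_sandwich[OF _ _ tendsto_const])
    \<comment> \<open>Markov's inequality at height \<kappa> n; the factor 2 comes from s n \<le> 2
      n.\<close>
    have "(\<lambda>n. 2 / \<kappa> * ((\<integral>\<omega>. excess (i * s n) (j * s n) \<omega> \<partial>P) / real (s n))) \<longlonglongrightarrow> 2 / \<kappa> * 0"
      by (intro tendsto_mult_left filterlim_compose[OF mean_excess_tendsto(1)[OF inv] s_lim])
    then show "(\<lambda>n. 2 / \<kappa> * ((\<integral>\<omega>. excess (i * s n) (j * s n) \<omega> \<partial>P) / real (s n))) \<longlonglongrightarrow> 0" by simp
    show "eventually (\<lambda>n. prob (X i j n) \<le> 2 / \<kappa> * ((\<integral>\<omega>. excess (i * s n) (j * s n) \<omega> \<partial>P) / real (s n))) sequentially"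
      using eventually_ge_at_top[of 1]
    proof eventually_elim
      fix n :: nat assume n: "1 \<le> n"
      let ?E = "\<integral>\<omega>. excess (i * s n) (j * s n) \<omega> \<partial>P"
      have E0: "0 \<le> ?E" by (intro integral_nonneg_AE) (simp add: excess_nonneg)
      have sn: "real (s n) \<le> 2 * real n" "0 < real (s n)"
      proof -
        have "s n \<le> 2 * n" unfolding s_def using n div_le_dividend[of n L] by linarith
        then show "real (s n) \<le> 2 * real n" by linarith
      qed (simp add: s_def)
      have "prob (X i j n) \<le> ?E / (\<kappa> * real n)"
        using integral_Markov_inequality_measure[OF mean_excess_tendsto(2)[OF inv], of UNIV "i * s n" "j * s n" "\<kappa> * real n"]
          \<kappa> n excess_nonneg I(3) sets.top[of P]
        by (simp add: X_def)
      also have "\<dots> \<le> 2 / \<kappa> * (?E / real (s n))"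
      proof -
        have "?E * real (s n) \<le> ?E * (2 * real n)" using sn E0 by (intro mult_left_mono) auto
        then show ?thesis using \<kappa> n sn by (simp add: field_simps)
      qed
      finally show "prob (X i j n) \<le> 2 / \<kappa> * (?E / real (s n))" .
    qed
  qed simp
  have "(\<lambda>n. \<Sum>i\<le>J. \<Sum>j\<le>J. prob (X i j n)) \<longlonglongrightarrow> (\<Sum>i\<le>J. \<Sum>j\<le>J. 0)"
    by (intro tendsto_sum X_lim)
  then have "(\<lambda>n. \<Sum>i\<le>J. \<Sum>j\<le>J. prob (X i j n)) \<longlonglongrightarrow> 0" by simp
  moreover have "prob (\<Union>i\<le>J. \<Union>j\<le>J. X i j n) \<le> (\<Sum>i\<le>J. \<Sum>j\<le>J. prob (X i j n))" for n
  proof -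
    have "prob (\<Union>i\<le>J. \<Union>j\<le>J. X i j n) \<le> (\<Sum>i\<le>J. prob (\<Union>j\<le>J. X i j n))"
      using X by (intro finite_measure_subadditive_finite) (auto intro!: sets.finite_UN)
    also have "\<dots> \<le> (\<Sum>i\<le>J. \<Sum>j\<le>J. prob (X i j n))"
      using X by (intro sum_mono finite_measure_subadditive_finite) auto
    finally show ?thesis .
  qed
  ultimately have "(\<lambda>n. prob (\<Union>i\<le>J. \<Union>j\<le>J. X i j n)) \<longlonglongrightarrow> 0"
    by (auto intro: tendsto_sandwich[where f="\<lambda>_. 0" and h="\<lambda>n. \<Sum>i\<le>J. \<Sum>j\<le>J. prob (X i j n)"])
  then show ?thesis by (simp add: X_def s_def)
qed

text \<open>Rounding the random levels \<^term>\<open>m\<close> and \<^term>\<open>M\<close> to multiples of \<^term>\<open>s\<close> leaves only finitely many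
  deterministic levels to control.\<close>

lemma excess_le_grid:
  fixes m M s :: nat
  assumes m: "m \<le> M" and s: "0 < s"
  defines "i \<equiv> m div s" and "j \<equiv> M div s + 1 - m div s"
  shows "excess m (M - m) \<omega> \<le> excess (i * s) (j * s) \<omega> + 2 * c1 + (c2 + c3) * (real s + 1)"
proof -
  \<comment> \<open>m is rounded down and M up, so the block between them only grows.\<close>
  define m' where "m' = i * s"
  define M' where "M' = (M div s + 1) * s"
  have im: "m' \<le> m" "m \<le> m' + s"
    using dividend_less_div_times[OF s, of m] by (auto simp: m'_def i_def)
  have iM: "M \<le> M'" "M' \<le> M + s"
    using dividend_less_div_times[OF s, of M] by (auto simp: M'_def)
  have js: "j * s = M' - m'" by (simp add: j_def M'_def m'_def i_def diff_mult_distrib)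
  have M'm': "m' + (M' - m') = M'" using im iM m by simp
  \<comment> \<open>\<open>G\<close> is nondecreasing in the level up to \<open>c1\<close>, by
    superadditivity and nonnegativity.\<close>
  have 1: "G \<omega> M \<le> G \<omega> M' + c1"
    using G_superadd[of \<omega> M "M' - M"] G_nonneg[of "(shift ^^ M) \<omega>" "M' - M"] iM by simp
  have 2: "G \<omega> m' \<le> G \<omega> m + c1"
    using G_superadd[of \<omega> m' "m - m'"] G_nonneg[of "(shift ^^ m') \<omega>" "m - m'"] im by simp
  have sh: "(shift ^^ (m - m')) ((shift ^^ m') \<omega>) = (shift ^^ m) \<omega>"
    using im(1) by (simp add: shift_funpow)
  \<comment> \<open>The enlarged block loses its first m - m' letters by
    \<open>G_add_left_le\<close> and its last M' - M by \<open>G_add_right_le\<close>, at most s of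
    each.\<close>
  have "G ((shift ^^ m') \<omega>) (M' - m') \<le> G ((shift ^^ m) \<omega>) (M' - m) + c3 * (real (m - m') + 1)"
    using G_add_left_le[of "(shift ^^ m') \<omega>" "m - m'" "M' - m"] im iM m by (simp add: sh)
  also have "c3 * (real (m - m') + 1) \<le> c3 * (real s + 1)"
    using im c3_nonneg by (intro mult_left_mono) auto
  also have "G ((shift ^^ m) \<omega>) (M' - m) \<le> G ((shift ^^ m) \<omega>) (M - m) + c2 * (real (M' - M) + 1)"
    using G_add_right_le[of "(shift ^^ m) \<omega>" "M - m" "M' - M"] iM m by simp
  also have "c2 * (real (M' - M) + 1) \<le> c2 * (real s + 1)"
    using iM c2_nonneg by (intro mult_left_mono) auto
  finally have 3: "G ((shift ^^ m') \<omega>) (M' - m') \<le> G ((shift ^^ m) \<omega>) (M - m) + (c2 + c3) * (real s + 1)"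
    by (simp add: distrib_right)
  show ?thesis
    using 1 2 3 m unfolding excess_def js m'_def[symmetric] M'm' by simp
qed

section \<open>Components against the excess, and the limit\<close>

context
  fixes R :: real assumes R: "0 < R"
begin

text \<open>Chain rule cost at dyadic scales n \<le> N: the small summand has radius |lam_prod| B,
  at most B / (2 R) times \<open>1 / 2 ^ n\<close>.\<close>

definition c5 :: real where "c5 = 2 * log 2 (6 + 2 * B / R)"

text \<open>The chain rule bounds the average by H(nu * tau) - H(nu) up to \<open>c5\<close>.
  Expressing these two entropies and H(tau) through \<open>G\<close> turns the gain over H(tau) into
  the excess; each of the three replacements costs one \<open>c4 R\<close>.\<close>

lemma components_le_excess:
  fixes \<omega> :: "nat \<Rightarrow> 'i" and n N :: nat
  assumes "n \<le> N"
  defines "m \<equiv> n_prime lam R \<omega> n" and "M \<equiv> n_prime lam R \<omega> N"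
  shows "(\<Sum>v\<in>(\<lambda>x. cell (2 ^ n * x)) ` nu_supp \<omega> m. measure (nu \<omega> m) {x. cell (2 ^ n * x) = v} *
      conv_entropy (cond_measure (nu \<omega> m) {x. cell (2 ^ n * x) = v}) (tau \<omega> m) (\<lambda>y. y) (2 ^ N))
    \<le> rv_entropy (tau \<omega> m) (\<lambda>y. cell (2 ^ N * y)) + (excess m (M - m) \<omega> + 3 * c4 R + c5)"
proof -
  let ?\<rho> = "cmod (lam_prod \<omega> m) * B"
  note t = scaled_eta_props[of "lam_prod \<omega> m" "(shift ^^ m) \<omega>", folded tau_eq_scaled_eta]
  have "rv_entropy (nu \<omega> m) (\<lambda>x. cell (2 ^ n * x))
      + (\<Sum>v\<in>(\<lambda>x. cell (2 ^ n * x)) ` nu_supp \<omega> m. measure (nu \<omega> m) {x. cell (2 ^ n * x) = v} *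
          conv_entropy (cond_measure (nu \<omega> m) {x. cell (2 ^ n * x) = v}) (tau \<omega> m) (\<lambda>y. y) (2 ^ N))
    \<le> conv_entropy (nu \<omega> m) (tau \<omega> m) (\<lambda>y. y) (2 ^ N) + 2 * log 2 (2 * (cmod (2 ^ n) * (2 / cmod (2 ^ N) + 2 * ?\<rho>)) + 2)"
    using t(2) B_nonneg by (intro conv_entropy_ge_components[OF fin_supp_nu t(1) _ t(3)]) (auto cong: measurable_cong_sets)
  moreover have "log 2 (2 * (cmod (2 ^ n) * (2 / cmod (2 ^ N) + 2 * ?\<rho>)) + 2) \<le> log 2 (6 + 2 * B / R)"
  proof -
    have "2 ^ n * cmod (lam_prod \<omega> m) \<le> 1 / (2 * R)"
      using np_upper[OF R, of \<omega> n] R by (simp add: m_def field_simps)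
    then have "(2 ^ n * cmod (lam_prod \<omega> m)) * B \<le> 1 / (2 * R) * B" using B_nonneg by (intro mult_right_mono)
    moreover have "(2::real) ^ n * (2 / 2 ^ N) \<le> 2"
      using power_increasing[OF assms(1), of "2::real"] by (simp add: field_simps)
    moreover have "2 * (cmod (2 ^ n) * (2 / cmod (2 ^ N) + 2 * ?\<rho>)) + 2
        = 2 * (2 ^ n * (2 / 2 ^ N)) + 4 * ((2 ^ n * cmod (lam_prod \<omega> m)) * B) + 2"
      by (simp add: norm_power algebra_simps)
    ultimately have "2 * (cmod (2 ^ n) * (2 / cmod (2 ^ N) + 2 * ?\<rho>)) + 2 \<le> 6 + 2 * B / R" by simp
    moreover have "0 < 2 * (cmod (2 ^ n) * (2 / cmod (2 ^ N) + 2 * ?\<rho>)) + 2"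
      using B_nonneg by (intro add_nonneg_pos) auto
    ultimately show ?thesis by (intro log_mono) auto
  qed
  moreover have "conv_entropy (nu \<omega> m) (tau \<omega> m) (\<lambda>y. y) (2 ^ N) \<le> G \<omega> M + c4 R"
    unfolding m_def M_def by (rule conv_entropy_tau_le_G[OF R assms(1)])
  moreover have "G \<omega> m \<le> rv_entropy (nu \<omega> m) (\<lambda>x. cell (2 ^ n * x)) + c4 R"
    unfolding m_def by (rule rv_entropy_nu_ge_G[OF R])
  moreover have "G ((shift ^^ m) \<omega>) (M - m) \<le> rv_entropy (tau \<omega> m) (\<lambda>x. cell (2 ^ N * x)) + c4 R"
    unfolding m_def M_def by (rule rv_entropy_tau_ge_G[OF R assms(1)])
  moreover have "m + (M - m) = M" using np_mono[OF R assms(1), of \<omega>] by (simp add: m_def M_def)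
  ultimately show ?thesis using c1_nonneg unfolding excess_def c5_def by simp
qed

lemma good_setI:
  assumes q: "0 < q" and n: "0 < n"
    and D: "2 * log 2 6 < \<delta> * (real q * real n)"
    and E: "excess (n_prime lam R \<omega> n) (n_prime lam R \<omega> ((q + 1) * n) - n_prime lam R \<omega> n) \<omega> + 3 * c4 R + c5
      + 2 * log 2 6 < \<epsilon> * (\<delta> * (real q * real n))"
  shows "\<omega> \<in> good_set lam k t p R \<epsilon> \<delta> q n"
proof -
  let ?m = "n_prime lam R \<omega> n"
  note t = scaled_eta_props[of "lam_prod \<omega> ?m" "(shift ^^ ?m) \<omega>", folded tau_eq_scaled_eta]
  have "comp_prob (nu \<omega> ?m) n (\<lambda>c. \<bar>dyadic_entropy (conv c (tau \<omega> ?m)) ((q + 1) * n)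
      - dyadic_entropy (tau \<omega> ?m) ((q + 1) * n)\<bar> < \<delta> * (real q * real n)) > 1 - \<epsilon>"
    by (rule comp_prob_gt[OF fin_supp_nu t bounded_cball components_le_excess D E]) simp
  moreover have "1 / (real q * real n) * x < \<delta> \<longleftrightarrow> x < \<delta> * (real q * real n)" for x
    using q n by (simp add: field_simps)
  ultimately show ?thesis by (simp add: good_set_def Let_def)
qed

lemma good_set_tendsto:
  assumes inv: "shift_invariant_ergodic P" and \<epsilon>: "0 < \<epsilon>" and \<delta>: "0 < \<delta>" and q: "0 < q"
  shows "(\<lambda>n. measure P (good_set lam k t p R \<epsilon> \<delta> q n)) \<longlonglongrightarrow> 1"
proof -
  note I = shift_invariant_ergodicD[OF inv]
  interpret prob_space P by (rule I(1))
  \<comment> \<open>\<gamma> n is the bound that Markov's inequality allows. A quarter of it goes to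
    the excess on the grid, a quarter to rounding, and half to the constants.\<close>
  define \<gamma> where "\<gamma> = \<epsilon> * \<delta> * real q"
  have \<gamma>: "0 < \<gamma>" using \<epsilon> \<delta> q by (simp add: \<gamma>_def)
  obtain c where c: "0 < c" "\<And>\<omega> n. real (n_prime lam R \<omega> n) \<le> c * (real n + 1)"
    using np_linear[OF R] by blast
  \<comment> \<open>L makes the grid so fine that rounding costs at most \<gamma> n / 4 plus a
    constant.\<close>
  obtain L :: nat where "4 * (c2 + c3) / \<gamma> < real L" using reals_Archimedean2 by blast
  moreover have "0 \<le> 4 * (c2 + c3) / \<gamma>" using c2_nonneg c3_nonneg \<gamma> by simp
  ultimately have L: "0 < L" "4 * (c2 + c3) < \<gamma> * real L" using \<gamma> by (auto simp: field_simps intro!: Nat.gr0I)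
  define s where "s n = n div L + 1" for n
  \<comment> \<open>J bounds the grid index of M: the factor q + 2 comes from (q + 1) n + 1 \<le> (q
    + 2) n in the linear bound on n', and the 1 from rounding up.\<close>
  obtain J :: nat where J: "c * (real q + 2) * real L + 1 < real J" using reals_Archimedean2 by blast
  define bad where "bad n = (\<Union>i\<le>J. \<Union>j\<le>J. {\<omega>. \<gamma> / 4 * real n \<le> excess (i * s n) (j * s n) \<omega>})" for n
  have bad_lim: "(\<lambda>n. prob (bad n)) \<longlonglongrightarrow> 0"
    unfolding bad_def s_def using \<gamma> L by (intro excess_grid_tendsto[OF inv]) auto
  \<comment> \<open>All terms independent of n; \<open>2 * (c2 + c3)\<close> arises because s n + 1
    = n div L + 2.\<close>
  define C where "C = 2 * c1 + 2 * (c2 + c3) + 3 * c4 R + c5 + 2 * log 2 6"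
  have good: "eventually (\<lambda>n. - bad n \<subseteq> good_set lam k t p R \<epsilon> \<delta> q n) sequentially"
  proof -
    have lin: "filterlim (\<lambda>n. b * real n) at_top sequentially" if "0 < b" for b
      using that by (intro filterlim_tendsto_pos_mult_at_top[OF tendsto_const] filterlim_real_sequentially)
    have "eventually (\<lambda>n. 2 * log 2 6 < \<delta> * real q * real n) sequentially"
      using lin[of "\<delta> * real q"] \<delta> q by (auto simp: filterlim_at_top_dense)
    moreover have "eventually (\<lambda>n. C < \<gamma> / 2 * real n) sequentially"
      using lin[of "\<gamma> / 2"] \<gamma> by (auto simp: filterlim_at_top_dense)
    ultimately show ?thesis using eventually_ge_at_top[of 1]
    proof eventually_elim
      fix n :: nat assume D: "2 * log 2 6 < \<delta> * real q * real n" and Cn: "C < \<gamma> / 2 * real n" and n: "1 \<le> n"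
      show "- bad n \<subseteq> good_set lam k t p R \<epsilon> \<delta> q n"
      proof
        fix \<omega> assume w: "\<omega> \<in> - bad n"
        define m where "m = n_prime lam R \<omega> n"
        define M where "M = n_prime lam R \<omega> ((q + 1) * n)"
        have mM: "m \<le> M" unfolding m_def M_def by (rule np_mono[OF R]) simp
        have s0: "0 < s n" by (simp add: s_def)
        have ns: "real n \<le> real L * real (s n)"
        proof -
          have "n \<le> L * s n"
            using dividend_less_div_times[OF L(1), of n] by (simp add: s_def algebra_simps)
          then show ?thesis by (metis of_nat_le_iff of_nat_mult)
        qed
        have "real M \<le> c * (real ((q + 1) * n) + 1)" unfolding M_def by (rule c)
        also have "\<dots> \<le> c * ((real q + 2) * real n)"
          using c(1) n by (intro mult_left_mono) (auto simp: algebra_simps)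
        also have "\<dots> \<le> c * ((real q + 2) * (real L * real (s n)))"
          using c(1) ns by (intro mult_left_mono) auto
        finally have "real M \<le> (c * (real q + 2) * real L) * real (s n)" by (simp add: algebra_simps)
        moreover have "real (M div s n) * real (s n) \<le> real M"
          by (metis of_nat_le_iff of_nat_mult div_times_less_eq_dividend)
        ultimately have "real (M div s n) * real (s n) \<le> (c * (real q + 2) * real L) * real (s n)" by linarith
        then have "real (M div s n) \<le> c * (real q + 2) * real L" using s0 by simp
        then have IJ: "M div s n + 1 \<le> J" using J by linarith
        moreover have "m div s n \<le> M div s n" using mM by (rule div_le_mono)
        ultimately have "m div s n \<le> J" "M div s n + 1 - m div s n \<le> J" by auto
        then have "excess (m div s n * s n) ((M div s n + 1 - m div s n) * s n) \<omega> < \<gamma> / 4 * real n"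
          using w unfolding bad_def by (auto simp: not_le)
        then have "excess m (M - m) \<omega> < \<gamma> / 4 * real n + 2 * c1 + (c2 + c3) * (real (s n) + 1)"
          using excess_le_grid[OF mM s0, of \<omega>] by linarith
        also have "(c2 + c3) * (real (s n) + 1) \<le> \<gamma> / 4 * real n + 2 * (c2 + c3)"
        proof -
          have "real (n div L) * real L \<le> real n" by (metis of_nat_le_iff of_nat_mult div_times_less_eq_dividend)
          then have "4 * (c2 + c3) * real (n div L) \<le> \<gamma> * real n"
          proof -
            have "4 * (c2 + c3) * real (n div L) \<le> \<gamma> * real L * real (n div L)"
              using L by (intro mult_right_mono) auto
            also have "\<dots> = \<gamma> * (real (n div L) * real L)" by simp
            also have "\<dots> \<le> \<gamma> * real n" using \<gamma> \<open>real (n div L) * real L \<le> real n\<close> by (intro mult_left_mono) auto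
            finally show ?thesis .
          qed
          then show ?thesis by (simp add: s_def algebra_simps)
        qed
        finally have "excess m (M - m) \<omega> + 3 * c4 R + c5 + 2 * log 2 6 < \<gamma> / 2 * real n + C"
          by (simp add: C_def)
        also have "\<dots> < \<gamma> * real n" using Cn by simp
        finally show "\<omega> \<in> good_set lam k t p R \<epsilon> \<delta> q n"
          using q n D by (intro good_setI) (auto simp: m_def M_def \<gamma>_def mult.assoc)
      qed
    qed
  qed
  have badP: "bad n \<in> sets P" for n
  proof -
    have "{\<omega>\<in>space seq_space. \<gamma> / 4 * real n \<le> excess i j \<omega>} \<in> sets seq_space" for i j
      using measurable_excess by measurable
    then show ?thesis unfolding bad_def I(2) by (auto intro!: sets.finite_UN)
  qed
  have lower: "eventually (\<lambda>n. 1 - prob (bad n) \<le> prob (good_set lam k t p R \<epsilon> \<delta> q n)) sequentially"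
    using good
  proof eventually_elim
    fix n assume sub: "- bad n \<subseteq> good_set lam k t p R \<epsilon> \<delta> q n"
    have "1 - prob (bad n) = prob (space P - bad n)" using prob_compl[OF badP] by simp
    also have "\<dots> \<le> prob (good_set lam k t p R \<epsilon> \<delta> q n)"
      using sub good_set_measurable[OF R] I by (intro finite_measure_mono) auto
    finally show "1 - prob (bad n) \<le> prob (good_set lam k t p R \<epsilon> \<delta> q n)" .
  qed
  show ?thesis
  proof (rule tendsto_sandwich[OF lower _ _ tendsto_const])
    show "(\<lambda>n. 1 - prob (bad n)) \<longlonglongrightarrow> 1" using tendsto_diff[OF tendsto_const bad_lim, of 1] by simp
  qed simp
qed

end

end

theorem proposition4p2:
  fixes lam :: "'i::finite \<Rightarrow> complex" and k :: "'i \<Rightarrow> nat"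
    and t :: "'i \<Rightarrow> nat \<Rightarrow> complex" and p :: "'i \<Rightarrow> nat \<Rightarrow> real"
    and P :: "(nat \<Rightarrow> 'i) measure" and R \<epsilon> \<delta> :: real and q :: nat
  assumes "planar_model lam k t p"
    and "shift_invariant_ergodic P"
    and "R > 0"
    and "\<forall>i. \<forall>j<k i. closure (ifs_map lam t i j ` ball 0 R) \<subseteq> ball 0 R"
    and "2 * R * (MIN i. cmod (lam i)) > 1 / 2"
    and "\<epsilon> > 0" and "\<delta> > 0"
  shows "(\<lambda>n. measure P (good_set lam k t p R \<epsilon> \<delta> q n)) \<longlonglongrightarrow> 1"
proof (cases "q = 0")
  case True
  interpret planar lam k t p using assms(1) by unfold_locales
  \<comment> \<open>With q = 0 the prefactor 1 / 0 is 0, so the inner condition reads 0 < \<delta>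
    and every sequence is good.\<close>
  have "good_set lam k t p R \<epsilon> \<delta> q n = UNIV" for n
    using True assms(6,7) prob_space.prob_space[OF prob_space_nu]
    by (auto simp: good_set_def Let_def comp_prob_def)
  then show ?thesis
    using prob_space.prob_space[OF shift_invariant_ergodicD(1)[OF assms(2)]] shift_invariant_ergodicD(3)[OF assms(2)]
    by simp
next
  case False
  interpret planar lam k t p using assms(1) by unfold_locales
  show ?thesis using good_set_tendsto[OF assms(3,2,6,7)] False by simp
qed

end
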